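(* Let $k\ge2$ be a fixed integer and let $d_N=N(N-1)/2$. Let $(H',H)$ be the exchangeable pair in which $H$ is uniformly distributed on the set $\mathfrak{T}_N$ of imaginary tournament matrices and, given $H$, the matrix $H'$ is obtained from $H$ by one step of the random walk with transition probability $\rho(H\to H')=1/d_N$ if $H$ and $H'$ differ in exactly one above-diagonal entry and $\rho(H\to H')=0$ otherwise. Let $$Y_n(H):=\operatorname{Tr}\Big(T_{2n}\Big(\tfrac{H}{\sqrt{4N}}\Big)\Big)-\mathbb{E}\Big[\operatorname{Tr}\Big(T_{2n}\Big(\tfrac{H}{\sqrt{4N}}\Big)\Big)\Big],\qquad \delta Y_n:=Y_n(H')-Y_n(H),$$ and define $R_n(H)$, $R_{nm}(H)$, $R_{nml}(H)$ by 1. $\frac{d_N}{4}\mathbb{E}[\delta Y_n|H]=-nY_n(H)+R_n(H)$, 2. $\frac{d_N}{4}\mathbb{E}[\delta Y_n\,\delta Y_m|H]=2n^2\delta_{nm}+R_{nm}(H)$, 3. $\frac{d_N}{4}\mathbb{E}[|\delta Y_n\,\delta Y_m\,\delta Y_l|\,|H]=R_{nml}(H)$, where $\delta_{nm}$ is the Kronecker delta. Then, as $N\to\infty$, $\mathbb{E}|R_n(H)|=\mathcal{O}(N^{-1})$, $\mathbb{E}|R_{nm}(H)|=\mathcal{O}(N^{-1})$ and $\mathbb{E}|R_{nml}(H)|=\mathcal{O}(N^{-1})$ for all $n,m,l=2,\ldots,k$.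
   Context: An $N\times N$ imaginary tournament matrix is a self-adjoint matrix $H$ with $H_{pp}=0$ for all $p$ and $H_{pq}=\overline{H_{qp}}=-H_{qp}\in\{+i,-i\}$ for all $p\neq q$ (here $i=\sqrt{-1}$); $\mathfrak{T}_N$ is the set of all of them. The imaginary tournament ensemble (ITE) is $\mathfrak{T}_N$ with the uniform probability measure; unconditional expectations of functions of $H$ are taken in this ensemble. One step of the random walk: choose one of the $d_N$ pairs $p<q$ uniformly at random and change the signs of $H_{pq}$ and $H_{qp}$. The uniform measure is stationary and the pair $(H,H')$ is exchangeable. $T_n(x)=\cos(n\arccos x)$ is the Chebyshev polynomial of the first kind. *)

theory Defs
  imports
    "HOL-Probability.Probability"
    "HOL-Library.Landau_Symbols"
    "Jordan_Normal_Form.Schur_Decomposition"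
begin

section \<open>Chebyshev polynomials of the first kind\<close>

text \<open>
  The polynomial, rather than the function \<open>cos (n arccos x)\<close> itself, is needed, because the
  rescaled matrices below may have eigenvalues outside \<open>[-1, 1]\<close>.
\<close>

definition chebyshev :: "nat \<Rightarrow> real poly" where
  "chebyshev n = (THE p. \<forall>x\<in>{-1..1}. poly p x = cos (real n * arccos x))"

fun chebyshev_rec :: "nat \<Rightarrow> real poly" where
  "chebyshev_rec 0 = 1"
| "chebyshev_rec (Suc 0) = [:0, 1:]"
| "chebyshev_rec (Suc (Suc n)) = [:0, 2:] * chebyshev_rec (Suc n) - chebyshev_rec n"

lemma poly_chebyshev_rec_cos: "poly (chebyshev_rec n) (cos t) = cos (real n * t)"
proof (induction n rule: chebyshev_rec.induct)
  case (3 n)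
  have a: "real (Suc (Suc n)) * t = real (Suc n) * t + t"
    and b: "real n * t = real (Suc n) * t - t"
    by (simp_all add: algebra_simps)
  have "cos (real (Suc (Suc n)) * t) = 2 * cos t * cos (real (Suc n) * t) - cos (real n * t)"
    unfolding a b cos_add cos_diff by simp
  then show ?case using 3 by simp
qed simp_all

lemma chebyshev_unique:
  assumes "\<forall>x\<in>{-1..1}. poly p x = cos (real n * arccos x)"
    and "\<forall>x\<in>{-1..1}. poly q x = cos (real n * arccos x)"
  shows "p = q"
proof (rule ccontr)
  assume "p \<noteq> q"
  then have "finite {x. poly (p - q) x = 0}"
    by (intro poly_roots_finite) simp
  moreover have "{-1..1} \<subseteq> {x. poly (p - q) x = 0}"
    using assms by auto
  ultimately have "finite {-1..1::real}"
    by (rule finite_subset[rotated])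
  then show False by (simp add: infinite_Icc)
qed

lemma chebyshev_eq_rec: "chebyshev n = chebyshev_rec n"
proof -
  have *: "\<forall>x\<in>{-1..1}. poly (chebyshev_rec n) x = cos (real n * arccos x)"
  proof
    fix x :: real assume "x \<in> {-1..1}"
    then show "poly (chebyshev_rec n) x = cos (real n * arccos x)"
      using poly_chebyshev_rec_cos[of n "arccos x"] by simp
  qed
  show ?thesis
    unfolding chebyshev_def
    using * chebyshev_unique by (intro the_equality) blast+
qed

lemma poly_chebyshev: "x \<in> {-1..1} \<Longrightarrow> poly (chebyshev n) x = cos (real n * arccos x)"
  using poly_chebyshev_rec_cos[of n "arccos x"] by (simp add: chebyshev_eq_rec)

section \<open>Polynomials of matrices and traces\<close>

text \<open>
  Matrices of a fixed size do not form a type here, so the sum of the powers of \<open>A\<close> is taken entrywise.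
\<close>

definition poly_mat :: "complex poly \<Rightarrow> complex mat \<Rightarrow> complex mat" where
  "poly_mat p A = mat (dim_row A) (dim_row A)
     (\<lambda>(i, j). \<Sum>k\<le>degree p. coeff p k * (A ^\<^sub>m k) $$ (i, j))"

definition mat_trace :: "complex mat \<Rightarrow> complex" where
  "mat_trace A = (\<Sum>i<dim_row A. A $$ (i, i))"

section \<open>The imaginary tournament ensemble and its random walk\<close>

text \<open>Rows and columns are numbered \<open>0, \<dots>, N - 1\<close>.\<close>

definition imag_tournaments :: "nat \<Rightarrow> complex mat set" where
  "imag_tournaments N = {H \<in> carrier_mat N N. mat_adjoint H = H \<and>
     (\<forall>p<N. H $$ (p, p) = 0) \<and>
     (\<forall>p<N. \<forall>q<N. p \<noteq> q \<longrightarrow>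
        H $$ (p, q) = cnj (H $$ (q, p)) \<and> cnj (H $$ (q, p)) = - H $$ (q, p) \<and>
        H $$ (p, q) \<in> {\<i>, - \<i>})}"

definition ite :: "nat \<Rightarrow> complex mat pmf" where
  "ite N = pmf_of_set (imag_tournaments N)"

definition d_N :: "nat \<Rightarrow> real" where
  "d_N N = real N * (real N - 1) / 2"

definition flip_sign :: "nat \<Rightarrow> nat \<Rightarrow> complex mat \<Rightarrow> complex mat" where
  "flip_sign p q H = mat (dim_row H) (dim_col H)
     (\<lambda>(i, j). if (i, j) = (p, q) \<or> (i, j) = (q, p) then - H $$ (i, j) else H $$ (i, j))"

definition upper_pairs :: "nat \<Rightarrow> (nat \<times> nat) set" where
  "upper_pairs N = {(p, q). p < q \<and> q < N}"

definition walk_step :: "nat \<Rightarrow> complex mat \<Rightarrow> complex mat pmf" where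
  "walk_step N H = map_pmf (\<lambda>(p, q). flip_sign p q H) (pmf_of_set (upper_pairs N))"

text \<open>The joint law of \<open>(H', H)\<close>; the first component is the matrix after the step.\<close>

definition exch_pair :: "nat \<Rightarrow> (complex mat \<times> complex mat) pmf" where
  "exch_pair N = bind_pmf (ite N) (\<lambda>H. map_pmf (\<lambda>H'. (H', H)) (walk_step N H))"

text \<open>
  \<open>cond_exp_H N f H\<close> is the conditional expectation of \<open>f (H', H)\<close> given that the second component
  equals \<open>H\<close>. It is meaningful for \<open>N \<ge> 2\<close> and \<open>H \<in> imag_tournaments N\<close>, where the
  conditioning event has positive probability.
\<close>

definition cond_exp_H ::
    "nat \<Rightarrow> (complex mat \<Rightarrow> complex mat \<Rightarrow> 'b::{banach, second_countable_topology}) \<Rightarrow>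
     complex mat \<Rightarrow> 'b" where
  "cond_exp_H N f H =
     measure_pmf.expectation (cond_pmf (exch_pair N) {\<omega>. snd \<omega> = H}) (\<lambda>(H', H). f H' H)"

lemma mat_adjoint_index:
  assumes "i < dim_col A" "j < dim_row A"
  shows "mat_adjoint A $$ (i, j) = conjugate (A $$ (j, i))"
  using assms by (simp add: mat_adjoint_def mat_of_rows_index)

lemma mat_adjoint_dim: "dim_row (mat_adjoint A) = dim_col A" "dim_col (mat_adjoint A) = dim_row A"
  by (simp_all add: mat_adjoint_def)

lemma imag_tournaments_iff:
  "H \<in> imag_tournaments N \<longleftrightarrow> dim_row H = N \<and> dim_col H = N \<and> (\<forall>p<N. H $$ (p, p) = 0) \<and>
     (\<forall>p<N. \<forall>q<N. p \<noteq> q \<longrightarrow> H $$ (q, p) = - H $$ (p, q) \<and> H $$ (p, q) \<in> {\<i>, - \<i>})"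
  (is "_ \<longleftrightarrow> ?R")
proof
  assume "H \<in> imag_tournaments N"
  then show ?R unfolding imag_tournaments_def carrier_mat_def mem_Collect_eq by metis
next
  assume R: ?R
  have "mat_adjoint H = H"
  proof (rule eq_matI)
    fix i j assume "i < dim_row H" "j < dim_col H"
    moreover have "dim_row H = N" "dim_col H = N" using R by blast+
    ultimately have ij: "i < N" "j < N" by simp_all
    show "mat_adjoint H $$ (i, j) = H $$ (i, j)"
    proof (cases "i = j")
      case True
      moreover have "dim_row H = N" "dim_col H = N" "H $$ (i, i) = 0" using R ij by blast+
      ultimately show ?thesis using ij by (simp add: mat_adjoint_index)
    next
      case False
      then have "H $$ (j, i) = - H $$ (i, j)" "H $$ (i, j) \<in> {\<i>, - \<i>}"
        using R ij by blast+
      moreover have "dim_row H = N" "dim_col H = N" using R by blast+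
      ultimately show ?thesis using ij by (auto simp: mat_adjoint_index)
    qed
  qed (use R in \<open>simp_all only: mat_adjoint_dim\<close>)
  moreover have "H $$ (p, q) = cnj (H $$ (q, p)) \<and> cnj (H $$ (q, p)) = - H $$ (q, p) \<and>
      H $$ (p, q) \<in> {\<i>, - \<i>}" if "p < N" "q < N" "p \<noteq> q" for p q
  proof -
    have "H $$ (q, p) = - H $$ (p, q)" "H $$ (p, q) \<in> {\<i>, - \<i>}" using R that by blast+
    then show ?thesis by auto
  qed
  ultimately show "H \<in> imag_tournaments N"
    unfolding imag_tournaments_def carrier_mat_def using R by blast
qed

lemma imag_tournamentsD:
  assumes "H \<in> imag_tournaments N"
  shows "dim_row H = N" "dim_col H = N"
    and "p < N \<Longrightarrow> H $$ (p, p) = 0"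
    and "p < N \<Longrightarrow> q < N \<Longrightarrow> p \<noteq> q \<Longrightarrow> H $$ (q, p) = - H $$ (p, q)"
    and "p < N \<Longrightarrow> q < N \<Longrightarrow> p \<noteq> q \<Longrightarrow> H $$ (p, q) = \<i> \<or> H $$ (p, q) = - \<i>"
  using assms unfolding imag_tournaments_iff by blast+

lemma finite_imag_tournaments: "finite (imag_tournaments N)"
proof -
  have "imag_tournaments N \<subseteq> (\<lambda>f. mat N N f) ` (({..<N} \<times> {..<N}) \<rightarrow>\<^sub>E {0, \<i>, - \<i>})"
  proof
    fix H assume H: "H \<in> imag_tournaments N"
    define f where "f = restrict (\<lambda>x. H $$ x) ({..<N} \<times> {..<N})"
    have "H = mat N N f"
      using imag_tournamentsD(1,2)[OF H] by (intro eq_matI) (auto simp: f_def)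
    moreover have "f \<in> ({..<N} \<times> {..<N}) \<rightarrow>\<^sub>E {0, \<i>, - \<i>}"
    proof (rule PiE_I)
      fix x assume "x \<in> {..<N} \<times> {..<N}"
      moreover obtain p q where "x = (p, q)" by (cases x)
      ultimately show "f x \<in> {0, \<i>, - \<i>}"
        using imag_tournamentsD(3,5)[OF H] unfolding f_def by (cases "p = q") auto
    qed (simp add: f_def)
    ultimately show "H \<in> (\<lambda>f. mat N N f) ` (({..<N} \<times> {..<N}) \<rightarrow>\<^sub>E {0, \<i>, - \<i>})"
      by blast
  qed
  moreover have "finite (({..<N} \<times> {..<N}) \<rightarrow>\<^sub>E {0, \<i>, - \<i>})"
    by (intro finite_PiE) auto
  ultimately show ?thesis
    using finite_surj by blast
qed

lemma imag_tournaments_nonempty: "imag_tournaments N \<noteq> {}"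
proof -
  have "mat N N (\<lambda>(p, q). if p = q then 0 else if p < q then \<i> else - \<i>) \<in> imag_tournaments N"
    unfolding imag_tournaments_iff by auto
  then show ?thesis by blast
qed

lemma set_pmf_ite: "set_pmf (ite N) = imag_tournaments N"
  unfolding ite_def by (intro set_pmf_of_set imag_tournaments_nonempty finite_imag_tournaments)

lemma finite_upper_pairs: "finite (upper_pairs N)"
  by (rule finite_subset[of _ "{..<N} \<times> {..<N}"]) (auto simp: upper_pairs_def)

lemma card_upper_pairs: "real (card (upper_pairs N)) = d_N N"
proof -
  have "upper_pairs N = (SIGMA q:{..<N}. {..<q})\<inverse>"
    by (auto simp: upper_pairs_def)
  then have "card (upper_pairs N) = (\<Sum>q<N. q)"
    by (simp add: card_SigmaI)
  also have "real \<dots> = d_N N"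
    by (induction N) (simp_all add: d_N_def field_simps)
  finally show ?thesis .
qed

lemma upper_pairs_nonempty: "N \<ge> 2 \<Longrightarrow> upper_pairs N \<noteq> {}"
proof -
  assume "N \<ge> 2"
  then have "(0, 1) \<in> upper_pairs N" by (simp add: upper_pairs_def)
  then show ?thesis by blast
qed

lemma flip_sign_upper_diff:
  assumes "H \<in> imag_tournaments N" "(p, q) \<in> upper_pairs N"
  shows "{(i, j) \<in> upper_pairs N. H $$ (i, j) \<noteq> flip_sign p q H $$ (i, j)} = {(p, q)}"
proof -
  have nz: "H $$ (p, q) \<noteq> - H $$ (p, q)"
    using assms(2) imag_tournamentsD(5)[OF assms(1), of p q] by (auto simp: upper_pairs_def)
  have fl: "flip_sign p q H $$ (i, j) = (if (i, j) = (p, q) then - H $$ (i, j) else H $$ (i, j))"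
    if "(i, j) \<in> upper_pairs N" for i j
    using that assms(2) imag_tournamentsD(1,2)[OF assms(1)]
    by (auto simp: upper_pairs_def flip_sign_def)
  have "(i, j) \<in> upper_pairs N \<and> H $$ (i, j) \<noteq> flip_sign p q H $$ (i, j) \<longleftrightarrow> (i, j) = (p, q)"
    for i j
    using fl[of i j] assms(2) nz
    by (cases "(i, j) = (p, q)"; cases "(i, j) \<in> upper_pairs N") (simp_all split: if_splits)
  then have "{(i, j). (i, j) \<in> upper_pairs N \<and> H $$ (i, j) \<noteq> flip_sign p q H $$ (i, j)} =
      {(i, j). (i, j) = (p, q)}"
    by (simp only:)
  also have "\<dots> = {(p, q)}" by blast
  finally show ?thesis .
qed

lemma flip_sign_imag_tournaments:
  assumes "H \<in> imag_tournaments N" "(p, q) \<in> upper_pairs N"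
  shows "flip_sign p q H \<in> imag_tournaments N"
proof -
  have "p < q" using assms(2) by (simp add: upper_pairs_def)
  then have "dim_row (flip_sign p q H) = N \<and> dim_col (flip_sign p q H) = N \<and>
      (\<forall>i<N. flip_sign p q H $$ (i, i) = 0)"
    using imag_tournamentsD(1,2,3)[OF assms(1)] by (auto simp: flip_sign_def)
  moreover have "flip_sign p q H $$ (j, i) = - flip_sign p q H $$ (i, j) \<and>
      flip_sign p q H $$ (i, j) \<in> {\<i>, - \<i>}" if "i < N" "j < N" "i \<noteq> j" for i j
    using that imag_tournamentsD(4,5)[OF assms(1) that] imag_tournamentsD(1,2)[OF assms(1)]
    by (auto simp: flip_sign_def)
  ultimately show ?thesis
    unfolding imag_tournaments_iff by blast
qed

lemma flip_sign_image:
  assumes H: "H \<in> imag_tournaments N"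
  shows "(\<lambda>(p, q). flip_sign p q H) ` upper_pairs N =
    {H' \<in> imag_tournaments N. card {(i, j) \<in> upper_pairs N. H $$ (i, j) \<noteq> H' $$ (i, j)} = 1}"
    (is "?A = ?B")
proof
  show "?A \<subseteq> ?B"
  proof
    fix H' assume "H' \<in> ?A"
    then obtain p q where pq: "(p, q) \<in> upper_pairs N" and H': "H' = flip_sign p q H" by auto
    show "H' \<in> ?B"
      unfolding H' mem_Collect_eq flip_sign_upper_diff[OF H pq]
      using flip_sign_imag_tournaments[OF H pq] by simp
  qed
  show "?B \<subseteq> ?A"
  proof
    fix H' assume "H' \<in> ?B"
    then have H': "H' \<in> imag_tournaments N"
      and "card {(i, j) \<in> upper_pairs N. H $$ (i, j) \<noteq> H' $$ (i, j)} = 1"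
      by (simp_all only: mem_Collect_eq)
    then obtain x where "{(i, j) \<in> upper_pairs N. H $$ (i, j) \<noteq> H' $$ (i, j)} = {x}"
      unfolding One_nat_def card_1_singleton_iff by blast
    moreover obtain p q where "x = (p, q)" by (cases x)
    ultimately have eq: "{(i, j) \<in> upper_pairs N. H $$ (i, j) \<noteq> H' $$ (i, j)} = {(p, q)}" by simp
    have "(p, q) \<in> {(i, j) \<in> upper_pairs N. H $$ (i, j) \<noteq> H' $$ (i, j)}"
      unfolding eq by (rule singletonI)
    then have pq: "(p, q) \<in> upper_pairs N" "H $$ (p, q) \<noteq> H' $$ (p, q)" by simp_all
    have same: "H' $$ (i, j) = H $$ (i, j)" if "i < j" "j < N" "(i, j) \<noteq> (p, q)" for i j
    proof (rule ccontr)
      assume "H' $$ (i, j) \<noteq> H $$ (i, j)"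
      then have "(i, j) \<in> {(i, j) \<in> upper_pairs N. H $$ (i, j) \<noteq> H' $$ (i, j)}"
        using that by (auto simp: upper_pairs_def)
      then have "(i, j) \<in> {(p, q)}" by (simp only: eq)
      then show False using that(3) by (simp only: singleton_iff)
    qed
    have lt: "p < N" "q < N" "p \<noteq> q" using pq(1) by (auto simp: upper_pairs_def)
    have neg: "H' $$ (p, q) = - H $$ (p, q)"
      using imag_tournamentsD(5)[OF H lt] imag_tournamentsD(5)[OF H' lt] pq(2)
      by (elim disjE) simp_all
    note dims = imag_tournamentsD(1,2)[OF H] imag_tournamentsD(1,2)[OF H']
    have "H' = flip_sign p q H"
    proof (rule eq_matI)
      fix i j assume "i < dim_row (flip_sign p q H)" "j < dim_col (flip_sign p q H)"
      then have ij: "i < N" "j < N" using dims by (auto simp: flip_sign_def)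
      have "p < q" "q < N" using pq by (auto simp: upper_pairs_def)
      consider "i = j" | "i < j" | "j < i" by linarith
      then show "H' $$ (i, j) = flip_sign p q H $$ (i, j)"
      proof cases
        case 1
        then show ?thesis
          using ij dims \<open>p < q\<close> imag_tournamentsD(3)[OF H] imag_tournamentsD(3)[OF H']
          by (auto simp: flip_sign_def)
      next
        case 2
        then show ?thesis using same[of i j] neg ij dims \<open>p < q\<close> by (auto simp: flip_sign_def)
      next
        case 3
        then have "j \<noteq> i" by simp
        note imag_tournamentsD(4)[OF H ij(2,1) this] imag_tournamentsD(4)[OF H' ij(2,1) this]
        then show ?thesis using 3 same[of j i] neg ij dims \<open>p < q\<close> by (auto simp: flip_sign_def)
      qed
    qed (use dims in \<open>auto simp: flip_sign_def\<close>)
    then have "H' = (case (p, q) of (p, q) \<Rightarrow> flip_sign p q H)" by simp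
    then show "H' \<in> ?A" using pq(1) by (rule image_eqI)
  qed
qed

lemma transition_probability:
  assumes "N \<ge> 2" and H: "H \<in> imag_tournaments N"
  shows "pmf (walk_step N H) H' =
    (if H' \<in> imag_tournaments N \<and>
        card {(i, j) \<in> upper_pairs N. H $$ (i, j) \<noteq> H' $$ (i, j)} = 1
     then 1 / d_N N else 0)"
proof -
  have inj: "inj_on (\<lambda>(p, q). flip_sign p q H) (upper_pairs N)"
  proof (rule inj_onI)
    fix x y assume xy: "x \<in> upper_pairs N" "y \<in> upper_pairs N"
      and eq: "(case x of (p, q) \<Rightarrow> flip_sign p q H) = (case y of (p, q) \<Rightarrow> flip_sign p q H)"
    obtain p q where x: "x = (p, q)" by (cases x)
    obtain p' q' where y: "y = (p', q')" by (cases y)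
    have "flip_sign p q H = flip_sign p' q' H" using eq by (simp add: x y)
    from flip_sign_upper_diff[OF H xy(1)[unfolded x], unfolded this]
      flip_sign_upper_diff[OF H xy(2)[unfolded y]]
    have "{(p, q)} = {(p', q')}" by (rule trans[OF sym])
    then show "x = y" by (simp add: x y)
  qed
  have fin: "finite (upper_pairs N)" and ne: "upper_pairs N \<noteq> {}"
    using finite_upper_pairs upper_pairs_nonempty[OF \<open>N \<ge> 2\<close>] by auto
  have "walk_step N H = pmf_of_set ((\<lambda>(p, q). flip_sign p q H) ` upper_pairs N)"
    unfolding walk_step_def by (rule map_pmf_of_set_inj[OF inj ne fin])
  also have "pmf \<dots> H' = indicator ((\<lambda>(p, q). flip_sign p q H) ` upper_pairs N) H' / d_N N"
    using fin ne by (simp add: card_image[OF inj] card_upper_pairs)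
  finally show ?thesis
    unfolding flip_sign_image[OF H] by (simp add: indicator_def)
qed

lemma pmf_map_Pair:
  "pmf (map_pmf (\<lambda>x. (x, b)) M) (x, y) = (if y = b then pmf M x else 0)"
proof (cases "y = b")
  case True
  have "inj (\<lambda>x. (x, b))" by (simp add: inj_on_def)
  from pmf_map_inj'[OF this, of M x] True show ?thesis by simp
next
  case False
  then have "(x, y) \<notin> (\<lambda>x. (x, b)) ` set_pmf M" by blast
  from pmf_map_outside[OF this] False show ?thesis by simp
qed

lemma pmf_exch_pair: "pmf (exch_pair N) (H', H) = pmf (ite N) H * pmf (walk_step N H) H'"
proof -
  have "pmf (exch_pair N) (H', H) =
      measure_pmf.expectation (ite N) (\<lambda>K. if H = K then pmf (walk_step N K) H' else 0)"
    unfolding exch_pair_def pmf_bind pmf_map_Pair ..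
  also have "\<dots> = measure_pmf.expectation (ite N)
      (\<lambda>K. indicator {H} K * pmf (walk_step N H) H')"
    by (intro Bochner_Integration.integral_cong refl) (simp add: indicator_def)
  also have "\<dots> = pmf (ite N) H * pmf (walk_step N H) H'"
    by (simp add: measure_pmf_single)
  finally show ?thesis .
qed

lemma exchangeable:
  assumes "N \<ge> 2"
  shows "map_pmf prod.swap (exch_pair N) = exch_pair N"
proof (rule pmf_eqI)
  fix x :: "complex mat \<times> complex mat"
  obtain A B where x: "x = (A, B)" by (cases x)
  have "pmf (map_pmf prod.swap (exch_pair N)) (prod.swap (B, A)) = pmf (exch_pair N) (B, A)"
    by (rule pmf_map_inj') simp
  moreover have "pmf (exch_pair N) (B, A) = pmf (exch_pair N) (A, B)"
  proof -
    have "{(i, j) \<in> upper_pairs N. A $$ (i, j) \<noteq> B $$ (i, j)} =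
        {(i, j) \<in> upper_pairs N. B $$ (i, j) \<noteq> A $$ (i, j)}" by auto
    then show ?thesis
      using transition_probability[OF assms] imag_tournaments_nonempty[of N]
        finite_imag_tournaments[of N]
      unfolding pmf_exch_pair
      by (cases "A \<in> imag_tournaments N"; cases "B \<in> imag_tournaments N") (simp_all add: ite_def)
  qed
  ultimately show "pmf (map_pmf prod.swap (exch_pair N)) x = pmf (exch_pair N) x"
    by (simp add: x)
qed

lemma cond_exp_H_eq:
  assumes H: "H \<in> imag_tournaments N"
  shows "cond_exp_H N f H = measure_pmf.expectation (walk_step N H) (\<lambda>H'. f H' H)"
proof -
  have snd: "map_pmf snd (exch_pair N) = ite N"
    unfolding exch_pair_def by (simp add: map_bind_pmf pmf.map_comp o_def bind_return_pmf')
  have "snd -` {H} = {\<omega> :: complex mat \<times> complex mat. snd \<omega> = H}" by auto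
  then have meas: "measure (exch_pair N) {\<omega>. snd \<omega> = H} = pmf (ite N) H"
    using pmf_map[of snd "exch_pair N" H] unfolding snd by simp
  have pos: "pmf (ite N) H > 0"
    using H by (simp add: pmf_positive_iff set_pmf_ite)
  have "H \<in> snd ` set_pmf (exch_pair N)"
    using H unfolding set_map_pmf[symmetric] snd set_pmf_ite .
  then have ne: "set_pmf (exch_pair N) \<inter> {\<omega>. snd \<omega> = H} \<noteq> {}" by blast
  have "cond_pmf (exch_pair N) {\<omega>. snd \<omega> = H} = map_pmf (\<lambda>H'. (H', H)) (walk_step N H)"
  proof (rule pmf_eqI)
    fix x :: "complex mat \<times> complex mat"
    obtain A B where x: "x = (A, B)" by (cases x)
    show "pmf (cond_pmf (exch_pair N) {\<omega>. snd \<omega> = H}) x =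
        pmf (map_pmf (\<lambda>H'. (H', H)) (walk_step N H)) x"
      using pos by (simp add: x pmf_cond[OF ne] meas pmf_exch_pair pmf_map_Pair)
  qed
  then show ?thesis unfolding cond_exp_H_def by simp
qed

section \<open>The linear statistics and the remainders\<close>

text \<open>
  The traces are real numbers, kept in type \<open>complex\<close>; absolute values below are therefore \<open>cmod\<close>.
\<close>

definition cheb_trace :: "nat \<Rightarrow> nat \<Rightarrow> complex mat \<Rightarrow> complex" where
  "cheb_trace N n H = mat_trace
     (poly_mat (map_poly complex_of_real (chebyshev (2 * n)))
        (complex_of_real (1 / sqrt (4 * real N)) \<cdot>\<^sub>m H))"

definition Y_stat :: "nat \<Rightarrow> nat \<Rightarrow> complex mat \<Rightarrow> complex" where
  "Y_stat N n H = cheb_trace N n H - measure_pmf.expectation (ite N) (cheb_trace N n)"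

definition deltaY :: "nat \<Rightarrow> nat \<Rightarrow> complex mat \<Rightarrow> complex mat \<Rightarrow> complex" where
  "deltaY N n H' H = Y_stat N n H' - Y_stat N n H"

definition R_n :: "nat \<Rightarrow> nat \<Rightarrow> complex mat \<Rightarrow> complex" where
  "R_n N n H = of_real (d_N N / 4) * cond_exp_H N (deltaY N n) H + of_nat n * Y_stat N n H"

definition R_nm :: "nat \<Rightarrow> nat \<Rightarrow> nat \<Rightarrow> complex mat \<Rightarrow> complex" where
  "R_nm N n m H = of_real (d_N N / 4) * cond_exp_H N (\<lambda>H' H. deltaY N n H' H * deltaY N m H' H) H
     - 2 * of_nat n ^ 2 * (if n = m then 1 else 0)"

definition R_nml :: "nat \<Rightarrow> nat \<Rightarrow> nat \<Rightarrow> nat \<Rightarrow> complex mat \<Rightarrow> real" where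
  "R_nml N n m l H =
     d_N N / 4 * cond_exp_H N (\<lambda>H' H. cmod (deltaY N n H' H * deltaY N m H' H * deltaY N l H' H)) H"

end

(*
  The trace of T_2n(H / sqrt (4N)) equals 1/2 N^-n times a signed sum over cyclically non-backtracking
  closed walks of length 2n, plus a combination with O(1/N) coefficients of the normalised sums for shorter
  walks, plus a constant. A walk w contributes the monomial chi_w in the signs of H, which depends only, up
  to a sign, on the edges that w uses an odd number of times, and the generator of the random walk acts on
  chi_w as multiplication by -1/2 times the number of these odd edges. Hence R_n only involves walks with a
  repeated edge and the shorter walks. All second and fourth moments reduce to counting pairs or quadruples
  of walks in which every edge is used an even number of times in total, i.e. to bounding the number of
  vertices of such a configuration. The leading part of R_nm comes from the 4n rotations and reflections of
  a simple cycle, and R_nml is bounded by interpolating between second and fourth moments.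
*)

theory Submission
  imports Defs
begin

section \<open>Closed non-backtracking walks as passage systems\<close>

text \<open>First moments are bounded through \<open>2 * |f| <= N * f^2 + 1 / N\<close>, so a
  remainder of order 1/N needs a second moment of order \<open>N^-2\<close>: configurations must
  have two vertices fewer than if every vertex were visited exactly twice. For two connected
  families of walks with the same odd edges, the vertices on these edges are common to both, and
  inclusion-exclusion cancels them; what each family has to supply is an excess of 2. An excess of 1
  is immediate but would end at \<open>N^(-1/2)\<close>; the second unit comes from a divisibility
  argument modulo 4.

  The shorter walks arise from a mismatch of scales. Vertices of the complete graph have degree N -
  1, so non-backtracking walks follow the Chebyshev recursion with parameter N - 2, for which traces
  telescope exactly to cyclic walks, while the matrix is scaled by N. The coefficients are O(1/N)
  because the two parameters differ by a constant.

  The limit \<open>2 * n^2\<close> is 4n rotations and reflections times 2n common edges times 4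
  from two sign changes, divided by 16 (a half in each factor, and the prefactor 1/4).\<close>

definition mk_edge :: "nat \<Rightarrow> nat \<Rightarrow> nat \<times> nat" where
  "mk_edge x y = (min x y, max x y)"

definition on_edge :: "nat \<Rightarrow> nat \<times> nat \<Rightarrow> bool" where
  "on_edge x E \<longleftrightarrow> x = fst E \<or> x = snd E"

lemma mk_edge_commute: "mk_edge x y = mk_edge y x"
  by (auto simp: mk_edge_def min_def max_def)

lemma mk_edge_eq_iff: "mk_edge x y = mk_edge x' y' \<longleftrightarrow> (x = x' \<and> y = y') \<or> (x = y' \<and> y = x')"
  by (auto simp: mk_edge_def min_def max_def split: if_splits)

lemma on_edge_mk_edge: "on_edge z (mk_edge x y) \<longleftrightarrow> z = x \<or> z = y"
  by (auto simp: on_edge_def mk_edge_def min_def max_def)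

text \<open>The permutation \<open>nx\<close> may have several cycles, so one instance covers a
  single closed walk as well as a tuple of closed walks, whose edge multiplicities then add
  up.\<close>

locale passage_system =
  fixes I :: "'i set" and nx :: "'i \<Rightarrow> 'i" and v :: "'i \<Rightarrow> nat"
  assumes finI: "finite I"
    and nx_bij: "bij_betw nx I I"
    and step: "i \<in> I \<Longrightarrow> v i \<noteq> v (nx i)"
    and non_backtracking: "i \<in> I \<Longrightarrow> v i \<noteq> v (nx (nx i))"
begin

definition e :: "'i \<Rightarrow> nat \<times> nat" where "e i = mk_edge (v i) (v (nx i))"
definition mu :: "nat \<times> nat \<Rightarrow> nat" where "mu E = card {i \<in> I. e i = E}"
definition occ :: "nat \<Rightarrow> nat" where "occ x = card {i \<in> I. v i = x}"

lemma nx_in: "i \<in> I \<Longrightarrow> nx i \<in> I"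
  using nx_bij by (auto simp: bij_betw_def)

lemma e_nx_neq: "i \<in> I \<Longrightarrow> e i \<noteq> e (nx i)"
  using step[of i] non_backtracking[of i] by (auto simp: e_def mk_edge_eq_iff)

lemma card_nx: "card {i \<in> I. P (nx i)} = card {j \<in> I. P j}"
proof -
  have "bij_betw nx {i \<in> I. P (nx i)} {j \<in> I. P j}"
    using nx_bij by (auto simp: bij_betw_def inj_on_def)
  then show ?thesis by (rule bij_betw_same_card)
qed

lemma sum_nx: "(\<Sum>i\<in>I. f (nx i)) = (\<Sum>i\<in>I. f i)"
  using sum.reindex_bij_betw[OF nx_bij] .

text \<open>A passage through \<open>x\<close> is indexed by the \<open>i\<close> with \<open>v (nx i) = x\<close>; it enters along \<open>e i\<close> and leaves
  along \<open>e (nx i)\<close>.\<close>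

lemma card_passages: "card {i \<in> I. v (nx i) = x} = occ x"
  unfolding occ_def by (rule card_nx)

text \<open>No step is a loop, so each traversal of \<open>E\<close> has exactly one end at
  \<open>x\<close> and belongs to one passage there. Since nothing backtracks, no passage enters and
  leaves along the same edge, and the correspondence is one to one.\<close>

lemma mu_passages:
  assumes "on_edge x E"
  shows "mu E = card {i \<in> I. v (nx i) = x \<and> (e i = E \<or> e (nx i) = E)}"
proof -
  have "{i \<in> I. e i = E} = {i \<in> I. v (nx i) = x \<and> e i = E} \<union> {i \<in> I. v i = x \<and> e i = E}"
    using assms by (auto simp: e_def on_edge_mk_edge)
  moreover have "{i \<in> I. v (nx i) = x \<and> e i = E} \<inter> {i \<in> I. v i = x \<and> e i = E} = {}"
    using step by fastforce
  ultimately have "mu E = card {i \<in> I. v (nx i) = x \<and> e i = E} + card {i \<in> I. v i = x \<and> e i = E}"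
    unfolding mu_def using finI by (simp add: card_Un_disjoint)
  also have "card {i \<in> I. v i = x \<and> e i = E} = card {i \<in> I. v (nx i) = x \<and> e (nx i) = E}"
    by (rule card_nx[symmetric, where P = "\<lambda>i. v i = x \<and> e i = E"])
  also have "card {i \<in> I. v (nx i) = x \<and> e i = E} + \<dots> =
      card ({i \<in> I. v (nx i) = x \<and> e i = E} \<union> {i \<in> I. v (nx i) = x \<and> e (nx i) = E})"
    using finI by (subst card_Un_disjoint) (auto dest: e_nx_neq)
  also have "{i \<in> I. v (nx i) = x \<and> e i = E} \<union> {i \<in> I. v (nx i) = x \<and> e (nx i) = E} =
      {i \<in> I. v (nx i) = x \<and> (e i = E \<or> e (nx i) = E)}" by auto
  finally show ?thesis .
qed

lemma mu_le_occ: "on_edge x E \<Longrightarrow> mu E \<le> occ x"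
  unfolding mu_passages card_passages[symmetric] using finI by (intro card_mono) auto

lemma mu_pos: "i \<in> I \<Longrightarrow> mu (e i) > 0"
  unfolding mu_def using finI by (auto simp: card_gt_0_iff)

lemma mu_pos_ex: "mu E > 0 \<Longrightarrow> \<exists>i\<in>I. e i = E"
  unfolding mu_def by (auto simp: card_gt_0_iff)

lemma obtain_passage:
  assumes "x \<in> v ` I"
  obtains i where "i \<in> I" "v (nx i) = x"
  using assms nx_bij by (auto simp: bij_betw_def) (metis imageE)

lemma sum_occ: "(\<Sum>x\<in>v ` I. occ x) = card I"
proof -
  have "card I = (\<Sum>i\<in>I. 1)" by simp
  also have "\<dots> = (\<Sum>x\<in>v ` I. \<Sum>i\<in>{i \<in> I. v i = x}. 1)"
    using finI by (rule sum.image_gen)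
  also have "\<dots> = (\<Sum>x\<in>v ` I. occ x)" by (simp add: occ_def)
  finally show ?thesis ..
qed

lemma occ_ge_2:
  assumes "x \<in> v ` I" "\<And>E. on_edge x E \<Longrightarrow> even (mu E)"
  shows "occ x \<ge> 2"
proof -
  obtain i where i: "i \<in> I" "v (nx i) = x" using obtain_passage assms(1) by blast
  then have x: "on_edge x (e i)" by (simp add: e_def on_edge_mk_edge)
  have "mu (e i) > 0" "even (mu (e i))" using mu_pos i assms(2)[OF x] by auto
  then have "mu (e i) \<ge> 2" by (auto elim!: evenE)
  then show ?thesis using mu_le_occ[OF x] by linarith
qed

lemma even_imp_vertices_le:
  assumes "\<And>E. even (mu E)"
  shows "2 * card (v ` I) \<le> card I"
proof -
  have "2 * card (v ` I) = (\<Sum>x\<in>v ` I. 2)" by simp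
  also have "\<dots> \<le> (\<Sum>x\<in>v ` I. occ x)" by (intro sum_mono occ_ge_2 assms)
  finally show ?thesis by (simp add: sum_occ)
qed

text \<open>Two vertices with four visits exceed the minimum of two visits by 4 in total, which
  costs two vertices. In the fourth moment these are the ends of an edge common to four
  walks.\<close>

lemma even_imp_vertices_le_busy:
  assumes "\<And>E. even (mu E)" "x \<in> v ` I" "y \<in> v ` I" "x \<noteq> y" "occ x \<ge> 4" "occ y \<ge> 4"
  shows "2 * card (v ` I) + 4 \<le> card I"
proof -
  have "2 * card (v ` I) + 4 = (\<Sum>z\<in>v ` I. 2) + (\<Sum>z\<in>{x, y}. 2)" using assms(4) by simp
  also have "(\<Sum>z\<in>{x, y}. 2) = (\<Sum>z\<in>v ` I. if z \<in> {x, y} then 2 else (0::nat))"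
    using finI assms by (subst sum.inter_restrict[symmetric]) (auto intro!: sum.cong)
  also have "(\<Sum>z\<in>v ` I. 2) + \<dots> = (\<Sum>z\<in>v ` I. 2 + (if z \<in> {x, y} then 2 else 0))"
    by (rule sum.distrib[symmetric])
  also have "\<dots> \<le> (\<Sum>z\<in>v ` I. occ z)"
  proof (rule sum_mono)
    fix z assume "z \<in> v ` I"
    then show "2 + (if z \<in> {x, y} then 2 else 0) \<le> occ z"
      using occ_ge_2[of z] assms by auto
  qed
  finally show ?thesis by (simp add: sum_occ)
qed

section \<open>Vertices on edges of odd multiplicity\<close>

definition odd_vertices :: "nat set" where
  "odd_vertices = {x. \<exists>E. odd (mu E) \<and> on_edge x E}"

lemma odd_vertices_subset: "odd_vertices \<subseteq> v ` I"
proof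
  fix x assume "x \<in> odd_vertices"
  then obtain E where E: "odd (mu E)" "on_edge x E" by (auto simp: odd_vertices_def)
  then obtain i where "i \<in> I" "e i = E" using mu_pos_ex[of E] by (auto simp: odd_pos)
  then show "x \<in> v ` I" using E(2) nx_in by (auto simp: e_def on_edge_mk_edge)
qed

lemma card_edges_in:
  "card {i \<in> I. e i \<in> Q} = (\<Sum>E\<in>e ` I \<inter> Q. mu E)"
proof -
  have "card {i \<in> I. e i \<in> Q} = (\<Sum>i\<in>{i \<in> I. e i \<in> Q}. 1)" by simp
  also have "\<dots> = (\<Sum>E\<in>e ` {i \<in> I. e i \<in> Q}. \<Sum>i\<in>{i \<in> {i \<in> I. e i \<in> Q}. e i = E}. 1)"
    using finI by (intro sum.image_gen) simp
  also have "e ` {i \<in> I. e i \<in> Q} = e ` I \<inter> Q" by auto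
  also have "(\<Sum>E\<in>e ` I \<inter> Q. \<Sum>i\<in>{i \<in> {i \<in> I. e i \<in> Q}. e i = E}. 1) = (\<Sum>E\<in>e ` I \<inter> Q. mu E)"
    unfolding mu_def by (intro sum.cong) (auto intro!: arg_cong[where f = card])
  finally show ?thesis .
qed

text \<open>A vertex may be visited only once, but then it lies on an edge of odd multiplicity; the
  bonus unit restores the lower bound 2.\<close>

lemma charge_ge_2:
  assumes "x \<in> v ` I"
  shows "occ x + (if x \<in> odd_vertices then 1 else 0) \<ge> 2"
proof (cases "x \<in> odd_vertices")
  case True
  have "occ x \<noteq> 0" using assms finI by (auto simp: occ_def)
  then show ?thesis using True by simp
next
  case False
  then show ?thesis using occ_ge_2[OF assms] by (auto simp: odd_vertices_def)
qed

text \<open>Call \<open>occ x + [x \<in> odd_vertices] - 2\<close> the excess of \<open>x\<close>. If the total excess were at most 1, every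
  edge would be used at most twice, and exactly one vertex \<open>z\<close> would touch both singly and doubly used
  edges. Counting the ends of doubly used edges then gives a number that is divisible by 4 globally
  but is 2 modulo 4 when summed over the vertices.\<close>

lemma vertices_le_of_odd_and_repeated:
  assumes conn: "\<And>A. \<exists>i\<in>I. e i \<in> A \<Longrightarrow> \<exists>i\<in>I. e i \<notin> A \<Longrightarrow> \<exists>i\<in>I. (e i \<in> A) \<noteq> (e (nx i) \<in> A)"
    and odd: "odd (mu E1)" and rep: "mu E2 \<ge> 2"
  shows "2 * card (v ` I) + 2 \<le> card I + card odd_vertices"
proof (rule ccontr)
  assume neg: "\<not> ?thesis"
  define c where "c x = occ x + (if x \<in> odd_vertices then 1 else 0)" for x
  define V where "V = v ` I"
  have finV: "finite V" using finI by (simp add: V_def)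
  have c2: "c x \<ge> 2" if "x \<in> V" for x
    using charge_ge_2 that by (simp add: c_def V_def)
  have "(\<Sum>x\<in>V. c x) = card I + card odd_vertices"
  proof -
    have "(\<Sum>x\<in>V. if x \<in> odd_vertices then 1 else 0) = (\<Sum>x\<in>V \<inter> odd_vertices. (1::nat))"
      using finV by (subst sum.inter_restrict) simp_all
    also have "V \<inter> odd_vertices = odd_vertices" using odd_vertices_subset by (auto simp: V_def)
    finally show ?thesis
      unfolding c_def sum.distrib using sum_occ by (simp add: V_def)
  qed
  then have small: "(\<Sum>x\<in>V. c x) \<le> 2 * card V + 1" using neg by (simp add: V_def)
  have c3: "c z \<le> 3" if "z \<in> V" for z
  proof -
    have "(\<Sum>x\<in>V. c x) = c z + (\<Sum>x\<in>V - {z}. c x)" using that finV by (simp add: sum.remove)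
    moreover have "(\<Sum>x\<in>V - {z}. c x) \<ge> (\<Sum>x\<in>V - {z}. 2)" by (intro sum_mono c2) auto
    moreover have "(\<Sum>x\<in>V - {z}. (2::nat)) = 2 * card V - 2" using that finV by simp
    moreover have "card V \<ge> 1" using that finV by (metis One_nat_def Suc_leI card_gt_0_iff empty_iff)
    ultimately show ?thesis using small by linarith
  qed
  have c_unique: "c y = 2" if "z \<in> V" "c z = 3" "y \<in> V" "y \<noteq> z" for y z
  proof -
    have "(\<Sum>x\<in>V. c x) = c z + (c y + (\<Sum>x\<in>V - {z} - {y}. c x))"
      using that finV by (simp add: sum.remove[of V z] sum.remove[of "V - {z}" y])
    moreover have "(\<Sum>x\<in>V - {z} - {y}. c x) \<ge> (\<Sum>x\<in>V - {z} - {y}. 2)" by (intro sum_mono c2) auto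
    moreover have "(\<Sum>x\<in>V - {z} - {y}. (2::nat)) = 2 * (card V - 2)"
      using that finV by (simp add: card_Diff_singleton)
    moreover have "card V \<ge> card {z, y}" using that finV by (intro card_mono) auto
    ultimately show ?thesis using small c2[OF that(3)] that by auto
  qed
  have occ2: "occ y \<le> 2" if "y \<in> V" "c y = 2 \<or> y \<in> odd_vertices" for y
    using that c3[OF that(1)] by (auto simp: c_def split: if_splits)
  \<comment> \<open>At most one vertex has positive excess, so one of the two ends of
    \<open>E\<close> has charge 2 and hence at most two visits.\<close>
  have mu2: "mu E \<le> 2" for E
  proof (cases "mu E = 0")
    case False
    then obtain i where i: "i \<in> I" "e i = E" using mu_pos_ex by blast
    then have xy: "on_edge (v i) E" "on_edge (v (nx i)) E" "v i \<in> V" "v (nx i) \<in> V" "v i \<noteq> v (nx i)"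
      using step nx_in by (auto simp: e_def on_edge_mk_edge V_def)
    have "c (v i) = 2 \<or> c (v (nx i)) = 2"
      using c_unique[of "v i" "v (nx i)"] c2[OF xy(3)] c3[OF xy(3)] xy by force
    then show ?thesis using occ2 xy mu_le_occ by (meson le_trans)
  qed simp
  define Q where "Q = {E. mu E = 2}"
  have notQ: "odd (mu (e i))" if "i \<in> I" "e i \<notin> Q" for i
    using that mu2[of "e i"] mu_pos[of i] by (cases "mu (e i) = 1") (auto simp: Q_def)
  have "mu E1 \<noteq> 0" using odd by (metis even_zero)
  then obtain i1 where "i1 \<in> I" "e i1 = E1" using mu_pos_ex by blast
  moreover from this have "e i1 \<notin> Q" using odd by (auto simp: Q_def)
  ultimately have ex1: "\<exists>i\<in>I. e i \<notin> Q" by blast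
  have "mu E2 \<noteq> 0" "mu E2 = 2" using rep mu2[of E2] by auto
  then obtain i2 where "i2 \<in> I" "e i2 = E2" using mu_pos_ex by blast
  then have ex2: "\<exists>i\<in>I. e i \<in> Q" using \<open>mu E2 = 2\<close> by (auto simp: Q_def)
  \<comment> \<open>Connectedness supplies a passage that switches between doubly and singly used
    edges. Its vertex \<open>z\<close> is odd and visited at least twice, so it carries the whole
    excess.\<close>
  obtain i where i: "i \<in> I" "(e i \<in> Q) \<noteq> (e (nx i) \<in> Q)" using conn[OF ex2 ex1] by blast
  define z where "z = v (nx i)"
  have zV: "z \<in> V" using i nx_in by (auto simp: z_def V_def)
  have onz: "on_edge z (e i)" "on_edge z (e (nx i))" by (auto simp: z_def e_def on_edge_mk_edge)
  have zodd: "z \<in> odd_vertices"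
    using notQ[of i] notQ[of "nx i"] i nx_in onz unfolding odd_vertices_def by blast
  have "occ z \<ge> 2" using i(2) mu_le_occ[OF onz(1)] mu_le_occ[OF onz(2)] by (auto simp: Q_def)
  then have occz: "occ z = 2" and cz: "c z = 3" using occ2[OF zV] zodd by (auto simp: c_def)
  \<comment> \<open>\<open>q j\<close> counts the sides of the passage \<open>j\<close> that lie on
    doubly used edges. In the total over all passages each step along such an edge counts twice,
    hence each such edge four times.\<close>
  define q where "q j = (if e j \<in> Q then 1 else 0) + (if e (nx j) \<in> Q then 1 else (0::nat))" for j
  define qs where "qs x = (\<Sum>j\<in>{j \<in> I. v (nx j) = x}. q j)" for x
  have total: "(\<Sum>x\<in>V. qs x) = (\<Sum>j\<in>I. q j)"
  proof -
    have "(\<lambda>j. v (nx j)) ` I = V" using nx_bij by (auto simp: V_def bij_betw_def image_image[symmetric])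
    then show ?thesis unfolding qs_def using sum.image_gen[OF finI, of q "\<lambda>j. v (nx j)"] by simp
  qed
  have "(\<Sum>j\<in>I. q j) = 2 * (\<Sum>j\<in>I. if e j \<in> Q then 1 else 0)"
    unfolding q_def sum.distrib using sum_nx[of "\<lambda>j. if e j \<in> Q then 1 else 0"] by simp
  also have "(\<Sum>j\<in>I. if e j \<in> Q then 1 else 0) = card {j \<in> I. e j \<in> Q}"
    using finI by (simp add: sum.If_cases Int_def)
  also have "\<dots> = 2 * card (e ` I \<inter> Q)"
    unfolding card_edges_in by (simp add: Q_def)
  finally have dvd4: "4 dvd (\<Sum>x\<in>V. qs x)" using total by simp
  \<comment> \<open>At a fixed vertex the same quantity counts the steps along doubly used edges
    with an end at \<open>x\<close>, which is twice the number of these edges.\<close>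
  have qs_even: "even (qs x)" for x
  proof -
    have "qs x = (\<Sum>j\<in>{j \<in> I. v (nx j) = x}. if e j \<in> Q then 1 else 0) +
        (\<Sum>j\<in>{j \<in> I. v (nx j) = x}. if e (nx j) \<in> Q then 1 else 0)"
      unfolding qs_def q_def by (simp add: sum.distrib)
    also have "(\<Sum>j\<in>{j \<in> I. v (nx j) = x}. if e j \<in> Q then 1 else 0) = card {j \<in> I. v (nx j) = x \<and> e j \<in> Q}"
      using finI by (simp add: sum.If_cases Int_def conj_ac)
    also have "(\<Sum>j\<in>{j \<in> I. v (nx j) = x}. if e (nx j) \<in> Q then 1 else 0) =
        card {j \<in> I. v (nx j) = x \<and> e (nx j) \<in> Q}"
      using finI by (simp add: sum.If_cases Int_def conj_ac)
    also have "\<dots> = card {j \<in> I. v j = x \<and> e j \<in> Q}"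
      by (rule card_nx[where P = "\<lambda>j. v j = x \<and> e j \<in> Q"])
    also have "card {j \<in> I. v (nx j) = x \<and> e j \<in> Q} + \<dots> =
        card ({j \<in> I. v (nx j) = x \<and> e j \<in> Q} \<union> {j \<in> I. v j = x \<and> e j \<in> Q})"
      using finI step by (subst card_Un_disjoint) fastforce+
    also have "{j \<in> I. v (nx j) = x \<and> e j \<in> Q} \<union> {j \<in> I. v j = x \<and> e j \<in> Q} =
        {j \<in> I. e j \<in> Q \<inter> {E. on_edge x E}}"
      by (auto simp: e_def on_edge_mk_edge)
    also have "card \<dots> = (\<Sum>E\<in>e ` I \<inter> (Q \<inter> {E. on_edge x E}). mu E)"
      by (rule card_edges_in)
    also have "\<dots> = 2 * card (e ` I \<inter> (Q \<inter> {E. on_edge x E}))"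
      by (simp add: Q_def)
    finally show ?thesis by simp
  qed
  \<comment> \<open>A vertex without excess is either visited once, with no doubly used edge at it,
    or visited twice with all four sides doubly used; so \<open>qs y\<close> is 0 or 4.\<close>
  have qs4: "4 dvd qs y" if "y \<in> V" "y \<noteq> z" for y
  proof -
    have cy: "c y = 2" using c_unique[OF zV cz that] .
    show ?thesis
    proof (cases "y \<in> odd_vertices")
      case True
      then have "occ y = 1" using cy by (simp add: c_def)
      then have "\<not> (on_edge y E \<and> E \<in> Q)" for E using mu_le_occ[of y E] by (auto simp: Q_def)
      then have "q j = 0" if "j \<in> I" "v (nx j) = y" for j
        using that by (auto simp: q_def e_def on_edge_mk_edge)
      then show ?thesis by (simp add: qs_def)
    next
      case False
      then have "occ y = 2" using cy by (simp add: c_def)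
      moreover have "q j = 2" if "j \<in> I" "v (nx j) = y" for j
      proof -
        have "on_edge y (e j)" "on_edge y (e (nx j))" using that by (auto simp: e_def on_edge_mk_edge)
        then have "e j \<in> Q" "e (nx j) \<in> Q"
          using notQ[OF that(1)] notQ[OF nx_in[OF that(1)]] False unfolding odd_vertices_def by blast+
        then show ?thesis by (simp add: q_def)
      qed
      ultimately show ?thesis by (simp add: qs_def card_passages)
    qed
  qed
  have "\<not> 4 dvd qs z"
  proof -
    have iz: "i \<in> {j \<in> I. v (nx j) = z}" using i by (simp add: z_def)
    moreover have "card {j \<in> I. v (nx j) = z} = 2" using card_passages occz by simp
    ultimately have "card ({j \<in> I. v (nx j) = z} - {i}) = 1" by simp
    then obtain k where "{j \<in> I. v (nx j) = z} - {i} = {k}" by (rule card_1_singletonE)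
    then have k: "{j \<in> I. v (nx j) = z} = {i, k}" "k \<noteq> i" using iz by blast+
    then have "qs z = q i + q k" by (simp add: qs_def)
    moreover have "q i = 1" using i(2) by (auto simp: q_def)
    moreover have "q k \<le> 2" by (simp add: q_def)
    moreover have "1 + k = 2" if "even (1 + k)" "k \<le> 2" for k :: nat using that by presburger
    \<comment> \<open>The switching passage \<open>i\<close> contributes 1, and parity forces the
      only other passage through \<open>z\<close> to contribute 1 as well.\<close>
    ultimately have "qs z = 2" using qs_even[of z] by metis
    then show ?thesis by simp
  qed
  moreover have "(\<Sum>x\<in>V. qs x) = qs z + (\<Sum>x\<in>V - {z}. qs x)"
    using zV finV by (simp add: sum.remove)
  moreover have "4 dvd (\<Sum>x\<in>V - {z}. qs x)" by (intro dvd_sum qs4) auto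
  ultimately show False using dvd4 by (metis dvd_add_left_iff)
qed

end

section \<open>The Chebyshev recursion for matrices\<close>

definition mat_prod :: "nat \<Rightarrow> (nat \<Rightarrow> nat \<Rightarrow> complex) \<Rightarrow> (nat \<Rightarrow> nat \<Rightarrow> complex) \<Rightarrow> nat \<Rightarrow> nat \<Rightarrow> complex" where
  "mat_prod N h M i j = (\<Sum>l<N. h i l * M l j)"

text \<open>This is \<open>2 * q^(r/2) * T_r(h / (2 * sqrt q))\<close> with all roots cleared, which
  explains the initial values 2 and \<open>h\<close>. Matrices are functions of two indices, so the
  algebra is entrywise and free of dimension conditions.\<close>

fun cheb_seq :: "nat \<Rightarrow> (nat \<Rightarrow> nat \<Rightarrow> complex) \<Rightarrow> complex \<Rightarrow> nat \<Rightarrow> nat \<Rightarrow> nat \<Rightarrow> complex" where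
  "cheb_seq N h q 0 = (\<lambda>i j. if i = j then 2 else 0)"
| "cheb_seq N h q (Suc 0) = h"
| "cheb_seq N h q (Suc (Suc r)) = (\<lambda>i j. mat_prod N h (cheb_seq N h q (Suc r)) i j - q * cheb_seq N h q r i j)"

lemma mat_prod_diff: "mat_prod N h (\<lambda>i j. A i j - B i j) i j = mat_prod N h A i j - mat_prod N h B i j"
  by (simp add: mat_prod_def algebra_simps sum_subtractf)

lemma mat_prod_scale: "mat_prod N h (\<lambda>i j. c * A i j) i j = c * mat_prod N h A i j"
  by (simp add: mat_prod_def sum_distrib_left mult_ac)

lemma mat_prod_sum: "mat_prod N h (\<lambda>i j. \<Sum>l\<in>S. A l i j) i j = (\<Sum>l\<in>S. mat_prod N h (A l) i j)"
  unfolding mat_prod_def sum_distrib_left by (rule sum.swap)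

lemma mat_prod_cong: "(\<And>l. l < N \<Longrightarrow> A l j = B l j) \<Longrightarrow> mat_prod N h A i j = mat_prod N h B i j"
  by (simp add: mat_prod_def)

lemma mat_prod_scaled_unit: "i < N \<Longrightarrow> j < N \<Longrightarrow> mat_prod N h (\<lambda>i j. if i = j then c else 0) i j = c * h i j"
  by (simp add: mat_prod_def if_distrib[of "\<lambda>x. _ * x"] mult_ac cong: if_cong)

text \<open>Only even indices occur in the traces; eliminating the odd neighbours from two
  applications of the recursion gives a recursion among the even ones.\<close>

lemma cheb_seq_even_step:
  "mat_prod N h (mat_prod N h (cheb_seq N h q (2 * l + 2))) i j =
     cheb_seq N h q (2 * l + 4) i j + 2 * q * cheb_seq N h q (2 * l + 2) i j + q\<^sup>2 * cheb_seq N h q (2 * l) i j"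
proof -
  have 1: "cheb_seq N h q (2 * l + 4) i j = mat_prod N h (cheb_seq N h q (2 * l + 3)) i j - q * cheb_seq N h q (2 * l + 2) i j"
    using cheb_seq.simps(3)[of N h q "2 * l + 2"] by (simp add: eval_nat_numeral del: cheb_seq.simps)
  have 3: "cheb_seq N h q (2 * l + 3) = (\<lambda>i j. mat_prod N h (cheb_seq N h q (2 * l + 2)) i j - q * cheb_seq N h q (2 * l + 1) i j)"
    using cheb_seq.simps(3)[of N h q "2 * l + 1"] by (simp add: eval_nat_numeral del: cheb_seq.simps)
  have "mat_prod N h (cheb_seq N h q (2 * l + 3)) i j =
      mat_prod N h (mat_prod N h (cheb_seq N h q (2 * l + 2))) i j - q * mat_prod N h (cheb_seq N h q (2 * l + 1)) i j"
    unfolding 3 mat_prod_diff mat_prod_scale ..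
  moreover have "mat_prod N h (cheb_seq N h q (2 * l + 1)) i j = cheb_seq N h q (2 * l + 2) i j + q * cheb_seq N h q (2 * l) i j"
    by (simp add: eval_nat_numeral)
  ultimately show ?thesis unfolding 1 by (simp add: algebra_simps power2_eq_square)
qed

lemma cheb_seq_two:
  assumes "i < N" "j < N"
  shows "cheb_seq N h q 2 i j = mat_prod N h h i j - q * (if i = j then 2 else 0)"
  by (simp add: eval_nat_numeral)

text \<open>Index 0 is exceptional: the term of index -2 would equal the one of index 2 after
  rescaling and is folded onto it, whence the factor 2.\<close>

lemma mat_prod_mat_prod_cheb_seq_0:
  assumes "i < N" "j < N"
  shows "mat_prod N h (mat_prod N h (cheb_seq N h q 0)) i j = 2 * cheb_seq N h q 2 i j + 2 * q * cheb_seq N h q 0 i j"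
proof -
  have "mat_prod N h (mat_prod N h (cheb_seq N h q 0)) i j = mat_prod N h (\<lambda>i j. 2 * h i j) i j"
    using assms by (intro mat_prod_cong) (simp add: mat_prod_scaled_unit)
  then show ?thesis using assms by (simp add: mat_prod_scale cheb_seq_two algebra_simps)
qed

text \<open>The coefficients expressing the recursion with parameter \<open>N\<close> through that with parameter \<open>N - 2\<close>.\<close>

fun trace_coeff :: "real \<Rightarrow> nat \<Rightarrow> nat \<Rightarrow> real" where
  "trace_coeff N 0 l = (if l = 0 then 1 else 0)"
| "trace_coeff N (Suc 0) l = (if l = 1 then 1 else if l = 0 then -2 else 0)"
| "trace_coeff N (Suc (Suc k)) l =
    (if l = 0 then 0 else if l = 1 then 2 * trace_coeff N (Suc k) 0 else trace_coeff N (Suc k) (l - 1))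
    - 4 * trace_coeff N (Suc k) l + (N - 2)\<^sup>2 * trace_coeff N (Suc k) (Suc l) - N\<^sup>2 * trace_coeff N k l"

lemma nat_two_step_cases:
  obtains "k = (0::nat)" | "k = 1" | k' where "k = Suc (Suc k')"
proof (cases k)
  case (Suc j)
  then show ?thesis using that by (cases j) auto
qed (use that in auto)

lemma trace_coeff_zero: "k < l \<Longrightarrow> trace_coeff N k l = 0"
  by (induction N k l rule: trace_coeff.induct) auto

lemma trace_coeff_diag: "trace_coeff N k k = 1"
proof (induction k rule: less_induct)
  case (less k)
  show ?case
  proof (cases "k \<le> 1")
    case True
    then show ?thesis by (cases k) auto
  next
    case False
    then obtain k' where "k = Suc (Suc k')" by (metis One_nat_def Suc_le_mono le0 not0_implies_Suc)
    then show ?thesis using less[of "Suc k'"] by (cases k') (auto simp: trace_coeff_zero)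
  qed
qed

text \<open>By homogeneity one expects the power \<open>k - l\<close> of \<open>N\<close>. One power
  is saved because for equal parameters the expansion would be trivial and the parameters differ
  only by 2. This saved power is the O(1/N) in front of the shorter walks.\<close>

lemma trace_coeff_bound: "\<exists>C\<ge>0. \<forall>N\<ge>2. \<forall>l<k. \<bar>trace_coeff N k l\<bar> \<le> C * N ^ (k - l - 1)"
proof (induction k rule: less_induct)
  case (less k)
  consider "k = 0" | "k = 1" | k' where "k = Suc (Suc k')" by (rule nat_two_step_cases)
  then show ?case
  proof cases
    case 1
    then show ?thesis by (intro exI[of _ 0]) simp
  next
    case 2
    then have "\<bar>trace_coeff N k l\<bar> \<le> 2 * N ^ (k - l - 1)" if "l < k" for N l using that by simp
    then show ?thesis by (intro exI[of _ 2]) auto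
  next
    case (3 k')
    obtain C1 where C1: "C1 \<ge> 0" "\<And>N l. N \<ge> 2 \<Longrightarrow> l < Suc k' \<Longrightarrow> \<bar>trace_coeff N (Suc k') l\<bar> \<le> C1 * N ^ (k' - l)"
      using less[of "Suc k'"] 3 by auto
    obtain C0 where C0: "C0 \<ge> 0" "\<And>N l. N \<ge> 2 \<Longrightarrow> l < k' \<Longrightarrow> \<bar>trace_coeff N k' l\<bar> \<le> C0 * N ^ (k' - l - 1)"
      using less[of "k'"] 3 by auto
    have bd: "\<bar>trace_coeff N k l\<bar> \<le> (2 * C1 + 4 * (C1 + 1) + (C1 + C0 + 8)) * N ^ (k - l - 1)"
      if N: "N \<ge> 2" and l: "l < k" for N :: real and l
    proof -
      have l': "k - l - 1 = Suc k' - l" "l \<le> Suc k'" using l 3 by auto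
      have mono: "N ^ a \<le> N ^ b" if "a \<le> b" for a b using N that by (intro power_increasing) auto
      have p0: "N ^ a \<ge> 0" for a using N by simp
      have A: "\<bar>if l = 0 then 0 else if l = 1 then 2 * trace_coeff N (Suc k') 0 else trace_coeff N (Suc k') (l - 1)\<bar>
          \<le> 2 * C1 * N ^ (Suc k' - l)"
      proof (cases "l = 0")
        case True
        then show ?thesis using C1(1) N by simp
      next
        case False
        then have "l - 1 < Suc k'" using l' by simp
        from C1(2)[OF N this] have "\<bar>trace_coeff N (Suc k') (l - 1)\<bar> \<le> C1 * N ^ (Suc k' - l)"
          using False by (simp add: Suc_diff_le l'(2))
        moreover have "C1 * N ^ (Suc k' - l) \<ge> 0" using C1(1) p0 by simp
        ultimately show ?thesis using False by (cases "l = 1") (auto simp: abs_mult)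
      qed
      have B: "\<bar>trace_coeff N (Suc k') l\<bar> \<le> (C1 + 1) * N ^ (Suc k' - l)"
      proof (cases "l = Suc k'")
        case True
        then show ?thesis using C1(1) by (simp add: trace_coeff_diag)
      next
        case False
        then have "\<bar>trace_coeff N (Suc k') l\<bar> \<le> C1 * N ^ (k' - l)" using l' by (intro C1(2)[OF N]) simp
        also have "\<dots> \<le> (C1 + 1) * N ^ (Suc k' - l)"
          using C1(1) p0 by (intro mult_mono mono) auto
        finally show ?thesis .
      qed
      have D: "\<bar>(N - 2)\<^sup>2 * trace_coeff N (Suc k') (Suc l) - N\<^sup>2 * trace_coeff N k' l\<bar> \<le> (C1 + C0 + 8) * N ^ (Suc k' - l)"
      proof -
        consider "l = Suc k'" | "l = k'" | "l < k'" using l' by linarith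
        then show ?thesis
        proof cases
          case 1
          then show ?thesis using C1(1) C0(1) by (simp add: trace_coeff_zero)
        next
          case 2
          \<comment> \<open>Here both coefficients are 1, and the leading terms of the two squares
            have to cancel; in the remaining cases the terms are bounded separately.\<close>
          have "\<bar>(N - 2)\<^sup>2 - N\<^sup>2\<bar> = 4 * (N - 1)" using N by (simp add: power2_eq_square algebra_simps)
          also have "\<dots> \<le> 8 * N" using N by simp
          also have "\<dots> \<le> (C1 + C0 + 8) * N" using N C1(1) C0(1) by (intro mult_right_mono) auto
          finally show ?thesis using 2 by (simp add: trace_coeff_diag)
        next
          case 3
          then have "Suc k' - l = 2 + (k' - Suc l)" by simp
          then have pw: "N ^ (Suc k' - l) = N\<^sup>2 * N ^ (k' - Suc l)" by (simp only: power_add)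
          have "\<bar>(N - 2)\<^sup>2 * trace_coeff N (Suc k') (Suc l)\<bar> \<le> N\<^sup>2 * (C1 * N ^ (k' - Suc l))"
            unfolding abs_mult using N 3 C1 by (intro mult_mono) (auto intro!: power_mono)
          also have "\<dots> = C1 * N ^ (Suc k' - l)"
            unfolding pw by simp
          finally have a: "\<bar>(N - 2)\<^sup>2 * trace_coeff N (Suc k') (Suc l)\<bar> \<le> C1 * N ^ (Suc k' - l)" .
          have "\<bar>N\<^sup>2 * trace_coeff N k' l\<bar> \<le> N\<^sup>2 * (C0 * N ^ (k' - l - 1))"
            unfolding abs_mult using N 3 C0 by (intro mult_mono) auto
          also have "\<dots> = C0 * N ^ (Suc k' - l)"
            unfolding pw by simp
          finally have b: "\<bar>N\<^sup>2 * trace_coeff N k' l\<bar> \<le> C0 * N ^ (Suc k' - l)" .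
          have "\<bar>(N - 2)\<^sup>2 * trace_coeff N (Suc k') (Suc l) - N\<^sup>2 * trace_coeff N k' l\<bar> \<le>
              C1 * N ^ (Suc k' - l) + C0 * N ^ (Suc k' - l)" using a b by linarith
          also have "\<dots> \<le> (C1 + C0 + 8) * N ^ (Suc k' - l)"
            using p0[of "Suc k' - l"] unfolding distrib_right[symmetric] by (intro mult_right_mono) auto
          finally show ?thesis .
        qed
      qed
      have eq: "trace_coeff N k l = (if l = 0 then 0 else if l = 1 then 2 * trace_coeff N (Suc k') 0 else trace_coeff N (Suc k') (l - 1))
        - 4 * trace_coeff N (Suc k') l + ((N - 2)\<^sup>2 * trace_coeff N (Suc k') (Suc l) - N\<^sup>2 * trace_coeff N k' l)"
        unfolding 3 by simp
      have comb: "\<bar>x - 4 * y + z\<bar> \<le> (a + 4 * b + c) * P"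
        if "\<bar>x\<bar> \<le> a * P" "\<bar>y\<bar> \<le> b * P" "\<bar>z\<bar> \<le> c * P" for x y z a b c P :: real
      proof -
        have "(a + 4 * b + c) * P = a * P + 4 * (b * P) + c * P" by (simp add: algebra_simps)
        then show ?thesis using that by linarith
      qed
      show ?thesis unfolding eq l'(1) by (rule comb[OF A B D])
    qed
    show ?thesis
    proof (intro exI conjI allI impI)
      show "0 \<le> 2 * C1 + 4 * (C1 + 1) + (C1 + C0 + 8)" using C1(1) C0(1) by simp
    qed (rule bd)
  qed
qed

text \<open>The even-index recursion is used with parameter \<open>N\<close> on the left and with
  \<open>N - 2\<close> on every summand of the right. The linear terms combine to 2(N - 2) - 2N =
  -4, the constant in \<open>trace_coeff\<close>; the doubled coefficient at \<open>l = 1\<close>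
  comes from the exceptional index 0.\<close>

lemma cheb_seq_change_parameter:
  assumes "i < N" "j < N"
  shows "cheb_seq N h (of_nat N) (2 * k) i j =
    (\<Sum>l\<le>k. of_real (trace_coeff (real N) k l) * cheb_seq N h (of_nat N - 2) (2 * l) i j)"
  using assms
proof (induction k arbitrary: i j rule: less_induct)
  case (less k)
  define q :: complex where "q = of_nat N - 2"
  define T where "T l = cheb_seq N h q (2 * l)" for l
  consider "k = 0" | "k = 1" | k' where "k = Suc (Suc k')" by (rule nat_two_step_cases)
  then show ?case
  proof cases
    case 1
    then show ?thesis by simp
  next
    case 2
    then show ?thesis using less.prems by (simp add: cheb_seq_two algebra_simps)
  next
    case (3 k')
    define b where "b = (\<lambda>k l. complex_of_real (trace_coeff (real N) k l))"
    have TS: "mat_prod N h (mat_prod N h (T l)) i j =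
        (if l = 0 then 2 else 1) * T (Suc l) i j + 2 * q * T l i j + (if l = 0 then 0 else q\<^sup>2 * T (l - 1) i j)" for l
    proof (cases l)
      case 0
      then show ?thesis using mat_prod_mat_prod_cheb_seq_0[OF less.prems, of h q] by (simp add: T_def del: cheb_seq.simps)
    next
      case (Suc m)
      have "T l = cheb_seq N h q (2 * m + 2)" "T (Suc l) = cheb_seq N h q (2 * m + 4)" "T (l - 1) = cheb_seq N h q (2 * m)"
        unfolding T_def Suc by (rule arg_cong[where f = "cheb_seq N h q"], simp)+
      then show ?thesis using cheb_seq_even_step[of N h q m i j] Suc by (simp del: cheb_seq.simps)
    qed
    have IH1: "cheb_seq N h (of_nat N) (2 * k' + 2) i j = (\<Sum>l\<le>Suc k'. b (Suc k') l * T l i j)" if "i < N" "j < N" for i j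
      using less.IH[of "Suc k'" i j] that 3 by (simp add: b_def T_def q_def del: cheb_seq.simps trace_coeff.simps sum.atMost_Suc)
    have IH0: "cheb_seq N h (of_nat N) (2 * k') i j = (\<Sum>l\<le>k'. b k' l * T l i j)"
      using less.IH[of k' i j] less.prems 3 by (simp add: b_def T_def q_def del: cheb_seq.simps trace_coeff.simps sum.atMost_Suc)
    have bz: "b k l = 0" if "k < l" for k l using that by (simp add: b_def trace_coeff_zero)
    have "cheb_seq N h (of_nat N) (2 * k) i j = mat_prod N h (mat_prod N h (cheb_seq N h (of_nat N) (2 * k' + 2))) i j
        - 2 * of_nat N * cheb_seq N h (of_nat N) (2 * k' + 2) i j - (of_nat N)\<^sup>2 * cheb_seq N h (of_nat N) (2 * k') i j"
    proof -
      have "2 * k = 2 * k' + 4" using 3 by simp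
      then show ?thesis using cheb_seq_even_step[of N h "of_nat N" k' i j] by (simp only: algebra_simps)
    qed
    also have "mat_prod N h (mat_prod N h (cheb_seq N h (of_nat N) (2 * k' + 2))) i j =
        mat_prod N h (mat_prod N h (\<lambda>i j. \<Sum>l\<le>Suc k'. b (Suc k') l * T l i j)) i j"
      using less.prems IH1 by (intro mat_prod_cong) auto
    also have "\<dots> = (\<Sum>l\<le>Suc k'. b (Suc k') l * mat_prod N h (mat_prod N h (T l)) i j)"
    proof -
      have "mat_prod N h (\<lambda>i j. \<Sum>l\<le>Suc k'. b (Suc k') l * T l i j) = (\<lambda>i j. \<Sum>l\<le>Suc k'. b (Suc k') l * mat_prod N h (T l) i j)"
        by (intro ext) (subst mat_prod_sum, simp only: mat_prod_scale)
      then show ?thesis by (simp only: mat_prod_sum mat_prod_scale)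
    qed
    also have "\<dots> - 2 * of_nat N * cheb_seq N h (of_nat N) (2 * k' + 2) i j - (of_nat N)\<^sup>2 * cheb_seq N h (of_nat N) (2 * k') i j =
       (\<Sum>l\<le>Suc k'. b (Suc k') l * mat_prod N h (mat_prod N h (T l)) i j) - 2 * of_nat N * (\<Sum>l\<le>Suc k'. b (Suc k') l * T l i j)
        - (of_nat N)\<^sup>2 * (\<Sum>l\<le>k'. b k' l * T l i j)"
      unfolding IH1[OF less.prems] IH0 ..
    also have "(\<Sum>l\<le>Suc k'. b (Suc k') l * mat_prod N h (mat_prod N h (T l)) i j) =
       (\<Sum>l\<le>Suc k'. (if l = 0 then 2 else 1) * b (Suc k') l * T (Suc l) i j) + 2 * q * (\<Sum>l\<le>Suc k'. b (Suc k') l * T l i j)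
       + q\<^sup>2 * (\<Sum>l\<le>Suc k'. if l = 0 then 0 else b (Suc k') l * T (l - 1) i j)"
      unfolding TS sum_distrib_left sum.distrib[symmetric]
      by (intro sum.cong refl) (simp add: algebra_simps)
    also have "(\<Sum>l\<le>Suc k'. (if l = 0 then 2 else 1) * b (Suc k') l * T (Suc l) i j) =
       (\<Sum>l\<le>k. (if l = 0 then 0 else if l = 1 then 2 * b (Suc k') 0 else b (Suc k') (l - 1)) * T l i j)"
    proof -
      have "(\<Sum>l\<le>k. (if l = 0 then 0 else if l = 1 then 2 * b (Suc k') 0 else b (Suc k') (l - 1)) * T l i j) =
        (\<Sum>l\<le>Suc k'. (if Suc l = 1 then 2 * b (Suc k') 0 else b (Suc k') l) * T (Suc l) i j)"
        unfolding 3 sum.atMost_Suc_shift[of _ "Suc k'"]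
        by (simp del: sum.atMost_Suc) (intro sum.cong refl, simp)
      also have "\<dots> = (\<Sum>l\<le>Suc k'. (if l = 0 then 2 else 1) * b (Suc k') l * T (Suc l) i j)"
        by (intro sum.cong refl) auto
      finally show ?thesis ..
    qed
    also have "(\<Sum>l\<le>Suc k'. b (Suc k') l * T l i j) = (\<Sum>l\<le>k. b (Suc k') l * T l i j)"
      unfolding 3 by (simp add: bz)
    also have "(\<Sum>l\<le>Suc k'. if l = 0 then 0 else b (Suc k') l * T (l - 1) i j) = (\<Sum>l\<le>k. b (Suc k') (Suc l) * T l i j)"
      unfolding 3 by (subst sum.atMost_Suc_shift) (simp add: bz)
    also have "(\<Sum>l\<le>k'. b k' l * T l i j) = (\<Sum>l\<le>k. b k' l * T l i j)"
      unfolding 3 by (simp add: bz)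
    finally have "cheb_seq N h (of_nat N) (2 * k) i j = (\<Sum>l\<le>k. ((if l = 0 then 0 else if l = 1 then 2 * b (Suc k') 0 else b (Suc k') (l - 1))
      + 2 * q * b (Suc k') l + q\<^sup>2 * b (Suc k') (Suc l) - 2 * of_nat N * b (Suc k') l - (of_nat N)\<^sup>2 * b k' l) * T l i j)"
      unfolding sum_distrib_left sum.distrib[symmetric] sum_subtractf[symmetric]
      by (simp only: distrib_right left_diff_distrib mult.assoc)
    also have "\<dots> = (\<Sum>l\<le>k. b k l * T l i j)"
    proof (intro sum.cong refl arg_cong2[where f = "(*)"])
      fix l
      have q: "2 * q * b (Suc k') l - 2 * of_nat N * b (Suc k') l = - 4 * b (Suc k') l"
        by (simp add: q_def algebra_simps)
      have "b k l = (if l = 0 then 0 else if l = 1 then 2 * b (Suc k') 0 else b (Suc k') (l - 1))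
          - 4 * b (Suc k') l + q\<^sup>2 * b (Suc k') (Suc l) - (of_nat N)\<^sup>2 * b k' l"
        unfolding b_def 3 q_def by simp
      then show "(if l = 0 then 0 else if l = 1 then 2 * b (Suc k') 0 else b (Suc k') (l - 1))
          + 2 * q * b (Suc k') l + q\<^sup>2 * b (Suc k') (Suc l) - 2 * of_nat N * b (Suc k') l - (of_nat N)\<^sup>2 * b k' l = b k l"
      proof -
        have gen: "x + u + v - w - y = c" if "c = x - 4 * z + v - y" "u - w = - 4 * z" for x u v w y c z :: complex
        proof -
          have "x + u + v - w - y = x + (u - w) + v - y" by (simp add: algebra_simps)
          then show ?thesis using that by simp
        qed
        show ?thesis by (rule gen[OF _ q]) fact
      qed
    qed
    finally show ?thesis unfolding b_def T_def q_def .
  qed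
qed

section \<open>Sums over non-backtracking walks\<close>

text \<open>\<open>nb_sum\<close> sums over non-backtracking walks from \<open>i\<close> to \<open>j\<close>, \<open>nb_sum_from\<close> over those whose first step
  in addition avoids \<open>u\<close>.\<close>

fun nb_sum_from :: "nat \<Rightarrow> (nat \<Rightarrow> nat \<Rightarrow> complex) \<Rightarrow> nat \<Rightarrow> nat \<Rightarrow> nat \<Rightarrow> nat \<Rightarrow> complex" where
  "nb_sum_from N h 0 u i j = (if i = j then 1 else 0)"
| "nb_sum_from N h (Suc r) u i j = (\<Sum>l\<in>{..<N} - {u}. h i l * nb_sum_from N h r i l j)"

fun nb_sum :: "nat \<Rightarrow> (nat \<Rightarrow> nat \<Rightarrow> complex) \<Rightarrow> nat \<Rightarrow> nat \<Rightarrow> nat \<Rightarrow> complex" where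
  "nb_sum N h 0 i j = (if i = j then 1 else 0)"
| "nb_sum N h (Suc r) i j = (\<Sum>l<N. h i l * nb_sum_from N h r i l j)"

lemma nb_sum_from_Suc:
  assumes "u < N"
  shows "nb_sum_from N h (Suc r) u i j = nb_sum N h (Suc r) i j - h i u * nb_sum_from N h r i u j"
  using assms by (simp add: sum.remove[of "{..<N}" u])

section \<open>Walks as lists of vertices\<close>

definition closed_list :: "nat list \<Rightarrow> nat list" where "closed_list xs = xs @ [hd xs]"

fun path_weight :: "(nat \<Rightarrow> nat \<Rightarrow> complex) \<Rightarrow> nat list \<Rightarrow> complex" where
  "path_weight h (x # y # ys) = h x y * path_weight h (y # ys)"
| "path_weight h _ = 1"

text \<open>Equal neighbours are not excluded: walks with such a step get weight 0 once the diagonal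
  of \<open>h\<close> vanishes.\<close>

fun nb_list :: "nat list \<Rightarrow> bool" where
  "nb_list (x # y # z # zs) \<longleftrightarrow> x \<noteq> z \<and> nb_list (y # z # zs)"
| "nb_list _ \<longleftrightarrow> True"

definition lists_below :: "nat \<Rightarrow> nat \<Rightarrow> nat list set" where
  "lists_below N r = {xs. set xs \<subseteq> {..<N} \<and> length xs = r}"

lemma finite_lists_below [simp]: "finite (lists_below N r)"
  unfolding lists_below_def by (rule finite_lists_length_eq) simp

lemma lists_below_0: "lists_below N 0 = {[]}"
  by (auto simp: lists_below_def)

lemma sum_lists_below_Cons:
  "(\<Sum>xs\<in>lists_below N (Suc r). f xs) = (\<Sum>x<N. \<Sum>xs\<in>lists_below N r. f (x # xs))"
proof -
  have "(\<Sum>(x, xs)\<in>{..<N} \<times> lists_below N r. f (x # xs)) = (\<Sum>xs\<in>lists_below N (Suc r). f xs)"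
    by (rule sum.reindex_bij_witness[of _ "\<lambda>xs. (hd xs, tl xs)" "\<lambda>(x, xs). x # xs"])
      (auto simp: lists_below_def length_Suc_conv)
  then show ?thesis by (simp add: sum.cartesian_product)
qed

lemma sum_lists_below_snoc:
  "(\<Sum>xs\<in>lists_below N (Suc r). f xs) = (\<Sum>x<N. \<Sum>xs\<in>lists_below N r. f (xs @ [x]))"
proof -
  have "(\<Sum>(x, xs)\<in>{..<N} \<times> lists_below N r. f (xs @ [x])) = (\<Sum>xs\<in>lists_below N (Suc r). f xs)"
  proof (rule sum.reindex_bij_witness[of _ "\<lambda>xs. (last xs, butlast xs)" "\<lambda>(x, xs). xs @ [x]"])
    fix xs assume "xs \<in> lists_below N (Suc r)"
    then have "xs \<noteq> []" "set xs \<subseteq> {..<N}" "length xs = Suc r" by (auto simp: lists_below_def)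
    then show "(last xs, butlast xs) \<in> {..<N} \<times> lists_below N r"
      "(case (last xs, butlast xs) of (x, xs) \<Rightarrow> xs @ [x]) = xs"
      by (auto simp: lists_below_def dest: in_set_butlastD last_in_set)
  qed (auto simp: lists_below_def)
  then show ?thesis by (simp add: sum.cartesian_product)
qed

lemma nb_sum_from_eq_sum:
  "nb_sum_from N h r u i j =
     (\<Sum>xs\<in>lists_below N r. if last (i # xs) = j \<and> nb_list (u # i # xs) then path_weight h (i # xs) else 0)"
proof (induction r arbitrary: u i)
  case 0
  then show ?case by (simp add: lists_below_0)
next
  case (Suc r)
  have "nb_sum_from N h (Suc r) u i j = (\<Sum>l<N. if l = u then 0 else h i l * nb_sum_from N h r i l j)"
    by (cases "u < N") (auto simp: sum.remove[of "{..<N}" u] intro!: sum.cong)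
  also have "\<dots> = (\<Sum>l<N. \<Sum>xs\<in>lists_below N r.
      if last (i # l # xs) = j \<and> nb_list (u # i # l # xs) then path_weight h (i # l # xs) else 0)"
    unfolding Suc by (intro sum.cong refl) (auto simp: sum_distrib_left intro!: sum.cong)
  finally show ?case by (simp only: sum_lists_below_Cons)
qed

lemma nb_sum_Suc_eq_sum:
  "nb_sum N h (Suc r) i j =
     (\<Sum>xs\<in>lists_below N (Suc r). if last (i # xs) = j \<and> nb_list (i # xs) then path_weight h (i # xs) else 0)"
  by (simp add: nb_sum_from_eq_sum sum_lists_below_Cons sum_distrib_left if_distrib[of "\<lambda>x. _ * x"] cong: if_cong)

text \<open>The condition does not look across the base point, so a closed list may still backtrack
  there. This is why the trace is later split into \<open>Bsum\<close> and
  \<open>Tailsum\<close>.\<close>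

lemma trace_nb_sum:
  "(\<Sum>i<N. nb_sum N h (Suc r) i i) =
     (\<Sum>xs\<in>lists_below N (Suc r). if nb_list (closed_list xs) then path_weight h (closed_list xs) else 0)"
proof -
  have "nb_sum N h (Suc r) i i =
      (\<Sum>xs\<in>lists_below N r. if nb_list (i # xs @ [i]) then path_weight h (i # xs @ [i]) else 0)" if "i < N" for i
  proof -
    have "nb_sum N h (Suc r) i i = (\<Sum>x<N. if x = i then
        \<Sum>xs\<in>lists_below N r. if nb_list (i # xs @ [x]) then path_weight h (i # xs @ [x]) else 0 else 0)"
      unfolding nb_sum_Suc_eq_sum sum_lists_below_snoc by (intro sum.cong refl) auto
    then show ?thesis using that by simp
  qed
  then show ?thesis unfolding sum_lists_below_Cons closed_list_def by (simp cong: if_cong del: nb_sum.simps)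
qed

text \<open>For tournament matrices \<open>h i j * h j i\<close> is the product of i and -i, so a
  step followed by its reversal has weight 1. This is what makes the sums over walks satisfy a
  recursion with constant coefficients.\<close>

locale unimodular_weights =
  fixes N :: nat and h :: "nat \<Rightarrow> nat \<Rightarrow> complex"
  assumes diag: "i < N \<Longrightarrow> h i i = 0"
    and inv: "i < N \<Longrightarrow> j < N \<Longrightarrow> i \<noteq> j \<Longrightarrow> h i j * h j i = 1"
begin

lemma sum_inv:
  assumes "i < N"
  shows "(\<Sum>l<N. h i l * (h l i * f l)) = (\<Sum>l\<in>{..<N} - {i}. f l)"
proof -
  have "(\<Sum>l<N. h i l * (h l i * f l)) = h i i * (h i i * f i) + (\<Sum>l\<in>{..<N} - {i}. h i l * (h l i * f l))"
    using assms by (simp add: sum.remove[of "{..<N}" i])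
  also have "(\<Sum>l\<in>{..<N} - {i}. h i l * (h l i * f l)) = (\<Sum>l\<in>{..<N} - {i}. f l)"
    using assms inv by (intro sum.cong refl) (auto simp: mult.assoc[symmetric])
  finally show ?thesis using assms by (simp add: diag)
qed

lemma nb_sum_1: "j < N \<Longrightarrow> nb_sum N h (Suc 0) i j = h i j"
  by (simp add: if_distrib[of "\<lambda>x. _ * x"] cong: if_cong)

text \<open>Multiplication by \<open>h\<close> admits one thing too many: walks that return to
  \<open>i\<close> in their second step. That excursion has weight 1, so these walks contribute the
  subtracted sum over the visited vertex \<open>l\<close>, which the continuation from
  \<open>i\<close> must still avoid.\<close>

lemma nb_sum_step:
  assumes i: "i < N"
  shows "nb_sum N h (Suc (Suc r)) i j =
    mat_prod N h (nb_sum N h (Suc r)) i j - (\<Sum>l\<in>{..<N} - {i}. nb_sum_from N h r l i j)"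
proof -
  have "nb_sum N h (Suc (Suc r)) i j = (\<Sum>l<N. h i l * nb_sum_from N h (Suc r) i l j)" by simp
  also have "\<dots> = (\<Sum>l<N. h i l * nb_sum N h (Suc r) l j - h i l * (h l i * nb_sum_from N h r l i j))"
    using i by (intro sum.cong refl) (simp only: nb_sum_from_Suc right_diff_distrib)
  finally show ?thesis by (simp only: sum_subtractf sum_inv[OF i] mat_prod_def)
qed

lemma nb_sum_2:
  assumes "i < N" "j < N"
  shows "nb_sum N h 2 i j = mat_prod N h h i j - (of_nat N - 1) * (if i = j then 1 else 0)"
proof -
  have "mat_prod N h (nb_sum N h (Suc 0)) i j = mat_prod N h h i j"
    using assms by (intro mat_prod_cong) (simp only: nb_sum_1)
  then show ?thesis using nb_sum_step[OF assms(1), of 0 j] assms by (simp add: eval_nat_numeral of_nat_diff)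
qed

text \<open>The excursion can visit N - 1 vertices, but the continuation must not use the same
  vertex again; summed over all of them this removes one full copy and leaves N - 2. At length 2
  there is no continuation, and the constant is N - 1.\<close>

lemma nb_sum_rec:
  assumes i: "i < N"
  shows "nb_sum N h (Suc (Suc (Suc r))) i j =
    mat_prod N h (nb_sum N h (Suc (Suc r))) i j - (of_nat N - 2) * nb_sum N h (Suc r) i j"
proof -
  have "(\<Sum>l\<in>{..<N} - {i}. nb_sum_from N h (Suc r) l i j) =
      (\<Sum>l\<in>{..<N} - {i}. nb_sum N h (Suc r) i j - h i l * nb_sum_from N h r i l j)"
    by (intro sum.cong refl nb_sum_from_Suc) auto
  also have "\<dots> = (of_nat N - 1) * nb_sum N h (Suc r) i j - (\<Sum>l\<in>{..<N} - {i}. h i l * nb_sum_from N h r i l j)"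
    using i by (simp add: sum_subtractf of_nat_diff)
  also have "(\<Sum>l\<in>{..<N} - {i}. h i l * nb_sum_from N h r i l j) = nb_sum N h (Suc r) i j"
    using i by (simp add: sum.remove[of "{..<N}" i] diag)
  finally have "(\<Sum>l\<in>{..<N} - {i}. nb_sum_from N h (Suc r) l i j) = (of_nat N - 2) * nb_sum N h (Suc r) i j"
    by (simp add: algebra_simps)
  then show ?thesis using nb_sum_step[OF i, of "Suc r" j] by simp
qed

text \<open>With \<open>q = N - 2\<close>, both sides satisfy the recursion \<open>x\<^sub>r\<^sub>+\<^sub>2 = h x\<^sub>r\<^sub>+\<^sub>1 - q x\<^sub>r\<close>.\<close>

lemma cheb_seq_diff_eq_nb_sum:
  assumes "i < N" "j < N"
  shows "cheb_seq N h (of_nat N - 2) (r + 3) i j - cheb_seq N h (of_nat N - 2) (r + 1) i j =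
    nb_sum N h (r + 3) i j - (of_nat N - 2) * nb_sum N h (r + 1) i j"
  using assms
proof (induction r arbitrary: i j rule: less_induct)
  case (less r)
  define q :: complex where "q = of_nat N - 2"
  define A where "A r i j = nb_sum N h r i j" for r i j
  define T where "T r i j = cheb_seq N h q r i j" for r i j
  have Ar: "A (r + 3) i j = mat_prod N h (A (r + 2)) i j - q * A (r + 1) i j" if "i < N" for r i j
    using nb_sum_rec[OF that, of r j] unfolding A_def q_def by (simp add: eval_nat_numeral del: nb_sum.simps)
  have Tr: "T (r + 2) i j = mat_prod N h (T (r + 1)) i j - q * T r i j" for r i j
    using cheb_seq.simps(3)[of N h q r] unfolding T_def by (simp add: eval_nat_numeral del: cheb_seq.simps)
  have A1: "A 1 i j = h i j" if "j < N" for i j using nb_sum_1[OF that] by (simp add: A_def del: nb_sum.simps)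
  have A2: "A 2 i j = mat_prod N h h i j - (q + 1) * (if i = j then 1 else 0)" if "i < N" "j < N" for i j
    using nb_sum_2[OF that] by (simp add: A_def q_def)
  have T1: "T 1 i j = h i j" for i j by (simp add: T_def)
  have T2: "T 2 i j = mat_prod N h h i j - 2 * q * (if i = j then 1 else 0)" if "i < N" "j < N" for i j
    using cheb_seq_two[OF that, of h q] by (simp add: T_def)
  have unit: "mat_prod N h (\<lambda>i j. c * (if i = j then 1 else 0)) i j = c * h i j" if "i < N" "j < N" for c i j
    using mat_prod_scaled_unit[OF that, of h c] by (simp add: mat_prod_scale if_distrib cong: if_cong)
  have A3: "A 3 i j = mat_prod N h (mat_prod N h h) i j - (q + 1) * h i j - q * h i j" if "i < N" "j < N" for i j
  proof -
    have "mat_prod N h (A 2) i j = mat_prod N h (\<lambda>i j. mat_prod N h h i j - (q + 1) * (if i = j then 1 else 0)) i j"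
      using that by (intro mat_prod_cong A2) auto
    moreover have "A 3 i j = mat_prod N h (A 2) i j - q * A 1 i j"
      using Ar[OF that(1), of 0 j] by (simp only: add_0)
    ultimately show ?thesis using A1[of j i] that by (simp only: mat_prod_diff unit)
  qed
  have T3: "T 3 i j = mat_prod N h (mat_prod N h h) i j - 2 * q * h i j - q * h i j" if "i < N" "j < N" for i j
  proof -
    have "mat_prod N h (T 2) i j = mat_prod N h (\<lambda>i j. mat_prod N h h i j - 2 * q * (if i = j then 1 else 0)) i j"
      using that by (intro mat_prod_cong T2) auto
    moreover have "T 3 i j = mat_prod N h (T 2) i j - q * T 1 i j"
      using Tr[of 1 i j] by (simp add: eval_nat_numeral)
    ultimately show ?thesis using T1[of i j] that by (simp only: mat_prod_diff unit)
  qed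
  have D1: "T 3 i j - T 1 i j = A 3 i j - q * A 1 i j" if "i < N" "j < N" for i j
    by (simp only: A1[OF that(2)] T1 A3[OF that] T3[OF that]) (simp add: algebra_simps)
  have IH: "T (s + 3) i j - T (s + 1) i j = A (s + 3) i j - q * A (s + 1) i j" if "s < r" "i < N" "j < N" for s i j
    using less.IH[OF that] by (simp add: T_def A_def q_def)
  have "T (r + 3) i j - T (r + 1) i j = A (r + 3) i j - q * A (r + 1) i j"
  proof -
    \<comment> \<open>The recursion for \<open>A\<close> starts at length 3, so the identities for
      lengths 3 and 4 are computed from the exceptional values at length 2.\<close>
    consider "r = 0" | "r = 1" | r' where "r = Suc (Suc r')" by (rule nat_two_step_cases)
    then show ?thesis
    proof cases
      case 1
      then show ?thesis using D1[OF less.prems] by (simp only: add_0)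
    next
      case 2
      have "mat_prod N h (\<lambda>i j. T 3 i j - T 1 i j) i j = mat_prod N h (\<lambda>i j. A 3 i j - q * A 1 i j) i j"
        using less.prems by (intro mat_prod_cong D1)
      then have "mat_prod N h (T 3) i j - mat_prod N h (T 1) i j = mat_prod N h (A 3) i j - q * mat_prod N h (A 1) i j"
        by (simp only: mat_prod_diff mat_prod_scale)
      moreover have "T 4 i j = mat_prod N h (T 3) i j - q * T 2 i j" using Tr[of 2 i j] by simp
      moreover have "A 4 i j = mat_prod N h (A 3) i j - q * A 2 i j" using Ar[of i 1 j] less.prems by (simp add: eval_nat_numeral)
      moreover have "mat_prod N h (A 1) i j = mat_prod N h h i j" using less.prems by (intro mat_prod_cong A1)
      moreover have "mat_prod N h (T 1) i j = mat_prod N h h i j" using less.prems by (intro mat_prod_cong T1)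
      ultimately have "T 4 i j - T 2 i j = A 4 i j - q * A 2 i j"
        using A2[OF less.prems] T2[OF less.prems] by Groebner_Basis.algebra
      moreover have "r + 3 = 4" "r + 1 = 2" using 2 by simp_all
      ultimately show ?thesis by (simp only:)
    next
      case (3 s)
      have "mat_prod N h (\<lambda>i j. T (s + 1 + 3) i j - T (s + 1 + 1) i j) i j =
          mat_prod N h (\<lambda>i j. A (s + 1 + 3) i j - q * A (s + 1 + 1) i j) i j"
        using less.prems 3 by (intro mat_prod_cong IH) auto
      then have "mat_prod N h (T (s + 4)) i j - mat_prod N h (T (s + 2)) i j = mat_prod N h (A (s + 4)) i j - q * mat_prod N h (A (s + 2)) i j"
        by (simp only: mat_prod_diff mat_prod_scale) (simp add: eval_nat_numeral)
      moreover have "T (s + 3) i j - T (s + 1) i j = A (s + 3) i j - q * A (s + 1) i j"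
        using IH less.prems 3 by simp
      moreover have "T (s + 5) i j = mat_prod N h (T (s + 4)) i j - q * T (s + 3) i j"
        using Tr[of "s + 3" i j] by (simp add: eval_nat_numeral)
      moreover have "T (s + 3) i j = mat_prod N h (T (s + 2)) i j - q * T (s + 1) i j"
        using Tr[of "s + 1" i j] by (simp add: eval_nat_numeral)
      moreover have "A (s + 5) i j = mat_prod N h (A (s + 4)) i j - q * A (s + 3) i j"
        using Ar[of i "s + 2" j] less.prems by (simp add: eval_nat_numeral)
      moreover have "A (s + 3) i j = mat_prod N h (A (s + 2)) i j - q * A (s + 1) i j"
        using Ar[of i s j] less.prems by (simp add: eval_nat_numeral)
      ultimately have "T (s + 5) i j - T (s + 3) i j = A (s + 5) i j - q * A (s + 3) i j"
        by Groebner_Basis.algebra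
      moreover have "r + 3 = s + 5" "r + 1 = s + 3" using 3 by simp_all
      ultimately show ?thesis by (simp only:)
    qed
  qed
  then show ?case by (simp add: T_def A_def q_def)
qed

text \<open>Comparing the second vertex with the last one is the non-backtracking condition across
  the base point. \<open>Bsum\<close> keeps the cyclically non-backtracking walks,
  \<open>Tailsum\<close> those that start and end with the same edge, a tail.\<close>

definition Bsum :: "nat \<Rightarrow> complex" where
  "Bsum r = (\<Sum>xs\<in>lists_below N r.
     if nb_list (closed_list xs) \<and> xs ! 1 \<noteq> last xs then path_weight h (closed_list xs) else 0)"

definition Tailsum :: "nat \<Rightarrow> complex" where
  "Tailsum r = (\<Sum>xs\<in>lists_below N r.
     if nb_list (closed_list xs) \<and> xs ! 1 = last xs then path_weight h (closed_list xs) else 0)"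

lemma trace_eq_Bsum_Tailsum: "(\<Sum>i<N. nb_sum N h (Suc r) i i) = Bsum (Suc r) + Tailsum (Suc r)"
  unfolding trace_nb_sum Bsum_def Tailsum_def sum.distrib[symmetric] by (intro sum.cong) auto

lemma nb_list_snoc: "length xs \<ge> 2 \<Longrightarrow> nb_list (xs @ [x]) \<longleftrightarrow> nb_list xs \<and> xs ! (length xs - 2) \<noteq> x"
proof (induction xs rule: nb_list.induct)
  case (1 x y z zs)
  then show ?case by (cases zs) auto
next
  case ("2_3" v vb)
  then show ?case by (cases vb) auto
qed auto

lemma path_weight_snoc: "xs \<noteq> [] \<Longrightarrow> path_weight h (xs @ [x]) = path_weight h xs * h (last xs) x"
  by (induction h xs rule: path_weight.induct) (auto split: list.splits)

text \<open>Cut off the first and last step of a walk with a tail: their joint weight is 1 and a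
  closed walk \<open>ys\<close> remains. The removed base point can be any vertex except the first,
  second and last of \<open>ys\<close>. These are two vertices if \<open>ys\<close> has a tail
  itself and three otherwise.\<close>

lemma Tailsum_step:
  assumes r: "r \<ge> 2"
  shows "Tailsum (r + 2) = (of_nat N - 3) * Bsum r + (of_nat N - 2) * Tailsum r"
proof -
  define P where "P ys \<longleftrightarrow> nb_list (closed_list ys)" for ys
  define W where "W ys = path_weight h (closed_list ys)" for ys
  define F where "F xs = (if nb_list (closed_list xs) \<and> xs ! 1 = last xs then path_weight h (closed_list xs) else 0)" for xs
  have F: "F (x # ys @ [z]) = (if z = hd ys \<and> P ys \<and> x \<noteq> ys ! 1 \<and> x \<noteq> last ys
      then h x (hd ys) * h (hd ys) x * W ys else 0)" if ys: "ys \<in> lists_below N r" for x z ys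
  proof -
    have len: "length ys \<ge> 2" using ys r by (simp add: lists_below_def)
    then obtain a b cs where ab: "ys = a # b # cs"
      by (metis Suc_le_length_iff numeral_2_eq_2)
    have c: "closed_list (x # ys @ [z]) = (x # (ys @ [z])) @ [x]" by (simp add: closed_list_def)
    have n: "nb_list (closed_list (x # ys @ [z])) \<longleftrightarrow> x \<noteq> b \<and> nb_list (ys @ [z]) \<and> last ys \<noteq> x"
    proof -
      have "nb_list ((x # (ys @ [z])) @ [x]) \<longleftrightarrow>
          nb_list (x # ys @ [z]) \<and> (x # ys @ [z]) ! (length (x # ys @ [z]) - 2) \<noteq> x"
        by (rule nb_list_snoc) simp
      also have "(x # ys @ [z]) ! (length (x # ys @ [z]) - 2) = last ys"
        using ab by (simp add: nth_append last_conv_nth nth_Cons')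
      also have "nb_list (x # ys @ [z]) \<longleftrightarrow> x \<noteq> b \<and> nb_list (ys @ [z])" by (simp add: ab)
      finally show ?thesis unfolding c by auto
    qed
    have w: "path_weight h (closed_list (x # ys @ [z])) = h x a * path_weight h (ys @ [z]) * h z x"
      unfolding c by (subst path_weight_snoc) (simp_all add: ab)
    have l: "(x # ys @ [z]) ! 1 = a" "last (x # ys @ [z]) = z" by (simp_all add: ab)
    have "hd ys = a" "ys ! 1 = b" by (simp_all add: ab)
    then show ?thesis unfolding F_def n w l unfolding P_def W_def closed_list_def by auto
  qed
  have "Tailsum (r + 2) = (\<Sum>xs\<in>lists_below N (Suc (Suc r)). F xs)"
    by (simp add: Tailsum_def F_def)
  also have "\<dots> = (\<Sum>x<N. \<Sum>z<N. \<Sum>ys\<in>lists_below N r. F (x # ys @ [z]))"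
    by (subst sum_lists_below_Cons) (intro sum.cong refl sum_lists_below_snoc)
  also have "\<dots> = (\<Sum>ys\<in>lists_below N r. \<Sum>x<N. \<Sum>z<N. F (x # ys @ [z]))"
    by (subst sum.swap, subst (2) sum.swap, rule sum.cong) (auto intro: sum.swap)
  also have "\<dots> = (\<Sum>ys\<in>lists_below N r. if P ys then
      (if ys ! 1 = last ys then of_nat N - 2 else of_nat N - 3) * W ys else 0)"
  proof (intro sum.cong refl)
    fix ys assume ys: "ys \<in> lists_below N r"
    then have len: "length ys \<ge> 2" using r by (simp add: lists_below_def)
    then obtain a b cs where ab: "ys = a # b # cs"
      by (metis Suc_le_length_iff numeral_2_eq_2)
    have "last ys \<in> set ys" using ab by (intro last_in_set) simp
    then have mem: "a < N" "b < N" "last ys < N" using ys ab by (auto simp: lists_below_def)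
    have "(\<Sum>x<N. \<Sum>z<N. F (x # ys @ [z])) =
        (\<Sum>x<N. if P ys \<and> x \<noteq> b \<and> x \<noteq> last ys then h a x * (h x a * W ys) else 0)"
    proof (intro sum.cong refl)
      fix x
      have "hd ys = a" "ys ! 1 = b" by (simp_all add: ab)
      then show "(\<Sum>z<N. F (x # ys @ [z])) = (if P ys \<and> x \<noteq> b \<and> x \<noteq> last ys then h a x * (h x a * W ys) else 0)"
        unfolding F[OF ys] using mem by (cases "P ys \<and> x \<noteq> b \<and> x \<noteq> last ys") (auto simp: mult_ac)
    qed
    also have "\<dots> = (\<Sum>x<N. h a x * (h x a * (if P ys \<and> x \<noteq> b \<and> x \<noteq> last ys then W ys else 0)))"
      by (intro sum.cong refl) auto
    also have "\<dots> = (\<Sum>x\<in>{..<N} - {a}. if P ys \<and> x \<noteq> b \<and> x \<noteq> last ys then W ys else 0)"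
      using mem by (simp only: sum_inv)
    also have "\<dots> = (if P ys then of_nat (card ({..<N} - {a, b, last ys})) * W ys else 0)"
    proof -
      have "(\<Sum>x\<in>{..<N} - {a}. if x \<noteq> b \<and> x \<noteq> last ys then W ys else 0) =
          (\<Sum>x\<in>{..<N} - {a, b, last ys}. W ys)"
        by (rule sum.mono_neutral_cong_right) auto
      then show ?thesis by simp
    qed
    also have "\<dots> = (if P ys then (if ys ! 1 = last ys then of_nat N - 2 else of_nat N - 3) * W ys else 0)"
    \<comment> \<open>A nonzero weight excludes loops, so the first vertex differs from the second
      and from the last one; only the latter two may coincide.\<close>
    proof (cases "W ys = 0")
      case False
      have "a \<noteq> b"
      proof
        assume "a = b"
        then show False using False mem diag by (simp add: W_def closed_list_def ab)
      qed
      moreover have "a \<noteq> last ys"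
      proof
        assume "a = last ys"
        moreover have "W ys = path_weight h ys * h (last ys) (hd ys)"
          unfolding W_def closed_list_def by (rule path_weight_snoc) (simp add: ab)
        moreover have "hd ys = a" by (simp add: ab)
        ultimately show False using False mem diag[of a] by auto
      qed
      ultimately have "card {a, b, last ys} = (if b = last ys then 2 else 3)" by auto
      moreover have "card ({..<N} - {a, b, last ys}) = N - card {a, b, last ys}"
        using mem by (subst card_Diff_subset) auto
      moreover have "card {a, b, last ys} \<le> card {..<N}" using mem by (intro card_mono) auto
      ultimately show ?thesis by (auto simp: ab of_nat_diff split: if_splits)
    qed simp
    finally show "(\<Sum>x<N. \<Sum>z<N. F (x # ys @ [z])) =
        (if P ys then (if ys ! 1 = last ys then of_nat N - 2 else of_nat N - 3) * W ys else 0)" .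
  qed
  also have "\<dots> = (of_nat N - 3) * Bsum r + (of_nat N - 2) * Tailsum r"
    unfolding Bsum_def Tailsum_def sum_distrib_left sum.distrib[symmetric] P_def W_def
    by (intro sum.cong refl) auto
  finally show ?thesis .
qed

end

section \<open>Cyclically non-backtracking walks\<close>

definition cyc_walks :: "nat \<Rightarrow> nat \<Rightarrow> nat list set" where
  "cyc_walks N r = {xs \<in> lists_below N r.
     \<forall>i<r. xs ! i \<noteq> xs ! ((i + 1) mod r) \<and> xs ! i \<noteq> xs ! ((i + 2) mod r)}"

text \<open>Polymorphic because it is applied to the complex entries of the matrix and to their real
  signs.\<close>

definition walk_weight :: "(nat \<Rightarrow> nat \<Rightarrow> 'a::comm_monoid_mult) \<Rightarrow> nat list \<Rightarrow> 'a" where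
  "walk_weight h xs = (\<Prod>i<length xs. h (xs ! i) (xs ! ((i + 1) mod length xs)))"

lemma finite_cyc_walks [simp]: "finite (cyc_walks N r)"
  by (simp add: cyc_walks_def)

lemma path_weight_eq_prod: "path_weight h zs = (\<Prod>i<length zs - 1. h (zs ! i) (zs ! Suc i))"
proof (induction h zs rule: path_weight.induct)
  case (1 h x y ys)
  then show ?case by (simp add: prod.lessThan_Suc_shift del: prod.lessThan_Suc)
qed auto

lemma nb_list_iff: "nb_list zs \<longleftrightarrow> (\<forall>i. i + 2 < length zs \<longrightarrow> zs ! i \<noteq> zs ! (i + 2))"
proof (induction zs rule: nb_list.induct)
  case (1 x y z zs)
  have "(\<forall>i. i + 2 < length (x # y # z # zs) \<longrightarrow> (x # y # z # zs) ! i \<noteq> (x # y # z # zs) ! (i + 2)) \<longleftrightarrow>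
    x \<noteq> z \<and> (\<forall>i. i + 2 < length (y # z # zs) \<longrightarrow> (y # z # zs) ! i \<noteq> (y # z # zs) ! (i + 2))"
    (is "(\<forall>i. ?P i) \<longleftrightarrow> _")
  proof -
    have "(\<forall>i. ?P i) \<longleftrightarrow> ?P 0 \<and> (\<forall>i. ?P (Suc i))" using not0_implies_Suc by metis
    then show ?thesis by simp
  qed
  then show ?case using 1 by simp
qed auto

lemma closed_list_nth:
  assumes "i \<le> length xs" "xs \<noteq> []"
  shows "closed_list xs ! i = xs ! (i mod length xs)"
  using assms by (cases "i = length xs") (auto simp: closed_list_def nth_append hd_conv_nth)

lemma path_weight_closed_list: "xs \<noteq> [] \<Longrightarrow> path_weight h (closed_list xs) = walk_weight h xs"
  unfolding path_weight_eq_prod walk_weight_def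
  by (rule prod.cong) (auto simp: closed_list_nth, auto simp: closed_list_def)

lemma nb_list_closed_list:
  assumes "length xs = r" "r \<ge> 2"
  shows "nb_list (closed_list xs) \<and> xs ! 1 \<noteq> last xs \<longleftrightarrow> (\<forall>i<r. xs ! i \<noteq> xs ! ((i + 2) mod r))"
proof -
  have ne: "xs \<noteq> []" using assms by auto
  have "nb_list (closed_list xs) \<longleftrightarrow> (\<forall>i<r - 1. xs ! i \<noteq> xs ! ((i + 2) mod r))"
    unfolding nb_list_iff using assms ne
    by (intro all_cong1) (auto simp: closed_list_nth closed_list_def[of xs, THEN arg_cong[where f = length]])
  moreover have "xs ! 1 \<noteq> last xs \<longleftrightarrow> xs ! (r - 1) \<noteq> xs ! ((r - 1 + 2) mod r)"
  proof -
    have "r - 1 + 2 = r + 1" using assms by simp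
    then have "(r - 1 + 2) mod r = 1" using assms mod_add_self1[of r 1] by simp
    then show ?thesis using ne assms by (auto simp: last_conv_nth)
  qed
  moreover have "(\<forall>i<r. P i) \<longleftrightarrow> (\<forall>i<r - 1. P i) \<and> P (r - 1)" for P
    using assms(2) by (metis Suc_diff_1 less_Suc_eq less_le_trans zero_less_numeral)
  ultimately show ?thesis by simp
qed

context unimodular_weights
begin

text \<open>The lists that are lost in passing to \<open>cyc_walks\<close> contain a loop and
  therefore have weight 0.\<close>

lemma Bsum_eq:
  assumes "r \<ge> 2"
  shows "Bsum r = (\<Sum>w\<in>cyc_walks N r. walk_weight h w)"
  unfolding Bsum_def
proof (rule sum.mono_neutral_cong_right)
  show "\<forall>xs\<in>lists_below N r - cyc_walks N r.
      (if nb_list (closed_list xs) \<and> xs ! 1 \<noteq> last xs then path_weight h (closed_list xs) else 0) = 0"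
  proof
    fix xs assume xs: "xs \<in> lists_below N r - cyc_walks N r"
    then have len: "length xs = r" and sub: "set xs \<subseteq> {..<N}" by (auto simp: lists_below_def)
    show "(if nb_list (closed_list xs) \<and> xs ! 1 \<noteq> last xs then path_weight h (closed_list xs) else 0) = 0"
    proof (cases "nb_list (closed_list xs) \<and> xs ! 1 \<noteq> last xs")
      case True
      then have "\<forall>i<r. xs ! i \<noteq> xs ! ((i + 2) mod r)" using nb_list_closed_list[OF len assms] by blast
      then obtain i where i: "i < r" "xs ! i = xs ! ((i + 1) mod r)"
        using xs by (auto simp: cyc_walks_def)
      have "xs ! i < N" using i len sub by (meson lessThan_iff nth_mem subsetD)
      then have "h (xs ! i) (xs ! ((i + 1) mod length xs)) = 0" using i len diag by simp
      then have "walk_weight h xs = 0" using i len unfolding walk_weight_def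
        by (intro prod_zero bexI[of _ i]) simp_all
      moreover have "xs \<noteq> []" using len assms by auto
      ultimately show ?thesis by (simp add: path_weight_closed_list)
    qed auto
  qed
  fix xs assume "xs \<in> cyc_walks N r"
  then have len: "length xs = r" and "\<forall>i<r. xs ! i \<noteq> xs ! ((i + 2) mod r)"
    by (auto simp: cyc_walks_def lists_below_def)
  then have "nb_list (closed_list xs) \<and> xs ! 1 \<noteq> last xs" using nb_list_closed_list[OF len assms] by blast
  moreover have "xs \<noteq> []" using len assms by auto
  ultimately show "(if nb_list (closed_list xs) \<and> xs ! 1 \<noteq> last xs then path_weight h (closed_list xs) else 0) =
      walk_weight h xs" by (simp add: path_weight_closed_list)
qed (auto simp: cyc_walks_def)

lemma Bsum_2: "Bsum 2 = 0"
proof -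
  have "w \<notin> cyc_walks N 2" for w by (auto simp: cyc_walks_def intro: exI[of _ "0::nat"])
  then have "cyc_walks N 2 = {}" by blast
  then show ?thesis by (simp add: Bsum_eq)
qed

text \<open>With q = N - 2 the tails cancel: \<open>Tailsum_step\<close> gives
  \<open>Tailsum (r + 2) - q * Tailsum r = (q - 1) * Bsum r\<close>, and together with the term
  \<open>- q * Bsum r\<close> only \<open>- Bsum r\<close> is left.\<close>

lemma trace_cheb_seq_step:
  assumes "r \<ge> 2"
  shows "(\<Sum>i<N. cheb_seq N h (of_nat N - 2) (r + 2) i i) - (\<Sum>i<N. cheb_seq N h (of_nat N - 2) r i i) = Bsum (r + 2) - Bsum r"
proof -
  define q :: complex where "q = of_nat N - 2"
  obtain s where s: "r = Suc s" "s \<ge> 1" using assms by (cases r) auto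
  have "(\<Sum>i<N. cheb_seq N h q (r + 2) i i) - (\<Sum>i<N. cheb_seq N h q r i i) =
      (\<Sum>i<N. cheb_seq N h q ((r - 1) + 3) i i - cheb_seq N h q ((r - 1) + 1) i i)"
    using assms by (simp add: sum_subtractf)
  also have "\<dots> = (\<Sum>i<N. nb_sum N h ((r - 1) + 3) i i - q * nb_sum N h ((r - 1) + 1) i i)"
    unfolding q_def by (intro sum.cong refl cheb_seq_diff_eq_nb_sum) auto
  also have "\<dots> = (\<Sum>i<N. nb_sum N h (Suc (Suc r)) i i) - q * (\<Sum>i<N. nb_sum N h (Suc s) i i)"
    using s by (simp add: sum_subtractf sum_distrib_left eval_nat_numeral del: nb_sum.simps)
  also have "\<dots> = Bsum (r + 2) + Tailsum (r + 2) - q * (Bsum r + Tailsum r)"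
    unfolding trace_eq_Bsum_Tailsum using s by simp
  also have "\<dots> = Bsum (r + 2) - Bsum r"
    unfolding Tailsum_step[OF assms] q_def by (simp add: algebra_simps)
  finally show ?thesis unfolding q_def .
qed

lemma trace_cheb_seq_2: "(\<Sum>i<N. cheb_seq N h q 2 i i) = of_nat N * (of_nat N - 1) - 2 * q * of_nat N"
proof -
  have "mat_prod N h h i i = of_nat N - 1" if "i < N" for i
    using sum_inv[OF that, of "\<lambda>_. 1"] that by (simp add: mat_prod_def of_nat_diff)
  then have "(\<Sum>i<N. cheb_seq N h q 2 i i) = (\<Sum>i<N. (of_nat N - 1) - q * 2)"
    by (intro sum.cong refl) (simp add: cheb_seq_two)
  then show ?thesis by (simp add: algebra_simps)
qed

text \<open>Telescoping from k = 1, where there are no cyclic walks and the trace is N(N - 1) - 2(N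
  - 2)N = N(3 - N).\<close>

lemma trace_cheb_seq_eq_Bsum:
  assumes "k \<ge> 1"
  shows "(\<Sum>i<N. cheb_seq N h (of_nat N - 2) (2 * k) i i) = Bsum (2 * k) + of_nat N * (3 - of_nat N)"
  using assms
proof (induction k rule: dec_induct)
  case base
  show ?case unfolding mult_1_right trace_cheb_seq_2 Bsum_2 by (simp add: algebra_simps)
next
  case (step k)
  have "2 * Suc k = 2 * k + 2" by simp
  moreover have "2 * k \<ge> 2" using step.hyps by simp
  moreover have "x' = b' + c" if "x' - x = b' - b" "x = b + c" for x x' b b' c :: complex
    using that by (simp add: algebra_simps)
  ultimately show ?case using trace_cheb_seq_step[of "2 * k"] step.IH by metis
qed

text \<open>The last summand does not involve \<open>h\<close>, so it disappears from the centred
  statistic and from its increments.\<close>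

lemma trace_cheb_seq_expansion:
  assumes "n \<ge> 2"
  shows "(\<Sum>i<N. cheb_seq N h (of_nat N) (2 * n) i i) =
    (\<Sum>l\<in>{2..n}. of_real (trace_coeff (real N) n l) * (\<Sum>w\<in>cyc_walks N (2 * l). walk_weight h w)) +
    of_real (trace_coeff (real N) n 0 * 2 * real N + (\<Sum>l\<in>{1..n}. trace_coeff (real N) n l * (real N * (3 - real N))))"
proof -
  define b where "b l = complex_of_real (trace_coeff (real N) n l)" for l
  define T where "T l = (\<Sum>i<N. cheb_seq N h (of_nat N - 2) (2 * l) i i)" for l
  have "(\<Sum>i<N. cheb_seq N h (of_nat N) (2 * n) i i) = (\<Sum>i<N. \<Sum>l\<le>n. b l * cheb_seq N h (of_nat N - 2) (2 * l) i i)"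
    unfolding b_def by (intro sum.cong refl cheb_seq_change_parameter) auto
  also have "\<dots> = (\<Sum>l\<le>n. b l * T l)"
    by (subst sum.swap) (simp add: T_def sum_distrib_left)
  also have "\<dots> = b 0 * T 0 + (\<Sum>l\<in>{1..n}. b l * T l)"
    by (simp add: atMost_atLeast0 sum.atLeast_Suc_atMost)
  also have "(\<Sum>l\<in>{1..n}. b l * T l) = (\<Sum>l\<in>{1..n}. b l * Bsum (2 * l)) + (\<Sum>l\<in>{1..n}. b l * (of_nat N * (3 - of_nat N)))"
    unfolding sum.distrib[symmetric] T_def by (intro sum.cong refl) (subst trace_cheb_seq_eq_Bsum, auto simp: algebra_simps)
  also have "(\<Sum>l\<in>{1..n}. b l * Bsum (2 * l)) = (\<Sum>l\<in>{2..n}. b l * Bsum (2 * l))"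
  proof -
    have "{1..n} = insert 1 {2..n}" using assms by auto
    then show ?thesis by (simp add: Bsum_2)
  qed
  also have "\<dots> = (\<Sum>l\<in>{2..n}. b l * (\<Sum>w\<in>cyc_walks N (2 * l). walk_weight h w))"
    by (intro sum.cong refl) (simp add: Bsum_eq)
  finally have "(\<Sum>i<N. cheb_seq N h (of_nat N) (2 * n) i i) =
      (\<Sum>l\<in>{2..n}. b l * (\<Sum>w\<in>cyc_walks N (2 * l). walk_weight h w)) +
      (b 0 * T 0 + (\<Sum>l\<in>{1..n}. b l * (of_nat N * (3 - of_nat N))))" by (simp add: algebra_simps)
  moreover have "b 0 * T 0 + (\<Sum>l\<in>{1..n}. b l * (of_nat N * (3 - of_nat N))) =
      of_real (trace_coeff (real N) n 0 * 2 * real N + (\<Sum>l\<in>{1..n}. trace_coeff (real N) n l * (real N * (3 - real N))))"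
    by (simp add: b_def T_def)
  ultimately show ?thesis by (simp add: b_def)
qed

end

section \<open>Entries of a polynomial in a matrix\<close>

lemma poly_entry_extend:
  assumes "degree p \<le> K"
  shows "(\<Sum>k\<le>degree p. of_real (coeff p k) * f k) = (\<Sum>k\<le>K. complex_of_real (coeff p k) * f k)"
  using assms by (intro sum.mono_neutral_left) (auto simp: coeff_eq_0)

definition poly_entry :: "real poly \<Rightarrow> complex mat \<Rightarrow> nat \<Rightarrow> nat \<Rightarrow> complex" where
  "poly_entry p X i j = (\<Sum>k\<le>degree p. of_real (coeff p k) * (X ^\<^sub>m k) $$ (i, j))"

lemma poly_entry_eq_sum: "degree p \<le> K \<Longrightarrow> poly_entry p X i j = (\<Sum>k\<le>K. of_real (coeff p k) * (X ^\<^sub>m k) $$ (i, j))"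
  unfolding poly_entry_def by (rule poly_entry_extend)

lemma poly_entry_diff: "poly_entry (p - q) X i j = poly_entry p X i j - poly_entry q X i j"
proof -
  define K where "K = max (degree p) (degree q)"
  have "degree (p - q) \<le> K" "degree p \<le> K" "degree q \<le> K"
    by (auto simp: K_def intro: degree_diff_le)
  then show ?thesis by (simp add: poly_entry_eq_sum[of _ K] sum_subtractf algebra_simps)
qed

lemma pow_mat_Suc_left:
  assumes "X \<in> carrier_mat n n"
  shows "X ^\<^sub>m Suc k = (X :: complex mat) * X ^\<^sub>m k"
proof (induction k)
  case 0
  then show ?case using assms by simp
next
  case (Suc k)
  have "X ^\<^sub>m Suc (Suc k) = (X * X ^\<^sub>m k) * X" using Suc by simp
  also have "\<dots> = X * (X ^\<^sub>m k * X)" using assms by (intro assoc_mult_mat) (auto intro: pow_carrier_mat)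
  finally show ?case by simp
qed

lemma poly_entry_mult_X:
  assumes X: "X \<in> carrier_mat N N" and ij: "i < N" "j < N"
  shows "poly_entry ([:0, 2:] * p) X i j = 2 * (\<Sum>l<N. X $$ (i, l) * poly_entry p X l j)"
proof -
  have pk: "X ^\<^sub>m k \<in> carrier_mat N N" for k using X by (rule pow_carrier_mat)
  have "[:0, 2:] * p = Polynomial.smult 2 (pCons 0 p)" by simp
  then have c: "coeff ([:0, 2:] * p) k = (case k of 0 \<Rightarrow> 0 | Suc k \<Rightarrow> 2 * coeff p k)" for k
    by (simp add: coeff_pCons split: nat.splits)
  have "degree ([:0, 2:] * p) \<le> Suc (degree p)"
    by (rule order_trans[OF degree_mult_le]) simp
  then have "poly_entry ([:0, 2:] * p) X i j = (\<Sum>k\<le>Suc (degree p). of_real (coeff ([:0, 2:] * p) k) * (X ^\<^sub>m k) $$ (i, j))"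
    by (rule poly_entry_eq_sum)
  also have "\<dots> = (\<Sum>k\<le>degree p. of_real (2 * coeff p k) * (X ^\<^sub>m Suc k) $$ (i, j))"
    unfolding c sum.atMost_Suc_shift by simp
  also have "\<dots> = (\<Sum>k\<le>degree p. of_real (2 * coeff p k) * (\<Sum>l<N. X $$ (i, l) * (X ^\<^sub>m k) $$ (l, j)))"
  proof (intro sum.cong refl arg_cong2[where f = "(*)"])
    fix k
    show "(X ^\<^sub>m Suc k) $$ (i, j) = (\<Sum>l<N. X $$ (i, l) * (X ^\<^sub>m k) $$ (l, j))"
      unfolding pow_mat_Suc_left[OF X] using X ij pk[of k]
      by (auto simp: scalar_prod_def atLeast0LessThan intro!: sum.cong)
  qed
  also have "\<dots> = 2 * (\<Sum>l<N. X $$ (i, l) * poly_entry p X l j)"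
    unfolding poly_entry_def sum_distrib_left by (subst sum.swap) (simp add: mult_ac)
  finally show ?thesis .
qed

text \<open>For the rescaled matrix X one has 2X = H / sqrt N. Multiplying by
  \<open>2 * sqrt N ^ r\<close> therefore clears all denominators and turns the Chebyshev recursion
  into the one with parameter \<open>N\<close>.\<close>

lemma poly_entry_chebyshev_rec:
  assumes H: "H \<in> carrier_mat N N" and N: "N \<ge> 1" and ij: "i < N" "j < N"
  shows "2 * of_real (sqrt (real N) ^ r) *
      poly_entry (chebyshev_rec r) (complex_of_real (1 / sqrt (4 * real N)) \<cdot>\<^sub>m H) i j =
    cheb_seq N (\<lambda>i j. H $$ (i, j)) (of_nat N) r i j"
  using ij
proof (induction r arbitrary: i j rule: chebyshev_rec.induct)
  case 1
  then show ?case using H by (simp add: poly_entry_def)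
next
  case 2
  have X: "complex_of_real (1 / sqrt (4 * real N)) \<cdot>\<^sub>m H \<in> carrier_mat N N" using H by simp
  have "poly_entry [:0, 1:] (complex_of_real (1 / sqrt (4 * real N)) \<cdot>\<^sub>m H) i j = complex_of_real (1 / sqrt (4 * real N)) * H $$ (i, j)"
    using X H 2 by (simp add: poly_entry_def)
  moreover have "2 * sqrt (real N) * (1 / sqrt (4 * real N)) = 1" using N by (simp add: real_sqrt_mult)
  moreover have "2 * complex_of_real (sqrt (real N)) * (complex_of_real (1 / sqrt (4 * real N)) * x) =
      complex_of_real (2 * sqrt (real N) * (1 / sqrt (4 * real N))) * x" for x
    by (simp only: of_real_mult of_real_numeral mult.assoc)
  ultimately show ?case
    by (simp only: chebyshev_rec.simps cheb_seq.simps power_Suc0_right of_real_1 mult_1)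
next
  case (3 r)
  define X where "X = complex_of_real (1 / sqrt (4 * real N)) \<cdot>\<^sub>m H"
  define s where "s = sqrt (real N)"
  have X: "X \<in> carrier_mat N N" using H by (simp add: X_def)
  have ss: "s ^ 2 = real N" "s \<noteq> 0" "s > 0" using N by (simp_all add: s_def)
  have Xh: "X $$ (i, l) = of_real (1 / (2 * s)) * H $$ (i, l)" if "l < N" for l
    using H that 3(3) by (simp add: X_def s_def real_sqrt_mult)
  have "2 * of_real (s ^ Suc (Suc r)) * poly_entry (chebyshev_rec (Suc (Suc r))) X i j =
     2 * of_real (s ^ Suc (Suc r)) * (2 * (\<Sum>l<N. X $$ (i, l) * poly_entry (chebyshev_rec (Suc r)) X l j) - poly_entry (chebyshev_rec r) X i j)"
    using 3 by (simp only: chebyshev_rec.simps poly_entry_diff poly_entry_mult_X[OF X])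
  also have "\<dots> = (\<Sum>l<N. H $$ (i, l) * (2 * of_real (s ^ Suc r) * poly_entry (chebyshev_rec (Suc r)) X l j))
      - of_nat N * (2 * of_real (s ^ r) * poly_entry (chebyshev_rec r) X i j)"
  proof -
    have "2 * of_real (s ^ Suc (Suc r)) * (2 * (\<Sum>l<N. X $$ (i, l) * poly_entry (chebyshev_rec (Suc r)) X l j)) =
        (\<Sum>l<N. H $$ (i, l) * (2 * of_real (s ^ Suc r) * poly_entry (chebyshev_rec (Suc r)) X l j))"
      unfolding sum_distrib_left using ss by (intro sum.cong refl) (simp add: Xh field_simps)
    moreover have "2 * of_real (s ^ Suc (Suc r)) * poly_entry (chebyshev_rec r) X i j =
        of_nat N * (2 * of_real (s ^ r) * poly_entry (chebyshev_rec r) X i j)"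
    proof -
      have "s ^ Suc (Suc r) = real N * s ^ r" using ss(1) by (simp add: power2_eq_square)
      then have "complex_of_real (s ^ Suc (Suc r)) = of_nat N * of_real (s ^ r)"
        by (simp only: of_real_mult of_real_of_nat_eq)
      then show ?thesis by (simp only: mult_ac)
    qed
    ultimately show ?thesis by (simp only: right_diff_distrib)
  qed
  also have "\<dots> = cheb_seq N (\<lambda>i j. H $$ (i, j)) (of_nat N) (Suc (Suc r)) i j"
    using 3 unfolding X_def s_def by (simp add: mat_prod_def)
  finally show ?case unfolding X_def s_def .
qed

lemma cheb_trace_eq_cheb_seq:
  assumes H: "H \<in> carrier_mat N N" and N: "N \<ge> 1"
  shows "cheb_trace N n H = (\<Sum>i<N. cheb_seq N (\<lambda>i j. H $$ (i, j)) (of_nat N) (2 * n) i i) / (2 * of_nat N ^ n)"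
proof -
  define X where "X = complex_of_real (1 / sqrt (4 * real N)) \<cdot>\<^sub>m H"
  define p where "p = chebyshev_rec (2 * n)"
  have X: "dim_row X = N" using H by (simp add: X_def)
  have d: "degree (map_poly complex_of_real p) = degree p" by (rule degree_map_poly) simp
  have "cheb_trace N n H = (\<Sum>i<N. poly_entry p X i i)"
    unfolding cheb_trace_def chebyshev_eq_rec X_def[symmetric] p_def[symmetric] mat_trace_def poly_mat_def poly_entry_def d
    by (simp add: X coeff_map_poly)
  moreover have "poly_entry p X i i = cheb_seq N (\<lambda>i j. H $$ (i, j)) (of_nat N) (2 * n) i i / (2 * of_nat N ^ n)" if "i < N" for i
  proof -
    have "sqrt (real N) ^ (2 * n) = real N ^ n" by (simp add: power_mult)
    then have "2 * of_nat N ^ n * poly_entry p X i i = cheb_seq N (\<lambda>i j. H $$ (i, j)) (of_nat N) (2 * n) i i"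
      using poly_entry_chebyshev_rec[OF H N that that, of "2 * n"] by (simp add: p_def X_def)
    then show ?thesis using N by (simp add: field_simps)
  qed
  ultimately show ?thesis by (simp add: sum_divide_distrib)
qed

section \<open>Counting walks by their vertices\<close>

definition edge_at :: "nat list \<Rightarrow> nat \<Rightarrow> nat \<times> nat" where
  "edge_at w i = mk_edge (w ! i) (w ! ((i + 1) mod length w))"

definition edge_mult :: "nat list \<Rightarrow> nat \<times> nat \<Rightarrow> nat" where
  "edge_mult w E = card {i. i < length w \<and> edge_at w i = E}"

definition odd_edges :: "nat list \<Rightarrow> (nat \<times> nat) set" where
  "odd_edges w = {E. odd (edge_mult w E)}"

text \<open>A tuple of walks becomes one passage system on pairs (number of the walk, position),
  whose permutation has one cycle for each walk.\<close>

definition walk_index :: "nat list list \<Rightarrow> (nat \<times> nat) set" where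
  "walk_index ws = (SIGMA j:{..<length ws}. {..<length (ws ! j)})"

definition walk_next :: "nat list list \<Rightarrow> nat \<times> nat \<Rightarrow> nat \<times> nat" where
  "walk_next ws = (\<lambda>(j, i). (j, (i + 1) mod length (ws ! j)))"

definition walk_vertex :: "nat list list \<Rightarrow> nat \<times> nat \<Rightarrow> nat" where
  "walk_vertex ws = (\<lambda>(j, i). ws ! j ! i)"

lemma cyc_walks_length: "w \<in> cyc_walks N r \<Longrightarrow> length w = r"
  by (simp add: cyc_walks_def lists_below_def)

lemma cyc_walks_nth_less: "w \<in> cyc_walks N r \<Longrightarrow> i < r \<Longrightarrow> w ! i < N"
  by (auto simp: cyc_walks_def lists_below_def subset_iff)

lemma Suc_mod_inj:
  assumes "Suc i mod L = Suc j mod L" "i < L" "j < L"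
  shows "i = j"
proof -
  have "Suc k mod L = (if Suc k = L then 0 else Suc k)" if "k < L" for k
    using that by (cases "Suc k = L") simp_all
  from this[OF assms(2)] this[OF assms(3)] assms(1) show ?thesis by (simp split: if_splits)
qed

lemma passage_system_walks:
  assumes "\<forall>w\<in>set ws. w \<in> cyc_walks N (length w)"
  shows "passage_system (walk_index ws) (walk_next ws) (walk_vertex ws)"
proof
  show "finite (walk_index ws)" by (simp add: walk_index_def)
  have "inj_on (walk_next ws) (walk_index ws)"
    unfolding inj_on_def walk_index_def walk_next_def by (auto dest: Suc_mod_inj)
  moreover have "walk_next ws ` walk_index ws \<subseteq> walk_index ws"
    unfolding walk_index_def walk_next_def by (auto intro!: mod_less_divisor)
  ultimately show "bij_betw (walk_next ws) (walk_index ws) (walk_index ws)"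
    unfolding bij_betw_def using endo_inj_surj \<open>finite (walk_index ws)\<close> by blast
next
  fix x assume x: "x \<in> walk_index ws"
  obtain j i where ji: "x = (j, i)" by (cases x)
  then have j: "j < length ws" "i < length (ws ! j)" using x by (auto simp: walk_index_def)
  then have "ws ! j \<in> cyc_walks N (length (ws ! j))" using assms by simp
  then have "ws ! j ! i \<noteq> ws ! j ! ((i + 1) mod length (ws ! j))"
    "ws ! j ! i \<noteq> ws ! j ! ((i + 2) mod length (ws ! j))"
    using j by (auto simp: cyc_walks_def)
  then show "walk_vertex ws x \<noteq> walk_vertex ws (walk_next ws x)" "walk_vertex ws x \<noteq> walk_vertex ws (walk_next ws (walk_next ws x))"
    by (auto simp: ji walk_vertex_def walk_next_def mod_Suc_eq)
qed

lemma card_walk_index: "card (walk_index ws) = length (concat ws)"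
proof -
  have "card (walk_index ws) = (\<Sum>j<length ws. length (ws ! j))" by (simp add: walk_index_def)
  also have "\<dots> = sum_list (map length ws)"
    by (simp add: sum_list_sum_nth atLeast0LessThan)
  finally show ?thesis by (simp add: length_concat)
qed

lemma walk_vertex_image: "walk_vertex ws ` walk_index ws = set (concat ws)"
  by (force simp: walk_vertex_def walk_index_def in_set_conv_nth image_iff)

context
  fixes ws :: "nat list list" and N :: nat
  assumes ws: "\<forall>w\<in>set ws. w \<in> cyc_walks N (length w)"
begin

interpretation passage_system "walk_index ws" "walk_next ws" "walk_vertex ws"
  using ws by (rule passage_system_walks)

lemma e_walks: "x \<in> walk_index ws \<Longrightarrow> e x = edge_at (ws ! fst x) (snd x)"
  unfolding e_def by (cases x) (simp add: walk_vertex_def walk_next_def edge_at_def)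

lemma mu_walks: "mu E = sum_list (map (\<lambda>w. edge_mult w E) ws)"
proof -
  have "{x \<in> walk_index ws. e x = E} = (SIGMA j:{..<length ws}. {i. i < length (ws ! j) \<and> edge_at (ws ! j) i = E})"
    using e_walks by (auto simp: walk_index_def)
  then show ?thesis by (simp add: mu_def edge_mult_def sum_list_sum_nth atLeast0LessThan)
qed

lemma odd_vertices_walks:
  "odd_vertices = {x. \<exists>E. odd (sum_list (map (\<lambda>w. edge_mult w E) ws)) \<and> on_edge x E}"
  by (simp add: odd_vertices_def mu_walks)

lemma even_walks_card:
  assumes "\<And>E. even (sum_list (map (\<lambda>w. edge_mult w E) ws))"
  shows "2 * card (set (concat ws)) \<le> length (concat ws)"
  using even_imp_vertices_le assms by (simp add: mu_walks card_walk_index walk_vertex_image)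

lemma occ_ge_length:
  assumes "\<And>w. w \<in> set ws \<Longrightarrow> x \<in> set w"
  shows "occ x \<ge> length ws"
proof -
  have "\<forall>j<length ws. \<exists>i<length (ws ! j). ws ! j ! i = x"
    using assms by (metis in_set_conv_nth nth_mem)
  then obtain f where f: "\<And>j. j < length ws \<Longrightarrow> f j < length (ws ! j) \<and> ws ! j ! f j = x" by metis
  have "card ((\<lambda>j. (j, f j)) ` {..<length ws}) \<le> occ x"
    unfolding occ_def using f finI by (intro card_mono) (auto simp: walk_index_def walk_vertex_def)
  then show ?thesis by (simp add: card_image inj_on_def)
qed

lemma even_walks_card_common_edge:
  assumes "\<And>E. even (sum_list (map (\<lambda>w. edge_mult w E) ws))"
    and "\<And>w. w \<in> set ws \<Longrightarrow> x \<in> set w" "\<And>w. w \<in> set ws \<Longrightarrow> y \<in> set w" "x \<noteq> y" "length ws = 4"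
  shows "2 * card (set (concat ws)) + 4 \<le> length (concat ws)"
proof -
  have 0: "ws ! 0 \<in> set ws" using assms by simp
  then have "x \<in> set (concat ws)" "y \<in> set (concat ws)" using assms(2)[OF 0] assms(3)[OF 0] by auto
  then show ?thesis
    using even_imp_vertices_le_busy[of x y] occ_ge_length[of x] occ_ge_length[of y] assms
    by (simp add: mu_walks card_walk_index walk_vertex_image)
qed

text \<open>If no step changed membership in \<open>A\<close>, it would be constant along the cycle
  of the walk \<open>ws ! j\<close>.\<close>

lemma connected_single:
  assumes j: "j < length ws"
    and "\<exists>i<length (ws ! j). edge_at (ws ! j) i \<in> A" "\<exists>i<length (ws ! j). edge_at (ws ! j) i \<notin> A"
  shows "\<exists>x\<in>walk_index ws. (e x \<in> A) \<noteq> (e (walk_next ws x) \<in> A)"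
proof (rule ccontr)
  assume neg: "\<not> ?thesis"
  have all: "e (j, i) \<in> A \<longleftrightarrow> e (j, 0) \<in> A" if "i < length (ws ! j)" for i
    using that
  proof (induction i)
    case (Suc i)
    then have "(j, i) \<in> walk_index ws" using j by (simp add: walk_index_def)
    then have "e (j, i) \<in> A \<longleftrightarrow> e (walk_next ws (j, i)) \<in> A" using neg by blast
    moreover have "walk_next ws (j, i) = (j, Suc i)" using Suc by (simp add: walk_next_def)
    ultimately show ?case using Suc by simp
  qed simp
  have "edge_at (ws ! j) i = e (j, i)" if "i < length (ws ! j)" for i
    using that j by (subst e_walks) (auto simp: walk_index_def)
  then have "edge_at (ws ! j) i \<in> A \<longleftrightarrow> e (j, 0) \<in> A" if "i < length (ws ! j)" for i
    using all that by simp
  then show False using assms by blast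
qed

text \<open>A walk, or a pair of walks sharing an edge, is connected, so the odd edges and the repeated
  ones meet somewhere.\<close>

lemma odd_repeated_card:
  assumes shared: "ws = [w] \<or> (ws = [w, w'] \<and> edge_mult w E2 \<ge> 1 \<and> edge_mult w' E2 \<ge> 1)"
    and odd: "odd (sum_list (map (\<lambda>w. edge_mult w E1) ws))"
    and rep: "sum_list (map (\<lambda>w. edge_mult w E2) ws) \<ge> 2"
  shows "2 * card (set (concat ws)) + 2 \<le> length (concat ws) + card odd_vertices"
proof -
  have "2 * card (walk_vertex ws ` walk_index ws) + 2 \<le> card (walk_index ws) + card odd_vertices"
  proof (rule vertices_le_of_odd_and_repeated)
    show "odd (mu E1)" "mu E2 \<ge> 2" using odd rep by (simp_all add: mu_walks)
  next
    fix A assume in_A: "\<exists>i\<in>walk_index ws. e i \<in> A" and out_A: "\<exists>i\<in>walk_index ws. e i \<notin> A"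
    from in_A obtain j i where 1: "j < length ws" "i < length (ws ! j)" "edge_at (ws ! j) i \<in> A"
      using e_walks by (auto simp: walk_index_def)
    from out_A obtain j' i' where 2: "j' < length ws" "i' < length (ws ! j')" "edge_at (ws ! j') i' \<notin> A"
      using e_walks by (auto simp: walk_index_def)
    show "\<exists>x\<in>walk_index ws. (e x \<in> A) \<noteq> (e (walk_next ws x) \<in> A)"
    proof (cases "j = j'")
      case True
      then show ?thesis using connected_single[OF 1(1)] 1 2 by blast
    next
      case False
      \<comment> \<open>The two witnesses lie on different walks. Both walks pass through
        \<open>E2\<close>, so whichever side of \<open>A\<close> this edge is on, one of them meets
        \<open>A\<close> and its complement.\<close>
      then have "ws = [w, w']" and E2: "edge_mult w E2 \<ge> 1" "edge_mult w' E2 \<ge> 1"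
        using shared 1(1) 2(1) by auto
      have "\<exists>i<length (ws ! k). edge_at (ws ! k) i = E2" if "k < length ws" for k
      proof -
        have "k = 0 \<or> k = 1" using that \<open>ws = [w, w']\<close> by auto
        then have "edge_mult (ws ! k) E2 > 0" using E2 \<open>ws = [w, w']\<close> by auto
        then show ?thesis by (auto simp: edge_mult_def card_gt_0_iff)
      qed
      note E2_used = this
      show ?thesis
      proof (cases "E2 \<in> A")
        case True
        then have "\<exists>i<length (ws ! j'). edge_at (ws ! j') i \<in> A" using E2_used[OF 2(1)] by blast
        then show ?thesis using connected_single[OF 2(1), of A] 2 by blast
      next
        case False
        then have "\<exists>i<length (ws ! j). edge_at (ws ! j) i \<notin> A" using E2_used[OF 1(1)] by blast
        then show ?thesis using connected_single[OF 1(1), of A] 1 by blast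
      qed
    qed
  qed
  then show ?thesis by (simp add: card_walk_index walk_vertex_image)
qed

lemma odd_vertices_walks_subset: "odd_vertices \<subseteq> set (concat ws)"
  using odd_vertices_subset by (simp add: walk_vertex_image)

end

text \<open>The two cases serve two estimates: a walk that repeats an edge occurs in the generator
  term, two walks with a common edge occur in the product of two gradients.\<close>

definition connected_repeating :: "nat \<Rightarrow> nat list list \<Rightarrow> bool" where
  "connected_repeating N ws \<longleftrightarrow> (\<forall>w\<in>set ws. w \<in> cyc_walks N (length w)) \<and>
     (\<exists>E. sum_list (map (\<lambda>w. edge_mult w E) ws) \<ge> 2 \<and>
       ((\<exists>w. ws = [w]) \<or> (\<exists>w w'. ws = [w, w'] \<and> edge_mult w E \<ge> 1 \<and> edge_mult w' E \<ge> 1)))"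

text \<open>Each family satisfies the bound with excess 2 and the number of its odd vertices on the
  right. The odd vertices are the same for both, hence lie in the intersection of the vertex sets,
  and inclusion-exclusion subtracts their number twice. What remains is the excess 2 + 2, that is,
  two vertices.\<close>

lemma connected_repeating_pair_card:
  assumes "connected_repeating N ws" "connected_repeating N ws'"
    and same: "\<And>E. odd (sum_list (map (\<lambda>w. edge_mult w E) ws)) \<longleftrightarrow> odd (sum_list (map (\<lambda>w. edge_mult w E) ws'))"
    and odd: "odd (sum_list (map (\<lambda>w. edge_mult w E1) ws))"
  shows "2 * card (set (concat (ws @ ws'))) + 4 \<le> length (concat (ws @ ws'))"
proof -
  define Od where "Od = {x. \<exists>E. odd (sum_list (map (\<lambda>w. edge_mult w E) ws)) \<and> on_edge x E}"
  have Od': "Od = {x. \<exists>E. odd (sum_list (map (\<lambda>w. edge_mult w E) ws')) \<and> on_edge x E}"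
    by (simp only: Od_def same)
  have main: "2 * card (set (concat vs)) + 2 \<le> length (concat vs) + card Od \<and> Od \<subseteq> set (concat vs)"
    if cr: "connected_repeating N vs" and Od: "Od = {x. \<exists>E. odd (sum_list (map (\<lambda>w. edge_mult w E) vs)) \<and> on_edge x E}"
      and odd: "odd (sum_list (map (\<lambda>w. edge_mult w E1) vs))" for vs
  proof -
    have ps: "\<forall>w\<in>set vs. w \<in> cyc_walks N (length w)"
      using cr by (simp add: connected_repeating_def)
    obtain E2 where rep: "sum_list (map (\<lambda>w. edge_mult w E2) vs) \<ge> 2"
      and disj: "(\<exists>w. vs = [w]) \<or> (\<exists>w w'. vs = [w, w'] \<and> edge_mult w E2 \<ge> 1 \<and> edge_mult w' E2 \<ge> 1)"
      using cr unfolding connected_repeating_def by blast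
    from disj have "\<exists>w w'. vs = [w] \<or> (vs = [w, w'] \<and> edge_mult w E2 \<ge> 1 \<and> edge_mult w' E2 \<ge> 1)"
      by (elim disjE exE) simp_all
    then obtain w w' where E2: "vs = [w] \<or> (vs = [w, w'] \<and> edge_mult w E2 \<ge> 1 \<and> edge_mult w' E2 \<ge> 1)"
      by (elim exE)
    have "Od = passage_system.odd_vertices (walk_index vs) (walk_next vs) (walk_vertex vs)"
      unfolding Od odd_vertices_walks[OF ps] ..
    then show ?thesis
      using odd_repeated_card[OF ps E2 odd rep] odd_vertices_walks_subset[OF ps] by simp
  qed
  note 1 = main[OF assms(1) Od_def odd] and 2 = main[OF assms(2) Od' odd[unfolded same]]
  have "card (set (concat ws) \<union> set (concat ws')) + card (set (concat ws) \<inter> set (concat ws')) =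
      card (set (concat ws)) + card (set (concat ws'))"
    by (rule card_Un_Int[symmetric]) auto
  moreover have "card Od \<le> card (set (concat ws) \<inter> set (concat ws'))"
    using 1 2 by (intro card_mono) auto
  ultimately show ?thesis using 1 2 by simp
qed

text \<open>Such a list consists of \<open>D\<close> candidate values, padded with 0 if fewer occur,
  and a pattern of positions among them. Only the first choice depends on \<open>N\<close>, so
  powers of \<open>N\<close> count vertices.\<close>

lemma card_few_distinct:
  assumes "N \<ge> 1"
  shows "card {xs \<in> lists_below N L. card (set xs) \<le> D} \<le> N ^ D * D ^ L"
proof -
  have "{xs \<in> lists_below N L. card (set xs) \<le> D} \<subseteq>
      (\<lambda>(g, p). map ((!) g) p) ` (lists_below N D \<times> lists_below D L)"
  proof
    fix xs assume xs: "xs \<in> {xs \<in> lists_below N L. card (set xs) \<le> D}"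
    obtain g0 where g0: "set g0 = set xs" "distinct g0" using finite_distinct_list[of "set xs"] by auto
    then have len: "length g0 \<le> D" using xs distinct_card[of g0] by simp
    define g where "g = g0 @ replicate (D - length g0) 0"
    have g: "g \<in> lists_below N D"
      using xs g0 len assms by (auto simp: g_def lists_below_def)
    have "\<forall>x\<in>set xs. \<exists>i<length g0. g0 ! i = x" using g0(1) by (metis in_set_conv_nth)
    then obtain f where f: "\<And>x. x \<in> set xs \<Longrightarrow> f x < length g0 \<and> g0 ! f x = x" by metis
    have "map ((!) g) (map f xs) = xs"
      using f by (auto simp: g_def nth_append intro!: map_idI)
    moreover have "map f xs \<in> lists_below D L"
      using f len xs by (force simp: lists_below_def)
    ultimately show "xs \<in> (\<lambda>(g, p). map ((!) g) p) ` (lists_below N D \<times> lists_below D L)"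
      using g by (intro image_eqI[of _ _ "(g, map f xs)"]) auto
  qed
  then have "card {xs \<in> lists_below N L. card (set xs) \<le> D} \<le>
      card ((\<lambda>(g, p). map ((!) g) p) ` (lists_below N D \<times> lists_below D L))"
    by (intro card_mono) auto
  also have "\<dots> \<le> card (lists_below N D \<times> lists_below D L)" by (intro card_image_le) auto
  also have "\<dots> = N ^ D * D ^ L"
    by (simp add: card_cartesian_product lists_below_def card_lists_length_eq)
  finally show ?thesis .
qed

section \<open>Walk monomials on the tournament ensemble\<close>

definition sign_entry :: "complex mat \<Rightarrow> nat \<Rightarrow> nat \<Rightarrow> real" where
  "sign_entry H x y = Im (H $$ (x, y))"

definition chi :: "nat list \<Rightarrow> complex mat \<Rightarrow> real" where
  "chi w H = walk_weight (sign_entry H) w"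

definition flip_edge :: "nat \<times> nat \<Rightarrow> complex mat \<Rightarrow> complex mat" where
  "flip_edge E H = flip_sign (fst E) (snd E) H"

text \<open>A finite average instead of an integral keeps linearity and monotonicity free of
  integrability conditions; \<open>expectation_ite\<close> translates back.\<close>

definition mean :: "nat \<Rightarrow> (complex mat \<Rightarrow> real) \<Rightarrow> real" where
  "mean N f = (\<Sum>H\<in>imag_tournaments N. f H) / card (imag_tournaments N)"

lemma card_imag_tournaments_pos: "card (imag_tournaments N) > 0"
  using finite_imag_tournaments imag_tournaments_nonempty by (simp add: card_gt_0_iff)

lemma mean_cong: "(\<And>H. H \<in> imag_tournaments N \<Longrightarrow> f H = g H) \<Longrightarrow> mean N f = mean N g"
  by (simp add: mean_def)

lemma mean_mono: "(\<And>H. H \<in> imag_tournaments N \<Longrightarrow> f H \<le> g H) \<Longrightarrow> mean N f \<le> mean N g"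
  unfolding mean_def by (intro divide_right_mono sum_mono) auto

lemma mean_nonneg: "(\<And>H. H \<in> imag_tournaments N \<Longrightarrow> f H \<ge> 0) \<Longrightarrow> mean N f \<ge> 0"
  unfolding mean_def by (intro divide_nonneg_nonneg sum_nonneg) auto

lemma mean_const: "mean N (\<lambda>H. c) = c"
  using card_imag_tournaments_pos[of N] by (simp add: mean_def)

lemma mean_add: "mean N (\<lambda>H. f H + g H) = mean N f + mean N g"
  by (simp add: mean_def sum.distrib add_divide_distrib)

lemma mean_cmult: "mean N (\<lambda>H. c * f H) = c * mean N f"
  by (simp add: mean_def sum_distrib_left[symmetric])

lemma mean_sum: "mean N (\<lambda>H. \<Sum>x\<in>A. f x H) = (\<Sum>x\<in>A. mean N (f x))"
  unfolding mean_def sum_divide_distrib[symmetric] by (subst sum.swap) (rule refl)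

lemma flip_edge_in: "H \<in> imag_tournaments N \<Longrightarrow> E \<in> upper_pairs N \<Longrightarrow> flip_edge E H \<in> imag_tournaments N"
  using flip_sign_imag_tournaments[of H N "fst E" "snd E"] by (simp add: flip_edge_def)

lemma flip_edge_involution:
  "H \<in> imag_tournaments N \<Longrightarrow> flip_edge E (flip_edge E H) = H"
  by (rule eq_matI) (auto simp: flip_edge_def flip_sign_def)

lemma mean_flip:
  assumes "E \<in> upper_pairs N"
  shows "mean N (\<lambda>H. f (flip_edge E H)) = mean N f"
proof -
  have "(\<Sum>H\<in>imag_tournaments N. f (flip_edge E H)) = (\<Sum>H\<in>imag_tournaments N. f H)"
    by (rule sum.reindex_bij_witness[of _ "flip_edge E" "flip_edge E"])
      (auto simp: flip_edge_in[OF _ assms] flip_edge_involution)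
  then show ?thesis by (simp add: mean_def)
qed

lemma mean_flip_odd:
  assumes "E \<in> upper_pairs N" "\<And>H. H \<in> imag_tournaments N \<Longrightarrow> f (flip_edge E H) = - f H"
  shows "mean N f = 0"
proof -
  have "mean N f = mean N (\<lambda>H. f (flip_edge E H))" using mean_flip[OF assms(1)] by simp
  also have "\<dots> = mean N (\<lambda>H. - 1 * f H)" using assms(2) by (intro mean_cong) simp
  also have "\<dots> = - mean N f" by (subst mean_cmult) simp
  finally show ?thesis by simp
qed

text \<open>This reduces moments to counting. The family \<open>X\<close> is abstract because it is
  instantiated with single monomials and with products of two monomials, the latter for fourth
  moments and for products of gradients.\<close>

lemma second_moment_le:
  assumes fin: "finite W" and c: "\<And>w. w \<in> W \<Longrightarrow> \<bar>c w\<bar> \<le> C"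
    and X: "\<And>w H. w \<in> W \<Longrightarrow> H \<in> imag_tournaments N \<Longrightarrow> \<bar>X w H\<bar> \<le> 1"
  shows "mean N (\<lambda>H. (\<Sum>w\<in>W. c w * X w H)\<^sup>2) \<le>
    C\<^sup>2 * card {p \<in> W \<times> W. mean N (\<lambda>H. X (fst p) H * X (snd p) H) \<noteq> 0}"
proof -
  define m where "m p = mean N (\<lambda>H. X (fst p) H * X (snd p) H)" for p
  define S where "S = {p \<in> W \<times> W. m p \<noteq> 0}"
  have "mean N (\<lambda>H. (\<Sum>w\<in>W. c w * X w H)\<^sup>2) =
      mean N (\<lambda>H. \<Sum>p\<in>W \<times> W. (c (fst p) * c (snd p)) * (X (fst p) H * X (snd p) H))"
    by (intro mean_cong) (simp add: power2_eq_square sum_product sum.cartesian_product case_prod_beta mult_ac)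
  also have "\<dots> = (\<Sum>p\<in>W \<times> W. (c (fst p) * c (snd p)) * m p)"
    by (simp only: mean_sum mean_cmult m_def)
  also have "\<dots> = (\<Sum>p\<in>S. (c (fst p) * c (snd p)) * m p)"
    using fin by (intro sum.mono_neutral_right) (auto simp: S_def)
  also have "\<dots> \<le> (\<Sum>p\<in>S. C\<^sup>2)"
  proof (rule sum_mono)
    fix p assume p: "p \<in> S"
    then have w: "fst p \<in> W" "snd p \<in> W" by (auto simp: S_def)
    have "\<bar>c (fst p) * c (snd p)\<bar> \<le> C * C"
      unfolding abs_mult using c[OF w(1)] c[OF w(2)] by (intro mult_mono) auto
    moreover have "\<bar>m p\<bar> \<le> 1"
    proof -
      have b: "\<bar>X (fst p) H * X (snd p) H\<bar> \<le> 1" if "H \<in> imag_tournaments N" for H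
        unfolding abs_mult using X[OF w(1) that] X[OF w(2) that] by (simp add: mult_le_one)
      have "m p \<le> mean N (\<lambda>H. 1)" unfolding m_def using b by (intro mean_mono) force
      moreover have "mean N (\<lambda>H. - 1) \<le> m p" unfolding m_def using b by (intro mean_mono) force
      ultimately show ?thesis by (simp add: mean_const)
    qed
    ultimately have "\<bar>c (fst p) * c (snd p) * m p\<bar> \<le> C * C * 1"
      unfolding abs_mult[of "_ * _" "m p"] by (intro mult_mono) auto
    then show "c (fst p) * c (snd p) * m p \<le> C\<^sup>2" by (simp add: power2_eq_square)
  qed
  also have "\<dots> = C\<^sup>2 * card S" by simp
  finally show ?thesis unfolding S_def m_def .
qed

lemma sign_entry_abs: "H \<in> imag_tournaments N \<Longrightarrow> x < N \<Longrightarrow> y < N \<Longrightarrow> x \<noteq> y \<Longrightarrow> \<bar>sign_entry H x y\<bar> = 1"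
  using imag_tournamentsD(5)[of H N x y] by (auto simp: sign_entry_def)

lemma sign_entry_antisym: "H \<in> imag_tournaments N \<Longrightarrow> x < N \<Longrightarrow> y < N \<Longrightarrow> x \<noteq> y \<Longrightarrow> sign_entry H y x = - sign_entry H x y"
  using imag_tournamentsD(4)[of H N x y] by (simp add: sign_entry_def)

lemma entry_eq_sign_entry: "H \<in> imag_tournaments N \<Longrightarrow> x < N \<Longrightarrow> y < N \<Longrightarrow> H $$ (x, y) = \<i> * of_real (sign_entry H x y)"
  using imag_tournamentsD(5)[of H N x y] imag_tournamentsD(3)[of H N x]
  by (cases "x = y") (auto simp: sign_entry_def)

lemma sign_entry_flip:
  assumes H: "H \<in> imag_tournaments N" and E: "E \<in> upper_pairs N" and xy: "x < N" "y < N"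
  shows "sign_entry (flip_edge E H) x y = (if mk_edge x y = E then - 1 else 1) * sign_entry H x y"
proof -
  have E': "fst E < snd E" using E by (auto simp: upper_pairs_def)
  have "flip_edge E H $$ (x, y) = (if (x, y) = (fst E, snd E) \<or> (x, y) = (snd E, fst E) then - H $$ (x, y) else H $$ (x, y))"
    using xy imag_tournamentsD(1,2)[OF H] by (simp add: flip_edge_def flip_sign_def)
  moreover have "(x, y) = (fst E, snd E) \<or> (x, y) = (snd E, fst E) \<longleftrightarrow> mk_edge x y = E"
    using E' by (cases E) (auto simp: mk_edge_def min_def max_def)
  ultimately show ?thesis by (simp add: sign_entry_def)
qed

lemma cyc_walks_step:
  assumes "w \<in> cyc_walks N r" "i < r"
  shows "w ! i < N" "w ! ((i + 1) mod r) < N" "w ! i \<noteq> w ! ((i + 1) mod r)" "edge_at w i \<in> upper_pairs N"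
proof -
  show 1: "w ! i < N" "w ! ((i + 1) mod r) < N"
    using assms cyc_walks_nth_less[OF assms(1)] by (auto intro!: mod_less_divisor)
  show 2: "w ! i \<noteq> w ! ((i + 1) mod r)" using assms by (simp add: cyc_walks_def)
  show "edge_at w i \<in> upper_pairs N"
    using 1 2 cyc_walks_length[OF assms(1)] by (auto simp: edge_at_def mk_edge_def upper_pairs_def min_def max_def)
qed

lemma edge_mult_pos_upper: "w \<in> cyc_walks N r \<Longrightarrow> edge_mult w E > 0 \<Longrightarrow> E \<in> upper_pairs N"
  using cyc_walks_step(4) cyc_walks_length by (fastforce simp: edge_mult_def card_gt_0_iff)

lemma odd_edges_upper: "w \<in> cyc_walks N r \<Longrightarrow> odd_edges w \<subseteq> upper_pairs N"
  using edge_mult_pos_upper by (auto simp: odd_edges_def odd_pos)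

lemma odd_edges_subset_image: "odd_edges w \<subseteq> edge_at w ` {..<length w}"
proof
  fix E assume "E \<in> odd_edges w"
  then have "edge_mult w E > 0" by (auto simp: odd_edges_def odd_pos)
  then show "E \<in> edge_at w ` {..<length w}" by (auto simp: edge_mult_def card_gt_0_iff)
qed

lemma finite_odd_edges [simp]: "finite (odd_edges w)"
  using odd_edges_subset_image by (rule finite_subset) simp

lemma card_odd_edges_le: "card (odd_edges w) \<le> length w"
  using surj_card_le[OF _ odd_edges_subset_image] by simp

lemma chi_abs:
  assumes w: "w \<in> cyc_walks N r" and H: "H \<in> imag_tournaments N"
  shows "\<bar>chi w H\<bar> = 1"
proof -
  have "\<bar>sign_entry H (w ! i) (w ! ((i + 1) mod length w))\<bar> = 1" if "i < length w" for i
    using that cyc_walks_step(1-3)[OF w, of i] cyc_walks_length[OF w] by (intro sign_entry_abs[OF H]) auto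
  then show ?thesis unfolding chi_def walk_weight_def abs_prod by (intro prod.neutral) auto
qed

lemma chi_flip:
  assumes H: "H \<in> imag_tournaments N" and E: "E \<in> upper_pairs N" and w: "w \<in> cyc_walks N r"
  shows "chi w (flip_edge E H) = (-1) ^ edge_mult w E * chi w H"
proof -
  have "chi w (flip_edge E H) = (\<Prod>i<length w. (if edge_at w i = E then - 1 else 1) * sign_entry H (w ! i) (w ! ((i + 1) mod length w)))"
    unfolding chi_def walk_weight_def
    by (intro prod.cong refl)
      (use cyc_walks_step[OF w] cyc_walks_length[OF w] in \<open>simp add: sign_entry_flip[OF H E] edge_at_def\<close>)
  also have "\<dots> = (\<Prod>i<length w. if edge_at w i = E then - 1 else 1) * chi w H"
    by (simp add: prod.distrib chi_def walk_weight_def)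
  also have "(\<Prod>i<length w. if edge_at w i = E then - 1 else (1::real)) = (-1) ^ edge_mult w E"
    by (simp add: prod.If_cases edge_mult_def Int_def)
  finally show ?thesis .
qed

lemma chi_flip_diff:
  assumes H: "H \<in> imag_tournaments N" and E: "E \<in> upper_pairs N" and w: "w \<in> cyc_walks N r"
  shows "chi w (flip_edge E H) - chi w H = (if E \<in> odd_edges w then - 2 * chi w H else 0)"
  using chi_flip[OF assms] by (simp add: odd_edges_def)

text \<open>The product of the signs of two tournaments is symmetric in the end points, so it is a
  function \<rho> of the unoriented edge with values of modulus 1. The product of both monomials is
  a product of even powers of \<rho>.\<close>

lemma chi_const:
  assumes w: "w \<in> cyc_walks N r" and ev: "odd_edges w = {}"
    and H: "H \<in> imag_tournaments N" and H': "H' \<in> imag_tournaments N"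
  shows "chi w H = chi w H'"
proof -
  define \<rho> where "\<rho> E = sign_entry H (fst E) (snd E) * sign_entry H' (fst E) (snd E)" for E
  have \<rho>: "sign_entry H x y * sign_entry H' x y = \<rho> (mk_edge x y)" if "x < N" "y < N" "x \<noteq> y" for x y
    using sign_entry_antisym[OF H that] sign_entry_antisym[OF H' that] by (auto simp: \<rho>_def mk_edge_def min_def max_def)
  have "chi w H * chi w H' = (\<Prod>i<length w. \<rho> (edge_at w i))"
    unfolding chi_def walk_weight_def prod.distrib[symmetric]
    by (intro prod.cong refl)
      (use cyc_walks_step[OF w] cyc_walks_length[OF w] in \<open>simp add: \<rho> edge_at_def\<close>)
  also have "\<dots> = (\<Prod>E\<in>edge_at w ` {..<length w}. \<Prod>i\<in>{i \<in> {..<length w}. edge_at w i = E}. \<rho> (edge_at w i))"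
    by (rule prod.image_gen) simp
  also have "\<dots> = (\<Prod>E\<in>edge_at w ` {..<length w}. \<rho> E ^ edge_mult w E)"
    by (intro prod.cong refl) (simp add: edge_mult_def)
  also have "\<dots> = 1"
  proof (intro prod.neutral ballI)
    fix E assume "E \<in> edge_at w ` {..<length w}"
    then have "E \<in> upper_pairs N" using cyc_walks_step(4)[OF w] cyc_walks_length[OF w] by auto
    then have "fst E < N" "snd E < N" "fst E \<noteq> snd E" by (auto simp: upper_pairs_def)
    then have "\<bar>\<rho> E\<bar> = 1" using sign_entry_abs[OF H] sign_entry_abs[OF H'] by (simp add: \<rho>_def abs_mult)
    moreover have "even (edge_mult w E)" using ev unfolding odd_edges_def by blast
    ultimately show "\<rho> E ^ edge_mult w E = 1" by (metis power_even_abs power_one)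
  qed
  finally have "chi w H * chi w H' = 1" .
  then show ?thesis using chi_abs[OF w H] chi_abs[OF w H'] by (auto simp: abs_if split: if_splits)
qed

lemma mean_chi_prod:
  assumes ws: "\<forall>w\<in>set ws. w \<in> cyc_walks N (length w)"
    and odd: "odd (sum_list (map (\<lambda>w. edge_mult w E) ws))"
  shows "mean N (\<lambda>H. prod_list (map (\<lambda>w. chi w H) ws)) = 0"
proof (rule mean_flip_odd)
  have "sum_list (map (\<lambda>w. edge_mult w E) ws) \<noteq> 0" using odd by (metis even_zero)
  then obtain w where "w \<in> set ws" "edge_mult w E \<noteq> 0" by (auto simp: sum_list_eq_0_iff)
  then show E: "E \<in> upper_pairs N" using ws edge_mult_pos_upper by blast
  fix H assume H: "H \<in> imag_tournaments N"
  have "prod_list (map (\<lambda>w. chi w (flip_edge E H)) ws) =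
      (-1) ^ sum_list (map (\<lambda>w. edge_mult w E) ws) * prod_list (map (\<lambda>w. chi w H) ws)"
    using ws
  proof (induction ws)
    case (Cons w ws)
    then show ?case using chi_flip[OF H E, of w "length w"] by (simp add: power_add mult_ac)
  qed simp
  then show "prod_list (map (\<lambda>w. chi w (flip_edge E H)) ws) = - prod_list (map (\<lambda>w. chi w H) ws)"
    using odd by simp
qed

section \<open>Counting pairs and quadruples of walks\<close>

lemma count_tuples:
  assumes "N \<ge> 1" "inj_on f Q" "\<And>q. q \<in> Q \<Longrightarrow> f q \<in> lists_below N L \<and> card (set (f q)) \<le> D"
  shows "card Q \<le> N ^ D * D ^ L"
proof -
  have "card Q = card (f ` Q)" using assms(2) by (simp add: card_image)
  also have "\<dots> \<le> card {xs \<in> lists_below N L. card (set xs) \<le> D}"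
    using assms(3) by (intro card_mono) auto
  also have "\<dots> \<le> N ^ D * D ^ L" by (rule card_few_distinct[OF assms(1)])
  finally show ?thesis .
qed

lemma cyc_walks_lists: "w \<in> cyc_walks N r \<Longrightarrow> w \<in> lists_below N r"
  by (simp add: cyc_walks_def)

lemma append_lists_below: "u \<in> lists_below N r \<Longrightarrow> v \<in> lists_below N s \<Longrightarrow> u @ v \<in> lists_below N (r + s)"
  by (auto simp: lists_below_def)

lemma count_pairs:
  assumes "N \<ge> 1" "Q \<subseteq> cyc_walks N r \<times> cyc_walks N s"
    and D: "\<And>u v. (u, v) \<in> Q \<Longrightarrow> card (set (concat [u, v])) \<le> D"
  shows "card Q \<le> N ^ D * D ^ (r + s)"
proof (rule count_tuples[OF assms(1), where f = "\<lambda>(u, v). u @ v"])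
  show "inj_on (\<lambda>(u, v). u @ v) Q"
  proof (rule inj_onI)
    fix p p' assume p: "p \<in> Q" "p' \<in> Q" and eq: "(case p of (u, v) \<Rightarrow> u @ v) = (case p' of (u, v) \<Rightarrow> u @ v)"
    have "fst p \<in> cyc_walks N r" "fst p' \<in> cyc_walks N r" using p assms(2) by auto
    then have "length (fst p) = length (fst p')" using cyc_walks_length by metis
    then show "p = p'" using eq by (simp add: case_prod_beta prod_eq_iff)
  qed
  fix q assume q: "q \<in> Q"
  obtain u v where uv: "q = (u, v)" by (cases q)
  then have "u @ v \<in> lists_below N (r + s)"
    using q assms(2) by (intro append_lists_below cyc_walks_lists) auto
  then show "(case q of (u, v) \<Rightarrow> u @ v) \<in> lists_below N (r + s) \<and> card (set (case q of (u, v) \<Rightarrow> u @ v)) \<le> D"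
    using D[OF q[unfolded uv]] by (simp add: uv)
qed

lemma count_quads:
  assumes "N \<ge> 1" "Q \<subseteq> (cyc_walks N r \<times> cyc_walks N s) \<times> (cyc_walks N r \<times> cyc_walks N s)"
    and D: "\<And>u v u' v'. ((u, v), (u', v')) \<in> Q \<Longrightarrow> card (set (concat [u, v, u', v'])) \<le> D"
  shows "card Q \<le> N ^ D * D ^ (2 * (r + s))"
proof -
  define f :: "(nat list \<times> nat list) \<times> (nat list \<times> nat list) \<Rightarrow> nat list"
    where "f q = (fst (fst q) @ snd (fst q)) @ (fst (snd q) @ snd (snd q))" for q
  show ?thesis
  proof (rule count_tuples[OF assms(1), where f = f])
    show "inj_on f Q"
    proof (rule inj_onI)
      fix p p' assume p: "p \<in> Q" "p' \<in> Q" and eq: "f p = f p'"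
      obtain a b c d where abcd: "p = ((a, b), (c, d))" by (metis surj_pair)
      obtain a' b' c' d' where abcd': "p' = ((a', b'), (c', d'))" by (metis surj_pair)
      have "a \<in> cyc_walks N r" "b \<in> cyc_walks N s" "c \<in> cyc_walks N r"
        "a' \<in> cyc_walks N r" "b' \<in> cyc_walks N s" "c' \<in> cyc_walks N r"
        using p assms(2) unfolding abcd abcd' by auto
      then have len: "length a = length a'" "length b = length b'" "length c = length c'"
        using cyc_walks_length by metis+
      then show "p = p'" using eq by (simp add: f_def abcd abcd')
    qed
    fix q assume q: "q \<in> Q"
    obtain a b c d where abcd: "q = ((a, b), (c, d))" by (metis surj_pair)
    have "(a @ b) @ (c @ d) \<in> lists_below N ((r + s) + (r + s))"
      using q assms(2) unfolding abcd by (intro append_lists_below cyc_walks_lists) auto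
    moreover have "(r + s) + (r + s) = 2 * (r + s)" by simp
    moreover have fq: "f q = (a @ b) @ (c @ d)" by (simp add: f_def abcd)
    ultimately have "f q \<in> lists_below N (2 * (r + s))" by (simp only:)
    then show "f q \<in> lists_below N (2 * (r + s)) \<and> card (set (f q)) \<le> D"
      using D[OF q[unfolded abcd]] unfolding fq by (simp add: Un_assoc)
  qed
qed

definition simple_edge_walks :: "nat \<Rightarrow> nat \<Rightarrow> nat list set" where
  "simple_edge_walks N r = {w \<in> cyc_walks N r. \<forall>E. edge_mult w E \<le> 1}"

definition repeating_walks :: "nat \<Rightarrow> nat \<Rightarrow> nat list set" where
  "repeating_walks N r = {w \<in> cyc_walks N r. \<exists>E. edge_mult w E \<ge> 2}"

lemma cyc_walks_split: "cyc_walks N r = simple_edge_walks N r \<union> repeating_walks N r"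
  "simple_edge_walks N r \<inter> repeating_walks N r = {}"
proof -
  have "(\<forall>E. edge_mult w E \<le> 1) \<longleftrightarrow> \<not> (\<exists>E. edge_mult w E \<ge> 2)" for w
    by (metis not_less_eq_eq numeral_2_eq_2 One_nat_def)
  then show "cyc_walks N r = simple_edge_walks N r \<union> repeating_walks N r"
    "simple_edge_walks N r \<inter> repeating_walks N r = {}"
    by (auto simp: simple_edge_walks_def repeating_walks_def)
qed

lemma odd_edges_eq_iff: "odd_edges w = odd_edges w' \<longleftrightarrow> (\<forall>E. even (edge_mult w E + edge_mult w' E))"
  by (auto simp: odd_edges_def)

text \<open>Together the two walks have 4n steps and use every edge evenly, so each vertex is
  visited twice and there are at most 2n vertices. After normalisation this is a bound of order
  1.\<close>

lemma card_same_odd: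
  assumes N: "N \<ge> 1" and Q: "Q \<subseteq> {p \<in> cyc_walks N (2 * n) \<times> cyc_walks N (2 * n). odd_edges (fst p) = odd_edges (snd p)}"
  shows "card Q \<le> N ^ (2 * n) * (2 * n) ^ (4 * n)"
proof -
  have "card Q \<le> N ^ (2 * n) * (2 * n) ^ (2 * n + 2 * n)"
  proof (rule count_pairs[OF N])
    show "Q \<subseteq> cyc_walks N (2 * n) \<times> cyc_walks N (2 * n)" using Q by auto
    fix u v assume "(u, v) \<in> Q"
    then have uv: "u \<in> cyc_walks N (2 * n)" "v \<in> cyc_walks N (2 * n)" "odd_edges u = odd_edges v" using Q by auto
    then have "2 * card (set (concat [u, v])) \<le> length (concat [u, v])"
      by (intro even_walks_card) (auto simp: odd_edges_eq_iff cyc_walks_length)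
    then show "card (set (concat [u, v])) \<le> 2 * n" using uv by (simp add: cyc_walks_length)
  qed
  then show ?thesis by (simp add: mult_2[symmetric])
qed

text \<open>Each walk on its own is a connected family with a repeated edge, and both have the same
  nonempty set of odd edges; this is where two vertices are gained.\<close>

lemma card_same_odd_repeating:
  assumes N: "N \<ge> 1" and Q: "Q \<subseteq> {p \<in> repeating_walks N (2 * n) \<times> repeating_walks N (2 * n).
      odd_edges (fst p) = odd_edges (snd p) \<and> odd_edges (fst p) \<noteq> {}}"
  shows "card Q \<le> N ^ (2 * n - 2) * (2 * n - 2) ^ (4 * n)"
proof -
  have "card Q \<le> N ^ (2 * n - 2) * (2 * n - 2) ^ (2 * n + 2 * n)"
  proof (rule count_pairs[OF N])
    show "Q \<subseteq> cyc_walks N (2 * n) \<times> cyc_walks N (2 * n)" using Q by (auto simp: repeating_walks_def)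
    fix u v assume "(u, v) \<in> Q"
    then have uv: "u \<in> repeating_walks N (2 * n)" "v \<in> repeating_walks N (2 * n)"
      "odd_edges u = odd_edges v" "odd_edges u \<noteq> {}" using Q by auto
    have cr: "connected_repeating N [w]" if "w \<in> repeating_walks N (2 * n)" for w
      using that by (auto simp: connected_repeating_def repeating_walks_def cyc_walks_length)
    obtain E where "odd (edge_mult u E)" using uv(4) unfolding odd_edges_def by blast
    moreover have "odd (edge_mult u E) \<longleftrightarrow> odd (edge_mult v E)" for E using uv(3) unfolding odd_edges_def by blast
    ultimately have "2 * card (set (concat ([u] @ [v]))) + 4 \<le> length (concat ([u] @ [v]))"
      by (intro connected_repeating_pair_card[where N = N and ?E1.0 = E] cr uv) auto
    then show "card (set (concat [u, v])) \<le> 2 * n - 2"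
      using uv(1,2) cyc_walks_length[of u N "2 * n"] cyc_walks_length[of v N "2 * n"]
      by (simp add: repeating_walks_def)
  qed
  then show ?thesis by (simp add: mult_2[symmetric])
qed

text \<open>The quadruple splits into two pairs, each connected through a common edge. Evenness of
  the total gives both pairs the same odd edges, and there is at least one because
  \<open>odd_edges u\<close> and \<open>odd_edges v\<close> differ.\<close>

lemma card_quads_offdiag:
  assumes N: "N \<ge> 1" and Q: "Q \<subseteq> {((u, v), (u', v')).
      u \<in> simple_edge_walks N (2 * n) \<and> v \<in> simple_edge_walks N (2 * m) \<and>
      u' \<in> simple_edge_walks N (2 * n) \<and> v' \<in> simple_edge_walks N (2 * m) \<and>
      odd_edges u \<inter> odd_edges v \<noteq> {} \<and> odd_edges u' \<inter> odd_edges v' \<noteq> {} \<and> odd_edges u \<noteq> odd_edges v \<and>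
      (\<forall>E. even (edge_mult u E + edge_mult v E + edge_mult u' E + edge_mult v' E))}"
  shows "card Q \<le> N ^ (2 * n + 2 * m - 2) * (2 * n + 2 * m - 2) ^ (2 * (2 * n + 2 * m))"
proof (rule count_quads[OF N])
  show "Q \<subseteq> (cyc_walks N (2 * n) \<times> cyc_walks N (2 * m)) \<times> (cyc_walks N (2 * n) \<times> cyc_walks N (2 * m))"
    using Q by (auto simp: simple_edge_walks_def)
  fix u v u' v' assume q: "((u, v), (u', v')) \<in> Q"
  have mem: "u \<in> simple_edge_walks N (2 * n) \<and> v \<in> simple_edge_walks N (2 * m) \<and>
      u' \<in> simple_edge_walks N (2 * n) \<and> v' \<in> simple_edge_walks N (2 * m) \<and>
      odd_edges u \<inter> odd_edges v \<noteq> {} \<and> odd_edges u' \<inter> odd_edges v' \<noteq> {} \<and> odd_edges u \<noteq> odd_edges v \<and>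
      (\<forall>E. even (edge_mult u E + edge_mult v E + edge_mult u' E + edge_mult v' E))"
    using subsetD[OF Q q] unfolding mem_Collect_eq prod.case .
  then have s: "u \<in> cyc_walks N (2 * n)" "v \<in> cyc_walks N (2 * m)" "u' \<in> cyc_walks N (2 * n)" "v' \<in> cyc_walks N (2 * m)"
    and sh: "odd_edges u \<inter> odd_edges v \<noteq> {}" "odd_edges u' \<inter> odd_edges v' \<noteq> {}" and ne: "odd_edges u \<noteq> odd_edges v"
    and ev: "\<And>E. even (edge_mult u E + edge_mult v E + edge_mult u' E + edge_mult v' E)"
    unfolding simple_edge_walks_def by blast+
  have cr: "connected_repeating N [a, b]"
    if ab: "a \<in> cyc_walks N (2 * n)" "b \<in> cyc_walks N (2 * m)" "odd_edges a \<inter> odd_edges b \<noteq> {}" for a b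
  proof -
    obtain E where E: "odd (edge_mult a E)" "odd (edge_mult b E)" using ab(3) unfolding odd_edges_def by blast
    then have "edge_mult a E \<ge> 1" "edge_mult b E \<ge> 1" by (auto simp: odd_pos Suc_leI)
    then show ?thesis using ab(1,2)
      unfolding connected_repeating_def by (intro conjI exI[of _ E]) (auto simp: cyc_walks_length)
  qed
  obtain E where "odd (edge_mult u E + edge_mult v E)" using ne unfolding odd_edges_eq_iff by blast
  moreover have "odd (edge_mult u E + edge_mult v E) \<longleftrightarrow> odd (edge_mult u' E + edge_mult v' E)" for E using ev[of E] by auto
  ultimately have "2 * card (set (concat ([u, v] @ [u', v']))) + 4 \<le> length (concat ([u, v] @ [u', v']))"
    by (intro connected_repeating_pair_card[where N = N and ?E1.0 = E] cr s sh) auto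
  then show "card (set (concat [u, v, u', v'])) \<le> 2 * n + 2 * m - 2"
    using s by (simp add: cyc_walks_length)
qed

lemma odd_edge_ends:
  assumes "E \<in> odd_edges w"
  shows "fst E \<in> set w" "snd E \<in> set w"
proof -
  obtain i where i: "i < length w" "E = edge_at w i" using assms odd_edges_subset_image by blast
  moreover have "(i + 1) mod length w < length w" using i by (intro mod_less_divisor) auto
  ultimately show "fst E \<in> set w" "snd E \<in> set w"
    by (auto simp: edge_at_def mk_edge_def min_def max_def)
qed

text \<open>All four walks pass through both ends of the common edge, so these two vertices are
  visited at least four times.\<close>

lemma card_quads_common:
  assumes N: "N \<ge> 1" and n: "n \<ge> 1" and Q: "Q \<subseteq> {((u, v), (u', v')).
      u \<in> cyc_walks N (2 * n) \<and> v \<in> cyc_walks N (2 * n) \<and> u' \<in> cyc_walks N (2 * n) \<and> v' \<in> cyc_walks N (2 * n) \<and>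
      odd_edges u \<inter> odd_edges v \<inter> odd_edges u' \<inter> odd_edges v' \<noteq> {} \<and>
      (\<forall>E. even (edge_mult u E + edge_mult v E + edge_mult u' E + edge_mult v' E))}"
  shows "card Q \<le> N ^ (4 * n - 2) * (4 * n - 2) ^ (8 * n)"
proof -
  have "card Q \<le> N ^ (4 * n - 2) * (4 * n - 2) ^ (2 * (2 * n + 2 * n))"
  proof (rule count_quads[OF N])
    show "Q \<subseteq> (cyc_walks N (2 * n) \<times> cyc_walks N (2 * n)) \<times> (cyc_walks N (2 * n) \<times> cyc_walks N (2 * n))"
      using Q by auto
    fix u v u' v' assume q: "((u, v), (u', v')) \<in> Q"
    let ?ws = "[u, v, u', v']"
    have mem: "u \<in> cyc_walks N (2 * n) \<and> v \<in> cyc_walks N (2 * n) \<and> u' \<in> cyc_walks N (2 * n) \<and> v' \<in> cyc_walks N (2 * n) \<and>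
        odd_edges u \<inter> odd_edges v \<inter> odd_edges u' \<inter> odd_edges v' \<noteq> {} \<and>
        (\<forall>E. even (edge_mult u E + edge_mult v E + edge_mult u' E + edge_mult v' E))"
      using subsetD[OF Q q] unfolding mem_Collect_eq prod.case .
    have s: "\<forall>w\<in>set ?ws. w \<in> cyc_walks N (2 * n)" using mem by simp
    have "odd_edges u \<inter> odd_edges v \<inter> odd_edges u' \<inter> odd_edges v' \<noteq> {}" using mem by blast
    then obtain E where "E \<in> odd_edges u" "E \<in> odd_edges v" "E \<in> odd_edges u'" "E \<in> odd_edges v'" by blast
    then have E: "\<forall>w\<in>set ?ws. E \<in> odd_edges w" by simp
    have "E \<in> upper_pairs N" using E odd_edges_upper[of u N "2 * n"] s by auto
    then have "fst E \<noteq> snd E" by (auto simp: upper_pairs_def)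
    moreover have "fst E \<in> set w" "snd E \<in> set w" if "w \<in> set ?ws" for w
      using odd_edge_ends E that by blast+
    moreover have "even (sum_list (map (\<lambda>w. edge_mult w E) ?ws))" for E
    proof -
      have "sum_list (map (\<lambda>w. edge_mult w E) ?ws) = edge_mult u E + edge_mult v E + edge_mult u' E + edge_mult v' E" by simp
      then show ?thesis using mem by presburger
    qed
    ultimately have "2 * card (set (concat ?ws)) + 4 \<le> length (concat ?ws)"
      using s by (intro even_walks_card_common_edge[of ?ws N "fst E" "snd E"]) (auto simp: cyc_walks_length)
    moreover have "length u = 2 * n" "length v = 2 * n" "length u' = 2 * n" "length v' = 2 * n"
      using s cyc_walks_length by auto
    ultimately show "card (set (concat ?ws)) \<le> 4 * n - 2" by simp
  qed
  then show ?thesis by (simp add: algebra_simps)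
qed

section \<open>Rotations and reflections of a cycle\<close>

text \<open>Integer indices, read modulo the length, make rotations and reflections of a cycle uniform.\<close>

definition cyc_nth :: "nat list \<Rightarrow> int \<Rightarrow> nat" where
  "cyc_nth w k = w ! nat (k mod int (length w))"

lemma cyc_nth_nat: "i < length w \<Longrightarrow> cyc_nth w (int i) = w ! i"
  by (simp add: cyc_nth_def)

lemma nth_mod_eq_cyc_nth: "w \<noteq> [] \<Longrightarrow> w ! (i mod length w) = cyc_nth w (int i)"
  by (simp add: cyc_nth_def zmod_int[symmetric])

lemma edge_at_cyc_nth: "i < length w \<Longrightarrow> edge_at w i = mk_edge (cyc_nth w (int i)) (cyc_nth w (int i + 1))"
  using nth_mod_eq_cyc_nth[of w "i + 1"] by (cases "w = []") (auto simp: edge_at_def cyc_nth_nat add.commute)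

lemma cyc_nth_in: "w \<noteq> [] \<Longrightarrow> cyc_nth w k \<in> set w"
  by (auto simp: cyc_nth_def nat_less_iff intro!: nth_mem)

lemma cyc_nth_eq_iff:
  assumes "distinct w" "w \<noteq> []"
  shows "cyc_nth w a = cyc_nth w b \<longleftrightarrow> int (length w) dvd a - b"
proof -
  have l: "nat (k mod int (length w)) < length w" for k using assms by (simp add: nat_less_iff)
  have "cyc_nth w a = cyc_nth w b \<longleftrightarrow> nat (a mod int (length w)) = nat (b mod int (length w))"
    unfolding cyc_nth_def using l assms by (simp add: nth_eq_iff_index_eq)
  also have "\<dots> \<longleftrightarrow> a mod int (length w) = b mod int (length w)"
    using assms by (simp add: eq_nat_nat_iff)
  finally show ?thesis by (simp add: mod_eq_dvd_iff)
qed

lemma cyc_walks_cyc_nth: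
  assumes "w \<in> cyc_walks N r" "r > 0"
  shows "cyc_nth w (int i) \<noteq> cyc_nth w (int i + 2)"
proof -
  have len: "length w = r" using assms(1) by (rule cyc_walks_length)
  have ne: "w \<noteq> []" using assms(2) len by auto
  define j where "j = i mod r"
  have "j < r" using assms(2) by (simp add: j_def)
  then have "w ! j \<noteq> w ! ((j + 2) mod r)" using assms by (simp add: cyc_walks_def)
  moreover have "w ! j = cyc_nth w (int i)" using nth_mod_eq_cyc_nth[OF ne, of i] len by (simp add: j_def)
  moreover have "w ! ((j + 2) mod r) = cyc_nth w (int i + 2)"
  proof -
    have "(j + 2) mod r = (i + 2) mod r" by (simp add: j_def mod_simps)
    then show ?thesis using nth_mod_eq_cyc_nth[OF ne, of "i + 2"] len by (simp add: add.commute)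
  qed
  ultimately show ?thesis by simp
qed

lemma simple_odd_edges:
  assumes "w \<in> simple_edge_walks N r"
  shows "odd_edges w = edge_at w ` {..<r}" "inj_on (edge_at w) {..<r}" "card (odd_edges w) = r"
proof -
  have len: "length w = r" and le: "\<And>E. edge_mult w E \<le> 1"
    using assms by (auto simp: simple_edge_walks_def cyc_walks_length)
  have fin: "finite {i. i < length w \<and> edge_at w i = E}" for E by simp
  show 1: "odd_edges w = edge_at w ` {..<r}"
  proof
    show "odd_edges w \<subseteq> edge_at w ` {..<r}" using odd_edges_subset_image len by auto
    show "edge_at w ` {..<r} \<subseteq> odd_edges w"
    proof
      fix E assume "E \<in> edge_at w ` {..<r}"
      then have "edge_mult w E > 0" using len by (auto simp: edge_mult_def card_gt_0_iff)
      then have "edge_mult w E = 1" using le[of E] by simp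
      then show "E \<in> odd_edges w" by (simp add: odd_edges_def)
    qed
  qed
  show 2: "inj_on (edge_at w) {..<r}"
  proof (rule inj_onI)
    fix i j assume ij: "i \<in> {..<r}" "j \<in> {..<r}" "edge_at w i = edge_at w j"
    then have "{i, j} \<subseteq> {k. k < length w \<and> edge_at w k = edge_at w j}" using len by auto
    then have "card {i, j} \<le> 1" using le[of "edge_at w j"] card_mono[OF fin] unfolding edge_mult_def by (meson le_trans)
    then show "i = j" by (cases "i = j") auto
  qed
  show "card (odd_edges w) = r" unfolding 1 using card_image[OF 2] by simp
qed

text \<open>Two equal edges at different positions would have to be traversed in opposite
  directions. Then the positions differ by 1 and by -1 modulo \<open>r\<close>, so \<open>r\<close>
  would divide 2.\<close>

lemma distinct_simple_edge_walks:
  assumes w: "w \<in> lists_below N r" "distinct w" and r: "r \<ge> 3"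
  shows "w \<in> simple_edge_walks N r"
proof -
  have len: "length w = r" using w by (simp add: lists_below_def)
  have ne: "w \<noteq> []" using len r by auto
  have shift: "(i + d) mod r \<noteq> i" if "i < r" "d = 1 \<or> d = 2" for i d :: nat
  proof
    assume "(i + d) mod r = i"
    then have "(i + d) mod r = i mod r" using that by simp
    then have "r dvd (i + d) - i" using mod_eq_dvd_iff_nat[of i "i + d" r] by simp
    then show False using that r by (auto dest: dvd_imp_le)
  qed
  have "w ! i \<noteq> w ! ((i + d) mod r)" if "i < r" "d = 1 \<or> d = 2" for i d
  proof -
    have "(i + d) mod r < r" using r by simp
    then show ?thesis using shift[OF that] nth_eq_iff_index_eq[OF w(2), of i "(i + d) mod r"] that(1) len by simp
  qed
  then have cw: "w \<in> cyc_walks N r" using w(1) unfolding cyc_walks_def by blast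
  have "inj_on (edge_at w) {..<r}"
  proof (rule inj_onI)
    fix i j assume ij: "i \<in> {..<r}" "j \<in> {..<r}" and eq: "edge_at w i = edge_at w j"
    have "int r dvd int i - int j \<or> (int r dvd int i - (int j + 1) \<and> int r dvd int i + 1 - int j)"
      using eq ij len unfolding edge_at_cyc_nth[of i w, unfolded len, OF ij(1)[unfolded lessThan_iff]]
        edge_at_cyc_nth[of j w, unfolded len, OF ij(2)[unfolded lessThan_iff]] mk_edge_eq_iff
      by (simp add: cyc_nth_eq_iff[OF w(2) ne] len)
    moreover have "\<not> (int r dvd int i - (int j + 1) \<and> int r dvd int i + 1 - int j)"
    proof
      assume "int r dvd int i - (int j + 1) \<and> int r dvd int i + 1 - int j"
      then have "int r dvd (int i + 1 - int j) - (int i - (int j + 1))" using dvd_diff by blast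
      then have "int r dvd 2" by simp
      then show False using r zdvd_imp_le[of "int r" 2] by simp
    qed
    ultimately have "int r dvd int i - int j" by blast
    then have "int i mod int r = int j mod int r" by (simp add: mod_eq_dvd_iff)
    then show "i = j" using ij by (simp flip: zmod_int)
  qed
  have "edge_mult w E \<le> 1" for E
  proof -
    have "i = j" if "i \<in> {i. i < length w \<and> edge_at w i = E}" "j \<in> {i. i < length w \<and> edge_at w i = E}" for i j
      using that \<open>inj_on (edge_at w) {..<r}\<close> len by (auto simp: inj_on_def)
    then have "card {i. i < length w \<and> edge_at w i = E} \<le> Suc 0"
      by (subst card_le_Suc0_iff_eq) auto
    then show ?thesis by (simp add: edge_mult_def)
  qed
  then show ?thesis using cw by (simp add: simple_edge_walks_def)
qed

text \<open>The pair consists of the starting position and of the direction, 1 for a rotation and -1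
  for a reflection.\<close>

definition dihedral :: "nat list \<Rightarrow> nat \<times> int \<Rightarrow> nat list" where
  "dihedral u p = map (\<lambda>i. cyc_nth u (int (fst p) + snd p * int i)) [0..<length u]"

context
  fixes u :: "nat list" and N r :: nat
  assumes u: "u \<in> lists_below N r" "distinct u" and r: "r \<ge> 3"
begin

lemma len_u: "length u = r" using u by (simp add: lists_below_def)
lemma u_ne: "u \<noteq> []" using len_u r by auto
lemma u_simple: "u \<in> simple_edge_walks N r" using u r by (rule distinct_simple_edge_walks)

lemma cyc_nth_u_eq: "cyc_nth u a = cyc_nth u b \<longleftrightarrow> int r dvd a - b"
  using cyc_nth_eq_iff[OF u(2) u_ne] by (simp add: len_u)

lemma cyc_nth_dihedral: "cyc_nth (dihedral u (j, s)) k = cyc_nth u (int j + s * k)"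
proof -
  have "nat (k mod int r) < r" using r by (simp add: nat_less_iff)
  then have "dihedral u (j, s) ! nat (k mod int r) = cyc_nth u (int j + s * (k mod int r))"
    using r by (simp add: dihedral_def len_u)
  moreover have "length (dihedral u (j, s)) = r" by (simp add: dihedral_def len_u)
  ultimately have "cyc_nth (dihedral u (j, s)) k = cyc_nth u (int j + s * (k mod int r))"
    by (simp only: cyc_nth_def[of "dihedral u (j, s)"])
  also have "\<dots> = cyc_nth u (int j + s * k)"
    unfolding cyc_nth_u_eq by (simp add: mod_eq_dvd_iff[symmetric] mod_simps)
  finally show ?thesis .
qed

text \<open>The edges of \<open>u\<close> are numbered by their earlier vertex. Run backwards, a
  step starts at the later one, and the correction \<open>(s - 1) div 2\<close> is then -1, while it
  is 0 for a rotation.\<close>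

lemma dihedral_edge:
  assumes s: "s = 1 \<or> s = - 1"
  shows "mk_edge (cyc_nth u (int j + s * k)) (cyc_nth u (int j + s * (k + 1))) =
    edge_at u (nat ((int j + s * k + (s - 1) div 2) mod int r))"
proof -
  define a where "a = int j + s * k + (s - 1) div 2"
  have a: "nat (a mod int r) < r" using r by (simp add: nat_less_iff)
  have "edge_at u (nat (a mod int r)) = mk_edge (cyc_nth u (a mod int r)) (cyc_nth u (a mod int r + 1))"
    using a r by (subst edge_at_cyc_nth) (simp_all add: len_u)
  also have "cyc_nth u (a mod int r) = cyc_nth u a"
    unfolding cyc_nth_u_eq by (simp add: mod_eq_dvd_iff[symmetric])
  also have "cyc_nth u (a mod int r + 1) = cyc_nth u (a + 1)"
    unfolding cyc_nth_u_eq by (simp add: mod_eq_dvd_iff[symmetric] mod_simps)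
  finally have *: "edge_at u (nat (a mod int r)) = mk_edge (cyc_nth u a) (cyc_nth u (a + 1))" .
  show ?thesis
  proof (cases "s = 1")
    case True
    then show ?thesis using * by (simp add: a_def algebra_simps)
  next
    case False
    then have s: "s = - 1" using assms by simp
    then have "a = int j + s * (k + 1)" "a + 1 = int j + s * k" by (simp_all add: a_def)
    then have "mk_edge (cyc_nth u (int j + s * k)) (cyc_nth u (int j + s * (k + 1))) = mk_edge (cyc_nth u (a + 1)) (cyc_nth u a)"
      by metis
    then show ?thesis using * by (simp only: a_def[symmetric] mk_edge_commute)
  qed
qed

lemma length_dihedral: "length (dihedral u p) = r"
  by (simp add: dihedral_def len_u)

lemma dihedral_simple:
  assumes s: "s = 1 \<or> s = - 1"
  shows "dihedral u (j, s) \<in> simple_edge_walks N r"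
proof (rule distinct_simple_edge_walks[OF _ _ r])
  show "dihedral u (j, s) \<in> lists_below N r"
    using cyc_nth_in[OF u_ne] u by (fastforce simp: dihedral_def lists_below_def)
  have "i = i'" if "i < r" "i' < r" "int r dvd s * int i - s * int i'" for i i'
  proof -
    have "int r dvd int i - int i'" using that(3) s by (auto simp: dvd_diff_commute)
    then have "int i mod int r = int i' mod int r" by (simp add: mod_eq_dvd_iff)
    then show ?thesis using that by (simp flip: zmod_int)
  qed
  then show "distinct (dihedral u (j, s))"
    unfolding dihedral_def by (auto simp: distinct_map inj_on_def cyc_nth_u_eq len_u)
qed

lemma odd_edges_dihedral:
  assumes s: "s = 1 \<or> s = - 1"
  shows "odd_edges (dihedral u (j, s)) = odd_edges u"
proof (rule card_subset_eq)
  show "card (odd_edges (dihedral u (j, s))) = card (odd_edges u)"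
    using simple_odd_edges(3)[OF u_simple] simple_odd_edges(3)[OF dihedral_simple[OF s]] by simp
  show "odd_edges (dihedral u (j, s)) \<subseteq> odd_edges u"
  proof
    fix E assume "E \<in> odd_edges (dihedral u (j, s))"
    then obtain i where i: "i < r" "E = edge_at (dihedral u (j, s)) i"
      using simple_odd_edges(1)[OF dihedral_simple[OF s]] by auto
    have "E = mk_edge (cyc_nth u (int j + s * int i)) (cyc_nth u (int j + s * (int i + 1)))"
      unfolding i(2) using i by (subst edge_at_cyc_nth) (simp_all add: cyc_nth_dihedral length_dihedral)
    then have E: "E = edge_at u (nat ((int j + s * int i + (s - 1) div 2) mod int r))"
      unfolding dihedral_edge[OF s] .
    have "nat ((int j + s * int i + (s - 1) div 2) mod int r) < r" using r by (simp add: nat_less_iff)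
    then show "E \<in> odd_edges u" using E unfolding simple_odd_edges(1)[OF u_simple] by blast
  qed
qed simp

lemma inj_dihedral: "inj_on (dihedral u) ({..<r} \<times> {1, - 1})"
proof (rule inj_onI)
  fix p p' assume p: "p \<in> {..<r} \<times> {1, - 1}" "p' \<in> {..<r} \<times> {1, - 1}" and eq: "dihedral u p = dihedral u p'"
  obtain j s j' s' where js: "p = (j, s)" "p' = (j', s')" by (cases p, cases p')
  have c: "cyc_nth u (int j + s * k) = cyc_nth u (int j' + s' * k)" for k
    using arg_cong[OF eq, of "\<lambda>w. cyc_nth w k"] by (simp add: js cyc_nth_dihedral)
  have "int r dvd int j - int j'" using c[of 0] by (simp add: cyc_nth_u_eq)
  then have "int j mod int r = int j' mod int r" by (simp add: mod_eq_dvd_iff)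
  then have j: "j = j'" using p js by (simp flip: zmod_int)
  have "int r dvd s - s'" using c[of 1] by (simp add: cyc_nth_u_eq j)
  moreover have "\<not> int r dvd 2" using r zdvd_imp_le[of "int r" 2] by auto
  moreover have "int r dvd - 2 \<longleftrightarrow> int r dvd 2" by (rule dvd_minus_iff)
  ultimately have "s = s'" using p js by auto
  then show "p = p'" using j js by simp
qed

text \<open>Every edge of \<open>v\<close> is an edge of the cycle \<open>u\<close>, whose vertices
  are distinct, so each step of \<open>v\<close> changes the position on the cycle by 1 or -1. As
  \<open>v\<close> does not backtrack, the direction of its first step persists.\<close>

lemma same_odd_edges_dihedral:
  assumes v: "v \<in> simple_edge_walks N r" and eq: "odd_edges v = odd_edges u"
  shows "v \<in> dihedral u ` ({..<r} \<times> {1, - 1})"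
proof -
  have lv: "length v = r" and vc: "v \<in> cyc_walks N r"
    using v by (auto simp: simple_edge_walks_def cyc_walks_length)
  have v_ne: "v \<noteq> []" using lv r by auto
  define V where "V i = cyc_nth v (int i)" for i :: nat
  define U where "U = cyc_nth u"
  have edge: "\<exists>k. (V i = U k \<and> V (Suc i) = U (k + 1)) \<or> (V i = U (k + 1) \<and> V (Suc i) = U k)" for i
  proof -
    have lt: "i mod r < r" using r by simp
    have "edge_at v (i mod r) \<in> odd_edges u"
      unfolding eq[symmetric] simple_odd_edges(1)[OF v] using r by simp
    then obtain k where k: "k < r" "edge_at v (i mod r) = edge_at u k"
      unfolding simple_odd_edges(1)[OF u_simple] by auto
    have 1: "edge_at v (i mod r) = mk_edge (V i) (V (Suc i))"
    proof -
      have "v ! (i mod r) = V i" using nth_mod_eq_cyc_nth[OF v_ne, of i] by (simp add: lv V_def)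
      moreover have "v ! ((i mod r + 1) mod r) = V (Suc i)"
        using nth_mod_eq_cyc_nth[OF v_ne, of "Suc i"] by (simp add: lv V_def mod_simps)
      ultimately show ?thesis by (simp only: edge_at_def lv)
    qed
    have 2: "edge_at u k = mk_edge (U (int k)) (U (int k + 1))"
      using k by (simp add: edge_at_cyc_nth len_u U_def)
    show ?thesis using k(2) unfolding 1 2 mk_edge_eq_iff by blast
  qed
  have next_vertex: "V (Suc i) = U (a + 1) \<or> V (Suc i) = U (a - 1)" if Vi: "V i = U a" for i a
  proof -
    have shift: "U (b + c) = U (a + c)" if "U a = U b" for b c
      using that unfolding U_def cyc_nth_u_eq by (metis dvd_diff_commute add_diff_cancel_right)
    obtain k where "(V i = U k \<and> V (Suc i) = U (k + 1)) \<or> (V i = U (k + 1) \<and> V (Suc i) = U k)"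
      using edge by blast
    then show ?thesis
    proof (elim disjE conjE)
      assume "V i = U k" "V (Suc i) = U (k + 1)"
      then show ?thesis using shift[of k 1] Vi by simp
    next
      assume "V i = U (k + 1)" "V (Suc i) = U k"
      then show ?thesis using shift[of "k + 1" "- 1"] Vi by simp
    qed
  qed
  have "V 0 \<in> set u"
    using edge[of 0] cyc_nth_in[OF u_ne] by (auto simp: U_def)
  then obtain j where j: "j < r" "V 0 = U (int j)"
    by (auto simp: in_set_conv_nth U_def cyc_nth_nat len_u)
  obtain s where s: "s = 1 \<or> s = - 1" "V 1 = U (int j + s)"
  proof -
    have "V 1 = U (int j + 1) \<or> V 1 = U (int j + (- 1))" using next_vertex[OF j(2)] by simp
    then show ?thesis using that by blast
  qed
  have all: "V i = U (int j + s * int i) \<and> V (Suc i) = U (int j + s * (int i + 1))" for i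
  proof (induction i)
    case 0
    then show ?case using j s by simp
  next
    case (Suc i)
    have nb: "V (Suc (Suc i)) \<noteq> V i"
      using cyc_walks_cyc_nth[OF vc, of i] r by (simp add: V_def add.commute eq_commute)
    have "V (Suc (Suc i)) = U (int j + s * (int i + 1) + s) \<or> V (Suc (Suc i)) = U (int j + s * (int i + 1) - s)"
      using next_vertex[of "Suc i" "int j + s * (int i + 1)"] Suc s(1) by auto
    moreover have "U (int j + s * (int i + 1) - s) = V i" using Suc by (simp add: algebra_simps)
    ultimately have "V (Suc (Suc i)) = U (int j + s * (int i + 1) + s)" using nb by metis
    then show ?case using Suc by (simp add: algebra_simps)
  qed
  have "v = dihedral u (j, s)"
  proof (rule nth_equalityI)
    show "length v = length (dihedral u (j, s))" by (simp add: lv length_dihedral)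
    fix i assume "i < length v"
    then show "v ! i = dihedral u (j, s) ! i"
      using all[of i] by (simp add: V_def U_def cyc_nth_nat dihedral_def lv len_u)
  qed
  then show ?thesis using j s by auto
qed

text \<open>Both monomials are compared with the product over the common edge set of \<tau>, the
  sign of an edge oriented along \<open>u\<close>. A reflection reverses all \<open>r\<close>
  orientations, and the resulting factor is 1 because \<open>r\<close> is even.\<close>

lemma chi_dihedral:
  assumes s: "s = 1 \<or> s = - 1" and ev: "even r" and H: "H \<in> imag_tournaments N"
  shows "chi (dihedral u (j, s)) H = chi u H"
proof -
  define v where "v = dihedral u (j, s)"
  have vs: "v \<in> simple_edge_walks N r" using dihedral_simple[OF s] by (simp add: v_def)
  have lv: "length v = r" by (simp add: v_def length_dihedral)
  have v_ne: "v \<noteq> []" using lv r by auto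
  define \<tau> where "\<tau> E = (let k = int (the_inv_into {..<r} (edge_at u) E) in sign_entry H (cyc_nth u k) (cyc_nth u (k + 1)))" for E
  have \<tau>: "\<tau> (edge_at u k) = sign_entry H (cyc_nth u (int k)) (cyc_nth u (int k + 1))" if "k < r" for k
    using that the_inv_into_f_f[OF simple_odd_edges(2)[OF u_simple], of k] by (simp add: \<tau>_def Let_def)
  have prod_eq: "chi w H = (\<Prod>i<r. sign_entry H (cyc_nth w (int i)) (cyc_nth w (int i + 1)))" if "length w = r" for w
  proof -
    have "w \<noteq> []" using that r by auto
    then show ?thesis unfolding chi_def walk_weight_def that
      using nth_mod_eq_cyc_nth[of w] that
      by (intro prod.cong refl) (simp add: cyc_nth_nat, metis of_nat_Suc add.commute)
  qed
  have "chi u H = (\<Prod>i<r. \<tau> (edge_at u i))"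
    unfolding prod_eq[OF len_u] by (intro prod.cong refl) (simp add: \<tau>)
  also have "\<dots> = (\<Prod>E\<in>odd_edges u. \<tau> E)"
    unfolding simple_odd_edges(1)[OF u_simple]
    using simple_odd_edges(2)[OF u_simple] by (simp add: prod.reindex)
  also have "\<dots> = (\<Prod>E\<in>odd_edges v. \<tau> E)" using odd_edges_dihedral[OF s] by (simp add: v_def)
  also have "\<dots> = (\<Prod>i<r. \<tau> (edge_at v i))"
    unfolding simple_odd_edges(1)[OF vs]
    using simple_odd_edges(2)[OF vs] by (simp add: prod.reindex)
  also have "\<dots> = (\<Prod>i<r. real_of_int s * sign_entry H (cyc_nth v (int i)) (cyc_nth v (int i + 1)))"
  proof (intro prod.cong refl)
    fix i assume i: "i \<in> {..<r}"
    define a where "a = int j + s * int i + (s - 1) div 2"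
    define k where "k = nat (a mod int r)"
    have k: "k < r" "int k = a mod int r" using r by (simp_all add: k_def nat_less_iff)
    have c: "cyc_nth u (int k + b) = cyc_nth u (a + b)" for b
      unfolding cyc_nth_u_eq k(2) by (simp add: mod_eq_dvd_iff[symmetric] mod_simps)
    have cv: "cyc_nth v l = cyc_nth u (int j + s * l)" for l by (simp add: v_def cyc_nth_dihedral)
    have "edge_at v i = edge_at u k"
      using i dihedral_edge[OF s, of j "int i"] by (simp add: edge_at_cyc_nth lv cv k_def a_def)
    then have "\<tau> (edge_at v i) = sign_entry H (cyc_nth u a) (cyc_nth u (a + 1))"
      using \<tau>[OF k(1)] c[of 0] c[of 1] by simp
    also have "\<dots> = real_of_int s * sign_entry H (cyc_nth v (int i)) (cyc_nth v (int i + 1))"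
    proof (cases "s = 1")
      case True
      then show ?thesis by (simp add: a_def cv algebra_simps)
    next
      case False
      then have s: "s = - 1" using assms by simp
      then have a: "a = int j + s * (int i + 1)" "a + 1 = int j + s * int i" by (simp_all add: a_def)
      have "cyc_nth u a \<noteq> cyc_nth u (a + 1)" using r unfolding cyc_nth_u_eq by (auto dest: zdvd_imp_le)
      moreover have "cyc_nth u b < N" for b using cyc_nth_in[OF u_ne, of b] u by (auto simp: lists_below_def)
      ultimately have "sign_entry H (cyc_nth u a) (cyc_nth u (a + 1)) = - sign_entry H (cyc_nth u (a + 1)) (cyc_nth u a)"
        by (intro sign_entry_antisym[OF H]) auto
      then show ?thesis unfolding a cv by (simp add: s)
    qed
    finally show "\<tau> (edge_at v i) = real_of_int s * sign_entry H (cyc_nth v (int i)) (cyc_nth v (int i + 1))" .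
  qed
  also have "\<dots> = real_of_int s ^ r * chi v H" by (simp add: prod.distrib prod_eq[OF lv])
  also have "real_of_int s ^ r = 1" using s ev by auto
  finally show ?thesis by (simp add: v_def)
qed

lemma same_odd_edges_walks:
  "{v \<in> simple_edge_walks N r. odd_edges v = odd_edges u} = dihedral u ` ({..<r} \<times> {1, - 1})"
  using same_odd_edges_dihedral dihedral_simple odd_edges_dihedral by auto

lemma card_same_odd_edges_walks:
  "card {v \<in> simple_edge_walks N r. odd_edges v = odd_edges u} = 2 * r"
  unfolding same_odd_edges_walks card_image[OF inj_dihedral] by (simp add: card_cartesian_product)

end

section \<open>Moment estimates\<close>

text \<open>There are about N^(2n) walks of length 2n, and the normalisation is the square root of
  that number.\<close>

definition walk_stat :: "nat \<Rightarrow> nat \<Rightarrow> nat list set \<Rightarrow> complex mat \<Rightarrow> real" where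
  "walk_stat N n W H = (\<Sum>w\<in>W. chi w H) / real N ^ n"

definition flip_diff :: "nat \<times> nat \<Rightarrow> (complex mat \<Rightarrow> real) \<Rightarrow> complex mat \<Rightarrow> real" where
  "flip_diff E f H = f (flip_edge E H) - f H"

lemma flip_diff_walk_stat:
  assumes "W \<subseteq> cyc_walks N r" "E \<in> upper_pairs N" "H \<in> imag_tournaments N"
  shows "flip_diff E (walk_stat N n W) H = - 2 / real N ^ n * (\<Sum>w\<in>{w \<in> W. E \<in> odd_edges w}. chi w H)"
proof -
  have fin: "finite W" using assms(1) by (rule finite_subset) simp
  have "flip_diff E (walk_stat N n W) H = (\<Sum>w\<in>W. chi w (flip_edge E H) - chi w H) / real N ^ n"
    by (simp add: flip_diff_def walk_stat_def sum_subtractf diff_divide_distrib)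
  also have "(\<Sum>w\<in>W. chi w (flip_edge E H) - chi w H) = (\<Sum>w\<in>W. if E \<in> odd_edges w then - 2 * chi w H else 0)"
    using assms by (intro sum.cong refl chi_flip_diff) auto
  also have "\<dots> = - 2 * (\<Sum>w\<in>{w \<in> W. E \<in> odd_edges w}. chi w H)"
    using fin by (simp add: sum.If_cases Int_def sum_distrib_left)
  finally show ?thesis by simp
qed

lemma sum_card_incidence:
  assumes "finite U" "finite S" and K: "\<And>p. p \<in> S \<Longrightarrow> finite (K p) \<and> card (K p) \<le> k"
  shows "(\<Sum>E\<in>U. card {p \<in> S. E \<in> K p}) \<le> k * card {p \<in> S. K p \<noteq> {}}"
proof -
  have "(\<Sum>E\<in>U. card {p \<in> S. E \<in> K p}) = (\<Sum>E\<in>U. \<Sum>p\<in>S. if E \<in> K p then 1 else 0)"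
    using assms(2) by (simp add: sum.If_cases Int_def)
  also have "\<dots> = (\<Sum>p\<in>S. \<Sum>E\<in>U. if E \<in> K p then 1 else 0)" by (rule sum.swap)
  also have "\<dots> = (\<Sum>p\<in>S. card (U \<inter> K p))" using assms(1) by (simp add: sum.If_cases)
  also have "\<dots> \<le> (\<Sum>p\<in>S. if K p \<noteq> {} then k else 0)"
  proof (rule sum_mono)
    fix p assume p: "p \<in> S"
    have "card (U \<inter> K p) \<le> card (K p)" using K[OF p] by (intro card_mono) auto
    then show "card (U \<inter> K p) \<le> (if K p \<noteq> {} then k else 0)" using K[OF p] by auto
  qed
  also have "\<dots> = k * card {p \<in> S. K p \<noteq> {}}" using assms(2) by (simp add: sum.If_cases Int_def)
  finally show ?thesis .
qed

lemma mean_chi_pair: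
  assumes "u \<in> cyc_walks N r" "v \<in> cyc_walks N s" "mean N (\<lambda>H. chi u H * chi v H) \<noteq> 0"
  shows "odd_edges u = odd_edges v"
proof (rule ccontr)
  assume "odd_edges u \<noteq> odd_edges v"
  then obtain E where "odd (edge_mult u E + edge_mult v E)" unfolding odd_edges_eq_iff by blast
  then have "mean N (\<lambda>H. prod_list (map (\<lambda>w. chi w H) [u, v])) = 0"
    using assms by (intro mean_chi_prod[of _ _ E]) (auto simp: cyc_walks_length)
  then show False using assms(3) by simp
qed

lemma mean_chi_quad:
  assumes "u \<in> cyc_walks N r" "v \<in> cyc_walks N s" "u' \<in> cyc_walks N r'" "v' \<in> cyc_walks N s'"
    and "mean N (\<lambda>H. (chi u H * chi v H) * (chi u' H * chi v' H)) \<noteq> 0"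
  shows "even (edge_mult u E + edge_mult v E + edge_mult u' E + edge_mult v' E)"
proof (rule ccontr)
  assume "odd (edge_mult u E + edge_mult v E + edge_mult u' E + edge_mult v' E)"
  then have "mean N (\<lambda>H. prod_list (map (\<lambda>w. chi w H) [u, v, u', v'])) = 0"
    using assms by (intro mean_chi_prod[of _ _ E]) (auto simp: cyc_walks_length add.assoc)
  then show False using assms(5) by (simp add: mult.assoc)
qed

lemma mean_chi_pair_subset:
  assumes "W \<subseteq> cyc_walks N r"
  shows "{p \<in> W \<times> W. mean N (\<lambda>H. chi (fst p) H * chi (snd p) H) \<noteq> 0} \<subseteq>
    {p \<in> W \<times> W. odd_edges (fst p) = odd_edges (snd p)}"
proof
  fix p assume "p \<in> {p \<in> W \<times> W. mean N (\<lambda>H. chi (fst p) H * chi (snd p) H) \<noteq> 0}"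
  then have "p \<in> W \<times> W" "mean N (\<lambda>H. chi (fst p) H * chi (snd p) H) \<noteq> 0" by simp_all
  moreover from this have "odd_edges (fst p) = odd_edges (snd p)"
    using assms by (intro mean_chi_pair[of "fst p" N r "snd p" r]) auto
  ultimately show "p \<in> {p \<in> W \<times> W. odd_edges (fst p) = odd_edges (snd p)}" by simp
qed

lemma chi_abs_le: "w \<in> cyc_walks N r \<Longrightarrow> H \<in> imag_tournaments N \<Longrightarrow> \<bar>chi w H\<bar> \<le> 1"
  using chi_abs by simp

text \<open>The constant is 4, the square of the factor -2 of a sign change, times 2n, the largest
  number of odd edges at which one pair of walks can be counted.\<close>

lemma sum_flip_diff_sq_le:
  assumes W: "W \<subseteq> cyc_walks N (2 * n)" and N: "N \<ge> 1"
  shows "mean N (\<lambda>H. \<Sum>E\<in>upper_pairs N. (flip_diff E (walk_stat N n W) H)\<^sup>2) \<le>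
    8 * real n / real N ^ (2 * n) * card {p \<in> W \<times> W. odd_edges (fst p) = odd_edges (snd p) \<and> odd_edges (fst p) \<noteq> {}}"
proof -
  have fin: "finite W" using W by (rule finite_subset) simp
  define S where "S = {p \<in> W \<times> W. odd_edges (fst p) = odd_edges (snd p)}"
  define WE where "WE E = {w \<in> W. E \<in> odd_edges w}" for E
  have finS: "finite S" using fin by (simp add: S_def)
  have "mean N (\<lambda>H. \<Sum>E\<in>upper_pairs N. (flip_diff E (walk_stat N n W) H)\<^sup>2) =
      (\<Sum>E\<in>upper_pairs N. mean N (\<lambda>H. (flip_diff E (walk_stat N n W) H)\<^sup>2))" by (rule mean_sum)
  also have "\<dots> \<le> (\<Sum>E\<in>upper_pairs N. 4 / real N ^ (2 * n) * card {p \<in> S. E \<in> odd_edges (fst p)})"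
  proof (rule sum_mono)
    fix E assume E: "E \<in> upper_pairs N"
    have "mean N (\<lambda>H. (flip_diff E (walk_stat N n W) H)\<^sup>2) = mean N (\<lambda>H. 4 / real N ^ (2 * n) * (\<Sum>w\<in>WE E. 1 * chi w H)\<^sup>2)"
      by (intro mean_cong)
        (simp add: flip_diff_walk_stat[OF W E] WE_def power_mult_distrib power_divide power_mult[symmetric] mult.commute)
    also have "\<dots> = 4 / real N ^ (2 * n) * mean N (\<lambda>H. (\<Sum>w\<in>WE E. 1 * chi w H)\<^sup>2)" by (rule mean_cmult)
    also have "\<dots> \<le> 4 / real N ^ (2 * n) * card {p \<in> S. E \<in> odd_edges (fst p)}"
    proof (rule mult_left_mono)
      have "mean N (\<lambda>H. (\<Sum>w\<in>WE E. 1 * chi w H)\<^sup>2) \<le>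
          (1::real)\<^sup>2 * real (card {p \<in> WE E \<times> WE E. mean N (\<lambda>H. chi (fst p) H * chi (snd p) H) \<noteq> 0})"
        using fin W by (intro second_moment_le chi_abs_le) (auto simp: WE_def)
      also have "card {p \<in> WE E \<times> WE E. mean N (\<lambda>H. chi (fst p) H * chi (snd p) H) \<noteq> 0} \<le>
          card {p \<in> S. E \<in> odd_edges (fst p)}"
      proof (rule card_mono)
        have sub: "WE E \<subseteq> cyc_walks N (2 * n)" using W by (auto simp: WE_def)
        show "{p \<in> WE E \<times> WE E. mean N (\<lambda>H. chi (fst p) H * chi (snd p) H) \<noteq> 0} \<subseteq> {p \<in> S. E \<in> odd_edges (fst p)}"
        proof
          fix p assume "p \<in> {p \<in> WE E \<times> WE E. mean N (\<lambda>H. chi (fst p) H * chi (snd p) H) \<noteq> 0}"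
          from subsetD[OF mean_chi_pair_subset[OF sub] this]
          show "p \<in> {p \<in> S. E \<in> odd_edges (fst p)}" by (simp add: WE_def S_def mem_Times_iff)
        qed
      qed (use finS in simp)
      finally show "mean N (\<lambda>H. (\<Sum>w\<in>WE E. 1 * chi w H)\<^sup>2) \<le> card {p \<in> S. E \<in> odd_edges (fst p)}" by simp
    qed auto
    finally show "mean N (\<lambda>H. (flip_diff E (walk_stat N n W) H)\<^sup>2) \<le> 4 / real N ^ (2 * n) * card {p \<in> S. E \<in> odd_edges (fst p)}" .
  qed
  also have "\<dots> = 4 / real N ^ (2 * n) * real (\<Sum>E\<in>upper_pairs N. card {p \<in> S. E \<in> odd_edges (fst p)})"
    by (simp add: sum_distrib_left)
  also have "\<dots> \<le> 4 / real N ^ (2 * n) * real (2 * n * card {p \<in> S. odd_edges (fst p) \<noteq> {}})"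
  proof (intro mult_left_mono of_nat_mono sum_card_incidence finite_upper_pairs finS)
    fix p assume "p \<in> S"
    then have "fst p \<in> cyc_walks N (2 * n)" using W by (auto simp: S_def)
    then show "finite (odd_edges (fst p)) \<and> card (odd_edges (fst p)) \<le> 2 * n"
      using card_odd_edges_le[of "fst p"] by (simp add: cyc_walks_length)
  qed auto
  also have "{p \<in> S. odd_edges (fst p) \<noteq> {}} =
      {p \<in> W \<times> W. odd_edges (fst p) = odd_edges (snd p) \<and> odd_edges (fst p) \<noteq> {}}"
    by (auto simp: S_def)
  finally show ?thesis by (simp add: field_simps)
qed

lemma sum_flip_diff_sq_bounded:
  assumes W: "\<And>N. W N \<subseteq> cyc_walks N (2 * n)"
  shows "\<exists>C. \<forall>N\<ge>1. mean N (\<lambda>H. \<Sum>E\<in>upper_pairs N. (flip_diff E (walk_stat N n (W N)) H)\<^sup>2) \<le> C"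
proof (intro exI allI impI)
  fix N :: nat assume N: "N \<ge> 1"
  have "mean N (\<lambda>H. \<Sum>E\<in>upper_pairs N. (flip_diff E (walk_stat N n (W N)) H)\<^sup>2) \<le>
    8 * real n / real N ^ (2 * n) *
      card {p \<in> W N \<times> W N. odd_edges (fst p) = odd_edges (snd p) \<and> odd_edges (fst p) \<noteq> {}}"
    by (rule sum_flip_diff_sq_le[OF W N])
  also have "\<dots> \<le> 8 * real n / real N ^ (2 * n) * real (N ^ (2 * n) * (2 * n) ^ (4 * n))"
    using W[of N] by (intro mult_left_mono of_nat_mono card_same_odd[OF N]) auto
  also have "\<dots> = 8 * real n * real ((2 * n) ^ (4 * n))" using N by simp
  finally show "mean N (\<lambda>H. \<Sum>E\<in>upper_pairs N. (flip_diff E (walk_stat N n (W N)) H)\<^sup>2) \<le>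
    8 * real n * real ((2 * n) ^ (4 * n))" .
qed

lemmas sum_flip_diff_sq_cyc_bounded = sum_flip_diff_sq_bounded[OF order_refl]

lemma sum_flip_diff_sq_simple_bounded:
  "\<exists>C. \<forall>N\<ge>1. mean N (\<lambda>H. \<Sum>E\<in>upper_pairs N. (flip_diff E (walk_stat N n (simple_edge_walks N (2 * n))) H)\<^sup>2) \<le> C"
  by (rule sum_flip_diff_sq_bounded) (auto simp: simple_edge_walks_def)

lemma power_diff_two: "N \<ge> 1 \<Longrightarrow> k \<ge> 2 \<Longrightarrow> real N ^ (k - 2) = real N ^ k / (real N)\<^sup>2"
  by (simp add: power_diff)

lemma sum_flip_diff_sq_repeating:
  assumes n: "n \<ge> 1"
  shows "\<exists>C. \<forall>N\<ge>1. mean N (\<lambda>H. \<Sum>E\<in>upper_pairs N. (flip_diff E (walk_stat N n (repeating_walks N (2 * n))) H)\<^sup>2) \<le> C / (real N)\<^sup>2"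
proof (intro exI allI impI)
  fix N :: nat assume N: "N \<ge> 1"
  have sub: "repeating_walks N (2 * n) \<subseteq> cyc_walks N (2 * n)" by (auto simp: repeating_walks_def)
  have "mean N (\<lambda>H. \<Sum>E\<in>upper_pairs N. (flip_diff E (walk_stat N n (repeating_walks N (2 * n))) H)\<^sup>2) \<le>
    8 * real n / real N ^ (2 * n) * card {p \<in> repeating_walks N (2 * n) \<times> repeating_walks N (2 * n).
      odd_edges (fst p) = odd_edges (snd p) \<and> odd_edges (fst p) \<noteq> {}}"
    by (rule sum_flip_diff_sq_le[OF sub N])
  also have "\<dots> \<le> 8 * real n / real N ^ (2 * n) * real (N ^ (2 * n - 2) * (2 * n - 2) ^ (4 * n))"
    by (intro mult_left_mono of_nat_mono card_same_odd_repeating[OF N]) auto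
  also have "\<dots> = 8 * real n * real ((2 * n - 2) ^ (4 * n)) / (real N)\<^sup>2"
    using N n power_diff_two[OF N, of "2 * n"] by (simp add: field_simps)
  finally show "mean N (\<lambda>H. \<Sum>E\<in>upper_pairs N. (flip_diff E (walk_stat N n (repeating_walks N (2 * n))) H)\<^sup>2) \<le>
    8 * real n * real ((2 * n - 2) ^ (4 * n)) / (real N)\<^sup>2" .
qed

text \<open>The square of the inner sum is a sum over pairs of walks, so this is again a second
  moment. A quadruple is counted at \<open>E\<close> only if all four walks contain
  \<open>E\<close>, and it is this common edge that yields the factor \<open>N^-2\<close>.\<close>

lemma sum_flip_diff_fourth:
  assumes n: "n \<ge> 1"
  shows "\<exists>C. \<forall>N\<ge>1. mean N (\<lambda>H. \<Sum>E\<in>upper_pairs N. (flip_diff E (walk_stat N n (cyc_walks N (2 * n))) H) ^ 4) \<le> C / (real N)\<^sup>2"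
proof (intro exI allI impI)
  fix N :: nat assume N: "N \<ge> 1"
  define W where "W = cyc_walks N (2 * n)"
  define K where "K = (\<lambda>q. odd_edges (fst (fst q)) \<inter> odd_edges (snd (fst q)) \<inter> odd_edges (fst (snd q)) \<inter> odd_edges (snd (snd q)))"
  define S where "S = {q \<in> (W \<times> W) \<times> (W \<times> W). \<forall>E. even (edge_mult (fst (fst q)) E + edge_mult (snd (fst q)) E + edge_mult (fst (snd q)) E + edge_mult (snd (snd q)) E)}"
  define WE where "WE E = {w \<in> W. E \<in> odd_edges w}" for E
  have finS: "finite S" by (simp add: S_def W_def)
  have "mean N (\<lambda>H. \<Sum>E\<in>upper_pairs N. (flip_diff E (walk_stat N n W) H) ^ 4) =
      (\<Sum>E\<in>upper_pairs N. mean N (\<lambda>H. (flip_diff E (walk_stat N n W) H) ^ 4))" by (rule mean_sum)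
  also have "\<dots> \<le> (\<Sum>E\<in>upper_pairs N. 16 / real N ^ (4 * n) * card {q \<in> S. E \<in> K q})"
  proof (rule sum_mono)
    fix E assume E: "E \<in> upper_pairs N"
    define P where "P = WE E \<times> WE E"
    define X where "X p H = chi (fst p) H * chi (snd p) H" for p H
    have "mean N (\<lambda>H. (flip_diff E (walk_stat N n W) H) ^ 4) = mean N (\<lambda>H. 16 / real N ^ (4 * n) * (\<Sum>p\<in>P. 1 * X p H)\<^sup>2)"
    proof (rule mean_cong)
      fix H assume H: "H \<in> imag_tournaments N"
      have "(\<Sum>p\<in>P. 1 * X p H) = (\<Sum>w\<in>WE E. chi w H)\<^sup>2"
        by (simp add: P_def X_def power2_eq_square sum_product sum.cartesian_product case_prod_beta)
      moreover have "flip_diff E (walk_stat N n W) H = - 2 / real N ^ n * (\<Sum>w\<in>WE E. chi w H)"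
        using flip_diff_walk_stat[OF _ E H, of W "2 * n" n] by (simp add: W_def WE_def)
      ultimately show "(flip_diff E (walk_stat N n W) H) ^ 4 = 16 / real N ^ (4 * n) * (\<Sum>p\<in>P. 1 * X p H)\<^sup>2"
        by (simp add: power_mult_distrib power_divide power_mult[symmetric] mult.commute)
    qed
    also have "\<dots> = 16 / real N ^ (4 * n) * mean N (\<lambda>H. (\<Sum>p\<in>P. 1 * X p H)\<^sup>2)" by (rule mean_cmult)
    also have "\<dots> \<le> 16 / real N ^ (4 * n) * card {q \<in> S. E \<in> K q}"
    proof (rule mult_left_mono)
      have "mean N (\<lambda>H. (\<Sum>p\<in>P. 1 * X p H)\<^sup>2) \<le> (1::real)\<^sup>2 * real (card {q \<in> P \<times> P. mean N (\<lambda>H. X (fst q) H * X (snd q) H) \<noteq> 0})"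
      proof (rule second_moment_le)
        show "\<bar>X p H\<bar> \<le> 1" if "p \<in> P" "H \<in> imag_tournaments N" for p H
          using that chi_abs[of "fst p" N "2 * n" H] chi_abs[of "snd p" N "2 * n" H]
          by (auto simp: X_def P_def WE_def W_def abs_mult)
      qed (auto simp: P_def WE_def W_def)
      also have "card {q \<in> P \<times> P. mean N (\<lambda>H. X (fst q) H * X (snd q) H) \<noteq> 0} \<le> card {q \<in> S. E \<in> K q}"
      proof (rule card_mono)
        show "finite {q \<in> S. E \<in> K q}" using finS by simp
        show "{q \<in> P \<times> P. mean N (\<lambda>H. X (fst q) H * X (snd q) H) \<noteq> 0} \<subseteq> {q \<in> S. E \<in> K q}"
        proof
          fix q assume q: "q \<in> {q \<in> P \<times> P. mean N (\<lambda>H. X (fst q) H * X (snd q) H) \<noteq> 0}"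
          obtain u v u' v' where uv: "q = ((u, v), (u', v'))" by (metis surj_pair)
          have m: "u \<in> WE E" "v \<in> WE E" "u' \<in> WE E" "v' \<in> WE E"
            and ne: "mean N (\<lambda>H. (chi u H * chi v H) * (chi u' H * chi v' H)) \<noteq> 0"
            using q by (auto simp: uv P_def X_def)
          have "u \<in> cyc_walks N (2 * n)" "v \<in> cyc_walks N (2 * n)" "u' \<in> cyc_walks N (2 * n)" "v' \<in> cyc_walks N (2 * n)"
            using m by (auto simp: WE_def W_def)
          then have "\<forall>E. even (edge_mult u E + edge_mult v E + edge_mult u' E + edge_mult v' E)"
            using mean_chi_quad ne by blast
          then show "q \<in> {q \<in> S. E \<in> K q}"
            using m unfolding uv S_def K_def WE_def by simp
        qed
      qed
      finally show "mean N (\<lambda>H. (\<Sum>p\<in>P. 1 * X p H)\<^sup>2) \<le> card {q \<in> S. E \<in> K q}" by simp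
    qed auto
    finally show "mean N (\<lambda>H. (flip_diff E (walk_stat N n W) H) ^ 4) \<le> 16 / real N ^ (4 * n) * card {q \<in> S. E \<in> K q}" .
  qed
  also have "\<dots> = 16 / real N ^ (4 * n) * real (\<Sum>E\<in>upper_pairs N. card {q \<in> S. E \<in> K q})"
    by (simp add: sum_distrib_left)
  also have "\<dots> \<le> 16 / real N ^ (4 * n) * real (2 * n * card {q \<in> S. K q \<noteq> {}})"
  proof (intro mult_left_mono of_nat_mono sum_card_incidence finite_upper_pairs finS)
    fix q assume "q \<in> S"
    then have "fst (fst q) \<in> cyc_walks N (2 * n)" by (auto simp: S_def W_def)
    then have "card (odd_edges (fst (fst q))) \<le> 2 * n" using card_odd_edges_le[of "fst (fst q)"] by (simp add: cyc_walks_length)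
    moreover have "card (K q) \<le> card (odd_edges (fst (fst q)))" unfolding K_def by (intro card_mono) auto
    ultimately show "finite (K q) \<and> card (K q) \<le> 2 * n" by (simp add: K_def)
  qed auto
  also have "\<dots> \<le> 16 / real N ^ (4 * n) * real (2 * n * (N ^ (4 * n - 2) * (4 * n - 2) ^ (8 * n)))"
  proof (intro mult_left_mono of_nat_mono card_quads_common[OF N n])
    show "{q \<in> S. K q \<noteq> {}} \<subseteq> {((u, v), u', v').
       u \<in> cyc_walks N (2 * n) \<and> v \<in> cyc_walks N (2 * n) \<and> u' \<in> cyc_walks N (2 * n) \<and> v' \<in> cyc_walks N (2 * n) \<and>
       odd_edges u \<inter> odd_edges v \<inter> odd_edges u' \<inter> odd_edges v' \<noteq> {} \<and>
       (\<forall>E. even (edge_mult u E + edge_mult v E + edge_mult u' E + edge_mult v' E))}"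
      unfolding S_def K_def W_def by (rule subsetI) (simp add: case_prod_beta mem_Times_iff)
  qed auto
  also have "\<dots> = 32 * real n * real ((4 * n - 2) ^ (8 * n)) / (real N)\<^sup>2"
    using N n power_diff_two[OF N, of "4 * n"] by (simp add: field_simps)
  finally show "mean N (\<lambda>H. \<Sum>E\<in>upper_pairs N. (flip_diff E (walk_stat N n (cyc_walks N (2 * n))) H) ^ 4) \<le>
      32 * real n * real ((4 * n - 2) ^ (8 * n)) / (real N)\<^sup>2" unfolding W_def .
qed

text \<open>The arithmetic-geometric mean inequality with a free weight replaces Cauchy-Schwarz; the
  weight \<open>a = N\<close> turns a second moment of order \<open>N^-2\<close> into a first moment
  of order 1/N.\<close>

lemma mean_abs_le:
  assumes "a > 0"
  shows "mean N (\<lambda>H. \<bar>f H\<bar>) \<le> (a * mean N (\<lambda>H. (f H)\<^sup>2) + 1 / a) / 2"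
proof -
  have "mean N (\<lambda>H. \<bar>f H\<bar>) \<le> mean N (\<lambda>H. (a * (f H)\<^sup>2 + 1 / a) / 2)"
  proof (rule mean_mono)
    fix H
    have "0 \<le> (a * \<bar>f H\<bar> - 1)\<^sup>2 / a" using assms by simp
    also have "\<dots> = a * (f H)\<^sup>2 - 2 * \<bar>f H\<bar> + 1 / a"
      using assms by (simp add: field_simps power2_eq_square)
    finally show "\<bar>f H\<bar> \<le> (a * (f H)\<^sup>2 + 1 / a) / 2" by simp
  qed
  also have "\<dots> = (a * mean N (\<lambda>H. (f H)\<^sup>2) + 1 / a) / 2"
    using mean_cmult[of N "1 / 2" "\<lambda>H. a * (f H)\<^sup>2 + 1 / a"] by (simp add: mean_add mean_cmult mean_const)
  finally show ?thesis .
qed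

lemma weighted_walks_second_moment:
  assumes W: "W \<subseteq> cyc_walks N (2 * n)" and c: "\<And>w. w \<in> W \<Longrightarrow> \<bar>c w\<bar> \<le> C"
  shows "mean N (\<lambda>H. ((\<Sum>w\<in>W. c w * chi w H) / real N ^ n)\<^sup>2) \<le>
    C\<^sup>2 / real N ^ (2 * n) * card {p \<in> W \<times> W. odd_edges (fst p) = odd_edges (snd p)}"
proof -
  have fin: "finite W" using W by (rule finite_subset) simp
  have "mean N (\<lambda>H. ((\<Sum>w\<in>W. c w * chi w H) / real N ^ n)\<^sup>2) =
      1 / real N ^ (2 * n) * mean N (\<lambda>H. (\<Sum>w\<in>W. c w * chi w H)\<^sup>2)"
    by (subst mean_cmult[symmetric]) (intro mean_cong, simp add: power_divide power_mult[symmetric] mult.commute)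
  also have "\<dots> \<le> 1 / real N ^ (2 * n) * (C\<^sup>2 * card {p \<in> W \<times> W. odd_edges (fst p) = odd_edges (snd p)})"
  proof (rule mult_left_mono)
    have "mean N (\<lambda>H. (\<Sum>w\<in>W. c w * chi w H)\<^sup>2) \<le>
        C\<^sup>2 * card {p \<in> W \<times> W. mean N (\<lambda>H. chi (fst p) H * chi (snd p) H) \<noteq> 0}"
      using fin W c by (intro second_moment_le chi_abs_le) auto
    also have "\<dots> \<le> C\<^sup>2 * card {p \<in> W \<times> W. odd_edges (fst p) = odd_edges (snd p)}"
      using fin mean_chi_pair_subset[OF W] by (intro mult_left_mono of_nat_mono card_mono) simp_all
    finally show "mean N (\<lambda>H. (\<Sum>w\<in>W. c w * chi w H)\<^sup>2) \<le> C\<^sup>2 * card {p \<in> W \<times> W. odd_edges (fst p) = odd_edges (snd p)}" .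
  qed auto
  finally show ?thesis by simp
qed

text \<open>The generator of the walk multiplies \<open>chi w\<close> by minus half the number of odd edges of \<open>w\<close>.\<close>

definition degree_defect :: "nat \<Rightarrow> nat \<Rightarrow> nat \<Rightarrow> complex mat \<Rightarrow> real" where
  "degree_defect N n j H = (\<Sum>E\<in>upper_pairs N. flip_diff E (walk_stat N j (cyc_walks N (2 * j))) H) / 4 +
     n * (walk_stat N j (cyc_walks N (2 * j)) H - mean N (walk_stat N j (cyc_walks N (2 * j))))"

text \<open>Walks without odd edges are constant and are removed by the centring; all others have
  mean 0. Each of the latter is an eigenfunction, and its coefficient is \<open>n\<close> minus half
  the number of its odd edges.\<close>

lemma degree_defect_eq:
  assumes H: "H \<in> imag_tournaments N"
  shows "degree_defect N n j H =
    (\<Sum>w\<in>{w \<in> cyc_walks N (2 * j). odd_edges w \<noteq> {}}. (n - card (odd_edges w) / 2) * chi w H) / real N ^ j"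
proof -
  define W where "W = cyc_walks N (2 * j)"
  define W1 where "W1 = {w \<in> W. odd_edges w \<noteq> {}}"
  have finW: "finite W" by (simp add: W_def)
  have gen: "(\<Sum>E\<in>upper_pairs N. flip_diff E (walk_stat N j W) H) = - 2 / real N ^ j * (\<Sum>w\<in>W1. card (odd_edges w) * chi w H)"
  proof -
    have "(\<Sum>E\<in>upper_pairs N. flip_diff E (walk_stat N j W) H) =
        (\<Sum>E\<in>upper_pairs N. - 2 / real N ^ j * (\<Sum>w\<in>W. if E \<in> odd_edges w then chi w H else 0))"
    proof (intro sum.cong refl)
      fix E assume "E \<in> upper_pairs N"
      then have "flip_diff E (walk_stat N j W) H = - 2 / real N ^ j * (\<Sum>w\<in>{w \<in> W. E \<in> odd_edges w}. chi w H)"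
        using flip_diff_walk_stat[of W N "2 * j" E H j] H by (simp add: W_def)
      also have "(\<Sum>w\<in>{w \<in> W. E \<in> odd_edges w}. chi w H) = (\<Sum>w\<in>W. if E \<in> odd_edges w then chi w H else 0)"
        using finW by (simp add: sum.If_cases Int_def)
      finally show "flip_diff E (walk_stat N j W) H = - 2 / real N ^ j * (\<Sum>w\<in>W. if E \<in> odd_edges w then chi w H else 0)" .
    qed
    also have "\<dots> = - 2 / real N ^ j * (\<Sum>w\<in>W. \<Sum>E\<in>upper_pairs N. if E \<in> odd_edges w then chi w H else 0)"
      unfolding sum_distrib_left[symmetric] by (subst sum.swap) (rule refl)
    also have "(\<Sum>w\<in>W. \<Sum>E\<in>upper_pairs N. if E \<in> odd_edges w then chi w H else 0) = (\<Sum>w\<in>W. card (odd_edges w) * chi w H)"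
    proof (intro sum.cong refl)
      fix w assume "w \<in> W"
      then have "upper_pairs N \<inter> odd_edges w = odd_edges w" using odd_edges_upper[of w N "2 * j"] by (auto simp: W_def)
      then show "(\<Sum>E\<in>upper_pairs N. if E \<in> odd_edges w then chi w H else 0) = card (odd_edges w) * chi w H"
        using finite_upper_pairs by (simp add: sum.If_cases)
    qed
    also have "\<dots> = (\<Sum>w\<in>W1. card (odd_edges w) * chi w H)"
      using finW by (intro sum.mono_neutral_right) (auto simp: W1_def)
    finally show ?thesis .
  qed
  have "mean N (walk_stat N j W) = 1 / real N ^ j * (\<Sum>w\<in>W. mean N (chi w))"
  proof -
    have "mean N (walk_stat N j W) = mean N (\<lambda>H. 1 / real N ^ j * (\<Sum>w\<in>W. chi w H))"
      by (intro mean_cong) (simp add: walk_stat_def)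
    then show ?thesis unfolding mean_cmult mean_sum .
  qed
  also have "(\<Sum>w\<in>W. mean N (chi w)) = (\<Sum>w\<in>W. if odd_edges w = {} then chi w H else 0)"
  proof (intro sum.cong refl)
    fix w assume w: "w \<in> W"
    show "mean N (chi w) = (if odd_edges w = {} then chi w H else 0)"
    proof (cases "odd_edges w = {}")
      case True
      then have "mean N (chi w) = mean N (\<lambda>_. chi w H)"
        using w H by (intro mean_cong chi_const[of w N "2 * j"]) (auto simp: W_def)
      then show ?thesis using True by (simp add: mean_const)
    next
      case False
      then obtain E where "odd (edge_mult w E)" unfolding odd_edges_def by blast
      then have "mean N (\<lambda>H. prod_list (map (\<lambda>w. chi w H) [w])) = 0"
        using w by (intro mean_chi_prod[of _ _ E]) (auto simp: cyc_walks_length W_def)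
      then show ?thesis using False by simp
    qed
  qed
  finally have mean_eq: "mean N (walk_stat N j W) = 1 / real N ^ j * (\<Sum>w\<in>W. if odd_edges w = {} then chi w H else 0)" .
  have "walk_stat N j W H - mean N (walk_stat N j W) =
      (\<Sum>w\<in>W. chi w H - (if odd_edges w = {} then chi w H else 0)) / real N ^ j"
    unfolding mean_eq by (simp add: walk_stat_def sum_subtractf diff_divide_distrib)
  also have "(\<Sum>w\<in>W. chi w H - (if odd_edges w = {} then chi w H else 0)) = (\<Sum>w\<in>W1. chi w H)"
    using finW by (intro sum.mono_neutral_cong_right) (auto simp: W1_def)
  finally have cen: "walk_stat N j W H - mean N (walk_stat N j W) = (\<Sum>w\<in>W1. chi w H) / real N ^ j" .
  have "degree_defect N n j H = ((\<Sum>w\<in>W1. n * chi w H) - (\<Sum>w\<in>W1. card (odd_edges w) * chi w H) / 2) / real N ^ j"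
    unfolding degree_defect_def W_def[symmetric] gen cen sum_distrib_left[symmetric] by (simp add: diff_divide_distrib)
  also have "(\<Sum>w\<in>W1. n * chi w H) - (\<Sum>w\<in>W1. card (odd_edges w) * chi w H) / 2 =
      (\<Sum>w\<in>W1. (n - card (odd_edges w) / 2) * chi w H)"
    by (simp add: sum_divide_distrib sum_subtractf algebra_simps)
  finally show ?thesis by (simp add: W1_def W_def)
qed

lemma degree_defect_coeff: "w \<in> cyc_walks N (2 * j) \<Longrightarrow> \<bar>real n - card (odd_edges w) / 2\<bar> \<le> n + j"
  using card_odd_edges_le[of w] by (simp add: cyc_walks_length)

text \<open>For shorter walks the eigenvalue does not match \<open>n\<close>, and only a constant
  bound is to be expected. It gets multiplied by a coefficient of order 1/N.\<close>

lemma degree_defect_lower: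
  "\<exists>C. \<forall>N\<ge>1. mean N (\<lambda>H. \<bar>degree_defect N n j H\<bar>) \<le> C"
proof (intro exI allI impI)
  fix N :: nat assume N: "N \<ge> 1"
  define W1 where "W1 = {w \<in> cyc_walks N (2 * j). odd_edges w \<noteq> {}}"
  have "mean N (\<lambda>H. (degree_defect N n j H)\<^sup>2) =
      mean N (\<lambda>H. ((\<Sum>w\<in>W1. (n - card (odd_edges w) / 2) * chi w H) / real N ^ j)\<^sup>2)"
    by (intro mean_cong) (simp add: degree_defect_eq W1_def)
  also have "\<dots> \<le> (real (n + j))\<^sup>2 / real N ^ (2 * j) * card {p \<in> W1 \<times> W1. odd_edges (fst p) = odd_edges (snd p)}"
    using degree_defect_coeff by (intro weighted_walks_second_moment) (auto simp: W1_def)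
  also have "\<dots> \<le> (real (n + j))\<^sup>2 / real N ^ (2 * j) * real (N ^ (2 * j) * (2 * j) ^ (4 * j))"
    by (intro mult_left_mono of_nat_mono card_same_odd[OF N]) (auto simp: W1_def)
  also have "\<dots> = (real (n + j))\<^sup>2 * real ((2 * j) ^ (4 * j))" using N by simp
  finally have "mean N (\<lambda>H. (degree_defect N n j H)\<^sup>2) \<le> (real (n + j))\<^sup>2 * real ((2 * j) ^ (4 * j))" .
  then show "mean N (\<lambda>H. \<bar>degree_defect N n j H\<bar>) \<le> ((real (n + j))\<^sup>2 * real ((2 * j) ^ (4 * j)) + 1) / 2"
    using mean_abs_le[of 1 N "degree_defect N n j"] by simp
qed

text \<open>A walk of length 2n without repeated edge has 2n odd edges, so its coefficient vanishes;
  for the walks that remain, the gain of two vertices applies.\<close>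

lemma degree_defect_top:
  assumes n: "n \<ge> 1"
  shows "\<exists>C. \<forall>N\<ge>1. mean N (\<lambda>H. \<bar>degree_defect N n n H\<bar>) \<le> C / real N"
proof (intro exI allI impI)
  fix N :: nat assume N: "N \<ge> 1"
  define W1 where "W1 = {w \<in> repeating_walks N (2 * n). odd_edges w \<noteq> {}}"
  have "mean N (\<lambda>H. (degree_defect N n n H)\<^sup>2) =
      mean N (\<lambda>H. ((\<Sum>w\<in>W1. (n - card (odd_edges w) / 2) * chi w H) / real N ^ n)\<^sup>2)"
  proof (rule mean_cong)
    fix H assume H: "H \<in> imag_tournaments N"
    have "(\<Sum>w\<in>{w \<in> cyc_walks N (2 * n). odd_edges w \<noteq> {}}. (n - card (odd_edges w) / 2) * chi w H) =
        (\<Sum>w\<in>W1. (n - card (odd_edges w) / 2) * chi w H)"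
    proof (rule sum.mono_neutral_right)
      show "\<forall>w\<in>{w \<in> cyc_walks N (2 * n). odd_edges w \<noteq> {}} - W1. (n - card (odd_edges w) / 2) * chi w H = 0"
      proof
        fix w assume "w \<in> {w \<in> cyc_walks N (2 * n). odd_edges w \<noteq> {}} - W1"
        then have "w \<in> simple_edge_walks N (2 * n)" using cyc_walks_split(1)[of N "2 * n"] by (auto simp: W1_def)
        then show "(n - card (odd_edges w) / 2) * chi w H = 0" using simple_odd_edges(3) by simp
      qed
    qed (auto simp: W1_def repeating_walks_def)
    then show "(degree_defect N n n H)\<^sup>2 = ((\<Sum>w\<in>W1. (n - card (odd_edges w) / 2) * chi w H) / real N ^ n)\<^sup>2"
      by (simp add: degree_defect_eq[OF H])
  qed
  also have "\<dots> \<le> (real (n + n))\<^sup>2 / real N ^ (2 * n) * card {p \<in> W1 \<times> W1. odd_edges (fst p) = odd_edges (snd p)}"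
  proof (rule weighted_walks_second_moment)
    show "W1 \<subseteq> cyc_walks N (2 * n)" by (auto simp: W1_def repeating_walks_def)
    show "\<bar>real n - card (odd_edges w) / 2\<bar> \<le> real (n + n)" if "w \<in> W1" for w
      using that degree_defect_coeff[of w N n n] by (simp add: W1_def repeating_walks_def)
  qed
  also have "\<dots> \<le> (real (n + n))\<^sup>2 / real N ^ (2 * n) * real (N ^ (2 * n - 2) * (2 * n - 2) ^ (4 * n))"
    by (intro mult_left_mono of_nat_mono card_same_odd_repeating[OF N]) (auto simp: W1_def)
  also have "\<dots> = (real (n + n))\<^sup>2 * real ((2 * n - 2) ^ (4 * n)) / (real N)\<^sup>2"
    using N n power_diff_two[OF N, of "2 * n"] by (simp add: field_simps)
  finally have "real N * mean N (\<lambda>H. (degree_defect N n n H)\<^sup>2) \<le>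
      real N * ((real (n + n))\<^sup>2 * real ((2 * n - 2) ^ (4 * n)) / (real N)\<^sup>2)" by (intro mult_left_mono) auto
  also have "\<dots> = (real (n + n))\<^sup>2 * real ((2 * n - 2) ^ (4 * n)) / real N"
    using N by (simp add: power2_eq_square)
  finally have "(real N * mean N (\<lambda>H. (degree_defect N n n H)\<^sup>2) + 1 / real N) / 2 \<le>
      ((real (n + n))\<^sup>2 * real ((2 * n - 2) ^ (4 * n)) / real N + 1 / real N) / 2" by simp
  also have "\<dots> = (((real (n + n))\<^sup>2 * real ((2 * n - 2) ^ (4 * n)) + 1) / 2) / real N"
    by (simp add: add_divide_distrib)
  finally show "mean N (\<lambda>H. \<bar>degree_defect N n n H\<bar>) \<le> (((real (n + n))\<^sup>2 * real ((2 * n - 2) ^ (4 * n)) + 1) / 2) / real N"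
    using mean_abs_le[of "real N" N "degree_defect N n n"] N by linarith
qed

section \<open>The product of gradients\<close>

text \<open>The increment at \<open>E\<close> sees exactly the walks in which \<open>E\<close> is
  odd, with a factor -2, so each pair of walks is counted 4 times for every common odd edge.\<close>

lemma sum_flip_diff_product:
  assumes H: "H \<in> imag_tournaments N" and U: "U \<subseteq> cyc_walks N r" and V: "V \<subseteq> cyc_walks N s"
  shows "(\<Sum>E\<in>upper_pairs N. flip_diff E (walk_stat N n U) H * flip_diff E (walk_stat N m V) H) =
    4 / real N ^ (n + m) * (\<Sum>p\<in>U \<times> V. card (odd_edges (fst p) \<inter> odd_edges (snd p)) * (chi (fst p) H * chi (snd p) H))"
proof -
  have fin: "finite U" "finite V" using U V by (auto intro: finite_subset)
  have "(\<Sum>E\<in>upper_pairs N. flip_diff E (walk_stat N n U) H * flip_diff E (walk_stat N m V) H) =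
      (\<Sum>E\<in>upper_pairs N. 4 / real N ^ (n + m) * (\<Sum>p\<in>U \<times> V. if E \<in> odd_edges (fst p) \<inter> odd_edges (snd p) then chi (fst p) H * chi (snd p) H else 0))"
  proof (intro sum.cong refl)
    fix E assume E: "E \<in> upper_pairs N"
    have "(\<Sum>w\<in>{w \<in> U. E \<in> odd_edges w}. chi w H) * (\<Sum>w\<in>{w \<in> V. E \<in> odd_edges w}. chi w H) =
        (\<Sum>p\<in>{w \<in> U. E \<in> odd_edges w} \<times> {w \<in> V. E \<in> odd_edges w}. chi (fst p) H * chi (snd p) H)"
      by (simp add: sum_product sum.cartesian_product case_prod_beta)
    also have "\<dots> = (\<Sum>p\<in>U \<times> V. if E \<in> odd_edges (fst p) \<inter> odd_edges (snd p) then chi (fst p) H * chi (snd p) H else 0)"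
      using fin by (intro sum.mono_neutral_cong_left) auto
    finally have *: "(\<Sum>w\<in>{w \<in> U. E \<in> odd_edges w}. chi w H) * (\<Sum>w\<in>{w \<in> V. E \<in> odd_edges w}. chi w H) =
        (\<Sum>p\<in>U \<times> V. if E \<in> odd_edges (fst p) \<inter> odd_edges (snd p) then chi (fst p) H * chi (snd p) H else 0)" .
    show "flip_diff E (walk_stat N n U) H * flip_diff E (walk_stat N m V) H = 4 / real N ^ (n + m) *
        (\<Sum>p\<in>U \<times> V. if E \<in> odd_edges (fst p) \<inter> odd_edges (snd p) then chi (fst p) H * chi (snd p) H else 0)"
      unfolding flip_diff_walk_stat[OF U E H] flip_diff_walk_stat[OF V E H] *[symmetric] by (simp add: power_add)
  qed
  also have "\<dots> = 4 / real N ^ (n + m) * (\<Sum>p\<in>U \<times> V. \<Sum>E\<in>upper_pairs N.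
      if E \<in> odd_edges (fst p) \<inter> odd_edges (snd p) then chi (fst p) H * chi (snd p) H else 0)"
    unfolding sum_distrib_left[symmetric] by (subst sum.swap) (rule refl)
  also have "(\<Sum>p\<in>U \<times> V. \<Sum>E\<in>upper_pairs N.
      if E \<in> odd_edges (fst p) \<inter> odd_edges (snd p) then chi (fst p) H * chi (snd p) H else 0) =
      (\<Sum>p\<in>U \<times> V. card (odd_edges (fst p) \<inter> odd_edges (snd p)) * (chi (fst p) H * chi (snd p) H))"
  proof (intro sum.cong refl)
    fix p assume "p \<in> U \<times> V"
    then have "fst p \<in> cyc_walks N r" using U by auto
    then have "upper_pairs N \<inter> (odd_edges (fst p) \<inter> odd_edges (snd p)) = odd_edges (fst p) \<inter> odd_edges (snd p)"
      using odd_edges_upper[of "fst p" N r] by blast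
    moreover have "(\<Sum>E\<in>upper_pairs N. if E \<in> odd_edges (fst p) \<inter> odd_edges (snd p) then chi (fst p) H * chi (snd p) H else 0) =
        (\<Sum>E\<in>upper_pairs N \<inter> (odd_edges (fst p) \<inter> odd_edges (snd p)). chi (fst p) H * chi (snd p) H)"
      using finite_upper_pairs by (rule sum.inter_restrict[symmetric])
    ultimately show "(\<Sum>E\<in>upper_pairs N. if E \<in> odd_edges (fst p) \<inter> odd_edges (snd p) then chi (fst p) H * chi (snd p) H else 0) =
        card (odd_edges (fst p) \<inter> odd_edges (snd p)) * (chi (fst p) H * chi (snd p) H)"
      by simp
  qed
  finally show ?thesis .
qed

lemma simple_sub_cyc: "simple_edge_walks N r \<subseteq> cyc_walks N r"
  by (auto simp: simple_edge_walks_def)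

text \<open>Squaring leads to quadruples made of two pairs with different odd edges; their even
  configurations have two vertices fewer than the normalisation allows.\<close>

lemma offdiagonal_second_moment:
  assumes n: "n \<ge> 1"
  shows "\<exists>C\<ge>0. \<forall>N\<ge>1. mean N (\<lambda>H. \<bar>(\<Sum>p\<in>{p \<in> simple_edge_walks N (2 * n) \<times> simple_edge_walks N (2 * m). odd_edges (fst p) \<noteq> odd_edges (snd p)}.
      card (odd_edges (fst p) \<inter> odd_edges (snd p)) * (chi (fst p) H * chi (snd p) H)) / real N ^ (n + m)\<bar>) \<le> C / real N"
proof -
  define B where "B = (real (2 * n))\<^sup>2 * real ((2 * n + 2 * m - 2) ^ (2 * (2 * n + 2 * m)))"
  have main: "mean N (\<lambda>H. \<bar>(\<Sum>p\<in>{p \<in> simple_edge_walks N (2 * n) \<times> simple_edge_walks N (2 * m). odd_edges (fst p) \<noteq> odd_edges (snd p)}.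
      card (odd_edges (fst p) \<inter> odd_edges (snd p)) * (chi (fst p) H * chi (snd p) H)) / real N ^ (n + m)\<bar>) \<le> ((B + 1) / 2) / real N"
    if N: "N \<ge> 1" for N :: nat
  proof -
    define c where "c p = real (card (odd_edges (fst p) \<inter> odd_edges (snd p)))" for p :: "nat list \<times> nat list"
    define X where "X p H = chi (fst p) H * chi (snd p) H" for p H
    define P where "P = {p \<in> simple_edge_walks N (2 * n) \<times> simple_edge_walks N (2 * m).
      odd_edges (fst p) \<noteq> odd_edges (snd p)}"
    define P1 where "P1 = {p \<in> P. odd_edges (fst p) \<inter> odd_edges (snd p) \<noteq> {}}"
    have fin: "finite P" unfolding P_def
      using finite_subset[OF simple_sub_cyc finite_cyc_walks] by simp
    have mem: "fst p \<in> cyc_walks N (2 * n)" "snd p \<in> cyc_walks N (2 * m)" if "p \<in> P" for p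
      using that by (simp_all add: P_def mem_Times_iff subsetD[OF simple_sub_cyc])
    have "mean N (\<lambda>H. ((\<Sum>p\<in>P. c p * X p H) / real N ^ (n + m))\<^sup>2) =
        1 / real N ^ (2 * n + 2 * m) * mean N (\<lambda>H. (\<Sum>p\<in>P1. c p * X p H)\<^sup>2)"
    proof (subst mean_cmult[symmetric], rule mean_cong)
      fix H
      \<comment> \<open>The weight counts common odd edges, so pairs without one drop out; the
        common edge makes the remaining pairs connected.\<close>
      have "(\<Sum>p\<in>P. c p * X p H) = (\<Sum>p\<in>P1. c p * X p H)"
        using fin by (intro sum.mono_neutral_right) (auto simp: P1_def c_def)
      moreover have "(real N ^ (n + m))\<^sup>2 = real N ^ (2 * n + 2 * m)"
        by (simp only: power_mult[symmetric]) (simp add: algebra_simps)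
      ultimately show "((\<Sum>p\<in>P. c p * X p H) / real N ^ (n + m))\<^sup>2 = 1 / real N ^ (2 * n + 2 * m) * (\<Sum>p\<in>P1. c p * X p H)\<^sup>2"
        by (simp only: power_divide) simp
    qed
    also have "\<dots> \<le> 1 / real N ^ (2 * n + 2 * m) * ((real (2 * n))\<^sup>2 * real (card {q \<in> P1 \<times> P1. mean N (\<lambda>H. X (fst q) H * X (snd q) H) \<noteq> 0}))"
    proof (intro mult_left_mono second_moment_le)
      show "finite P1" using fin by (simp add: P1_def)
      show "\<bar>c p\<bar> \<le> real (2 * n)" if "p \<in> P1" for p
      proof -
        have "card (odd_edges (fst p) \<inter> odd_edges (snd p)) \<le> card (odd_edges (fst p))" by (intro card_mono) auto
        also have "\<dots> \<le> 2 * n" using card_odd_edges_le[of "fst p"] mem(1)[of p] that by (simp add: P1_def cyc_walks_length)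
        finally show ?thesis unfolding c_def by (subst abs_of_nonneg) (simp_all only: of_nat_le_iff of_nat_0_le_iff)
      qed
      show "\<bar>X p H\<bar> \<le> 1" if "p \<in> P1" "H \<in> imag_tournaments N" for p H
        using chi_abs[OF mem(1) that(2), of p] chi_abs[OF mem(2) that(2), of p] that(1)
        by (simp add: X_def P1_def abs_mult)
    qed auto
    also have "\<dots> \<le> 1 / real N ^ (2 * n + 2 * m) * ((real (2 * n))\<^sup>2 *
        real (N ^ (2 * n + 2 * m - 2) * (2 * n + 2 * m - 2) ^ (2 * (2 * n + 2 * m))))"
    proof (intro mult_left_mono of_nat_mono card_quads_offdiag[OF N])
      show "{q \<in> P1 \<times> P1. mean N (\<lambda>H. X (fst q) H * X (snd q) H) \<noteq> 0} \<subseteq> {((u, v), u', v').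
         u \<in> simple_edge_walks N (2 * n) \<and> v \<in> simple_edge_walks N (2 * m) \<and>
         u' \<in> simple_edge_walks N (2 * n) \<and> v' \<in> simple_edge_walks N (2 * m) \<and>
         odd_edges u \<inter> odd_edges v \<noteq> {} \<and> odd_edges u' \<inter> odd_edges v' \<noteq> {} \<and> odd_edges u \<noteq> odd_edges v \<and>
         (\<forall>E. even (edge_mult u E + edge_mult v E + edge_mult u' E + edge_mult v' E))}"
      proof
        fix q assume q: "q \<in> {q \<in> P1 \<times> P1. mean N (\<lambda>H. X (fst q) H * X (snd q) H) \<noteq> 0}"
        obtain u v u' v' where uv: "q = ((u, v), (u', v'))" by (metis surj_pair)
        have m: "(u, v) \<in> P1" "(u', v') \<in> P1"
          and ne: "mean N (\<lambda>H. (chi u H * chi v H) * (chi u' H * chi v' H)) \<noteq> 0"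
          using q by (simp_all add: uv X_def)
        have "u \<in> cyc_walks N (2 * n)" "v \<in> cyc_walks N (2 * m)" "u' \<in> cyc_walks N (2 * n)" "v' \<in> cyc_walks N (2 * m)"
          using m mem[of "(u, v)"] mem[of "(u', v')"] by (simp_all add: P1_def)
        then have "\<forall>E. even (edge_mult u E + edge_mult v E + edge_mult u' E + edge_mult v' E)"
          using mean_chi_quad ne by blast
        then show "q \<in> {((u, v), u', v').
         u \<in> simple_edge_walks N (2 * n) \<and> v \<in> simple_edge_walks N (2 * m) \<and>
         u' \<in> simple_edge_walks N (2 * n) \<and> v' \<in> simple_edge_walks N (2 * m) \<and>
         odd_edges u \<inter> odd_edges v \<noteq> {} \<and> odd_edges u' \<inter> odd_edges v' \<noteq> {} \<and> odd_edges u \<noteq> odd_edges v \<and>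
         (\<forall>E. even (edge_mult u E + edge_mult v E + edge_mult u' E + edge_mult v' E))}"
          using m unfolding uv P1_def P_def by simp
      qed
    qed auto
    also have "\<dots> = B / (real N)\<^sup>2"
      using N n power_diff_two[OF N, of "2 * n + 2 * m"] unfolding B_def by (simp add: field_simps)
    finally have "mean N (\<lambda>H. ((\<Sum>p\<in>P. c p * X p H) / real N ^ (n + m))\<^sup>2) \<le> B / (real N)\<^sup>2" .
    then have "real N * mean N (\<lambda>H. ((\<Sum>p\<in>P. c p * X p H) / real N ^ (n + m))\<^sup>2) \<le> real N * (B / (real N)\<^sup>2)"
      by (intro mult_left_mono) auto
    also have "\<dots> = B / real N" using N by (simp add: power2_eq_square)
    finally have "(real N * mean N (\<lambda>H. ((\<Sum>p\<in>P. c p * X p H) / real N ^ (n + m))\<^sup>2) + 1 / real N) / 2 \<le> (B / real N + 1 / real N) / 2"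
      by (intro divide_right_mono add_right_mono) simp_all
    moreover have "(B / real N + 1 / real N) / 2 = ((B + 1) / 2) / real N" by (simp add: add_divide_distrib)
    moreover have "mean N (\<lambda>H. \<bar>(\<Sum>p\<in>P. c p * X p H) / real N ^ (n + m)\<bar>) \<le>
        (real N * mean N (\<lambda>H. ((\<Sum>p\<in>P. c p * X p H) / real N ^ (n + m))\<^sup>2) + 1 / real N) / 2"
      using N by (intro mean_abs_le) simp
    ultimately show ?thesis unfolding P_def c_def X_def by linarith
  qed
  have "B \<ge> 0" by (simp add: B_def)
  then show ?thesis using main by (intro exI[of _ "(B + 1) / 2"]) simp
qed

lemma same_odd_edges_set:
  assumes u: "u \<in> simple_edge_walks N r" and v: "v \<in> simple_edge_walks N r" and eq: "odd_edges u = odd_edges v"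
  shows "set v \<subseteq> set u"
proof
  fix x assume "x \<in> set v"
  then obtain i where i: "i < length v" "x = v ! i" by (auto simp: in_set_conv_nth)
  have "length v = r" using v by (auto simp: simple_edge_walks_def cyc_walks_length)
  then have E: "edge_at v i \<in> odd_edges u" unfolding eq simple_odd_edges(1)[OF v] using i by auto
  have "x = fst (edge_at v i) \<or> x = snd (edge_at v i)" using i by (auto simp: edge_at_def mk_edge_def min_def max_def)
  then show "x \<in> set u" using odd_edge_ends[OF E] by auto
qed

text \<open>If the first walk has distinct vertices, its partners are its 4n rotations and
  reflections, each with product 1, and all but O(N^(2n - 1)) of the N^(2n) lists have distinct
  vertices. If a vertex repeats, both walks live on at most 2n - 1 vertices, and these pairs are
  O(N^(2n - 1)) as well. The bound holds for every \<open>H\<close>, without averaging.\<close>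

lemma diagonal_sum:
  assumes n: "n \<ge> 2"
  shows "\<exists>C\<ge>0. \<forall>N\<ge>1. \<forall>H\<in>imag_tournaments N.
    \<bar>(\<Sum>p\<in>{p \<in> simple_edge_walks N (2 * n) \<times> simple_edge_walks N (2 * n). odd_edges (fst p) = odd_edges (snd p)}.
      chi (fst p) H * chi (snd p) H) / real N ^ (2 * n) - 4 * n\<bar> \<le> C / real N"
proof -
  define D where "D = 2 * n - 1"
  define B1 where "B1 = real (D ^ (4 * n))"
  define B2 where "B2 = real (D ^ (2 * n))"
  have main: "\<bar>(\<Sum>p\<in>{p \<in> simple_edge_walks N (2 * n) \<times> simple_edge_walks N (2 * n). odd_edges (fst p) = odd_edges (snd p)}.
      chi (fst p) H * chi (snd p) H) / real N ^ (2 * n) - 4 * n\<bar> \<le> (B1 + 4 * n * B2) / real N"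
    if N: "N \<ge> 1" and H: "H \<in> imag_tournaments N" for N H
  proof -
    define S where "S = simple_edge_walks N (2 * n)"
    define P where "P = {p \<in> S \<times> S. odd_edges (fst p) = odd_edges (snd p)}"
    define DL where "DL = {u \<in> lists_below N (2 * n). distinct u}"
    have r: "2 * n \<ge> 3" using n by simp
    have finS: "finite S" unfolding S_def by (rule finite_subset[OF simple_sub_cyc finite_cyc_walks])
    have finP: "finite P" using finS by (simp add: P_def)
    have DLS: "DL \<subseteq> S" using distinct_simple_edge_walks[OF _ _ r] by (auto simp: DL_def S_def)
    have lenS: "length u = 2 * n" "set u \<subseteq> {..<N}" "u \<in> cyc_walks N (2 * n)" if "u \<in> S" for u
      using that by (auto simp: S_def simple_edge_walks_def cyc_walks_def lists_below_def)
    have few: "card (set u) \<le> D" if "length u = 2 * n" "\<not> distinct u" for u :: "nat list"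
    proof -
      have "card (set u) \<noteq> 2 * n" using that card_distinct[of u] by auto
      then show ?thesis using that card_length[of u] unfolding D_def by linarith
    qed
    define P1 where "P1 = {p \<in> P. distinct (fst p)}"
    define P2 where "P2 = {p \<in> P. \<not> distinct (fst p)}"
    have split: "(\<Sum>p\<in>P. chi (fst p) H * chi (snd p) H) = (\<Sum>p\<in>P1. chi (fst p) H * chi (snd p) H) + (\<Sum>p\<in>P2. chi (fst p) H * chi (snd p) H)"
      using finP by (subst sum.union_disjoint[symmetric]) (auto simp: P1_def P2_def intro!: sum.cong)
    have s1: "(\<Sum>p\<in>P1. chi (fst p) H * chi (snd p) H) = 4 * n * real (card DL)"
    proof -
      have P1: "P1 = (SIGMA u:DL. {v \<in> S. odd_edges v = odd_edges u})"
      proof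
        show "P1 \<subseteq> (SIGMA u:DL. {v \<in> S. odd_edges v = odd_edges u})"
          using lenS by (auto simp: P1_def P_def DL_def lists_below_def)
        show "(SIGMA u:DL. {v \<in> S. odd_edges v = odd_edges u}) \<subseteq> P1"
          using DLS by (auto simp: P1_def P_def DL_def)
      qed
      have "(\<Sum>p\<in>P1. chi (fst p) H * chi (snd p) H) = (\<Sum>u\<in>DL. \<Sum>v\<in>{v \<in> S. odd_edges v = odd_edges u}. chi u H * chi v H)"
        unfolding P1 using finS DLS by (subst sum.Sigma) (auto intro: finite_subset simp: case_prod_beta)
      also have "\<dots> = (\<Sum>u\<in>DL. real (4 * n))"
      proof (intro sum.cong refl)
        fix u assume "u \<in> DL"
        then have u: "u \<in> lists_below N (2 * n)" "distinct u" by (auto simp: DL_def)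
        have "chi u H * chi v H = 1" if v: "v \<in> {v \<in> S. odd_edges v = odd_edges u}" for v
        proof -
          obtain j s where "v = dihedral u (j, s)" "s = 1 \<or> s = - 1"
            using v unfolding S_def same_odd_edges_walks[OF u r] by blast
          then have "chi v H = chi u H" using chi_dihedral[OF u r _ _ H] by simp
          then show ?thesis using chi_abs[OF lenS(3) H, of u] DLS \<open>u \<in> DL\<close> by (auto simp: abs_if split: if_splits)
        qed
        then have "(\<Sum>v\<in>{v \<in> S. odd_edges v = odd_edges u}. chi u H * chi v H) = real (card {v \<in> S. odd_edges v = odd_edges u})"
          by simp
        then show "(\<Sum>v\<in>{v \<in> S. odd_edges v = odd_edges u}. chi u H * chi v H) = real (4 * n)"
          using card_same_odd_edges_walks[OF u r] by (simp add: S_def)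
      qed
      finally show ?thesis by simp
    qed
    have s2: "\<bar>\<Sum>p\<in>P2. chi (fst p) H * chi (snd p) H\<bar> \<le> real N ^ D * B1"
    proof -
      have "\<bar>\<Sum>p\<in>P2. chi (fst p) H * chi (snd p) H\<bar> \<le> (\<Sum>p\<in>P2. 1)"
      proof (rule order_trans[OF sum_abs], rule sum_mono)
        fix p assume "p \<in> P2"
        then have "fst p \<in> S" "snd p \<in> S" by (auto simp: P2_def P_def)
        then show "\<bar>chi (fst p) H * chi (snd p) H\<bar> \<le> 1" using chi_abs[OF lenS(3) H] by (simp add: abs_mult)
      qed
      also have "(\<Sum>p\<in>P2. 1) = real (card P2)" by simp
      also have "card P2 \<le> N ^ D * D ^ (2 * n + 2 * n)"
      proof (rule count_pairs[OF N])
        show "P2 \<subseteq> cyc_walks N (2 * n) \<times> cyc_walks N (2 * n)" using lenS by (auto simp: P2_def P_def)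
        fix u v assume uv: "(u, v) \<in> P2"
        then have "set v \<subseteq> set u" using same_odd_edges_set[of u N "2 * n" v] by (auto simp: P2_def P_def S_def)
        then have "set (concat [u, v]) = set u" by auto
        moreover have "card (set u) \<le> D" using uv few lenS by (auto simp: P2_def P_def)
        ultimately show "card (set (concat [u, v])) \<le> D" by simp
      qed
      finally show ?thesis by (simp add: B1_def mult_2[symmetric])
    qed
    have s3: "\<bar>real (card DL) - real N ^ (2 * n)\<bar> \<le> real N ^ D * B2"
    proof -
      have "card (lists_below N (2 * n)) = N ^ (2 * n)" by (simp add: lists_below_def card_lists_length_eq)
      moreover have "lists_below N (2 * n) = DL \<union> {u \<in> lists_below N (2 * n). \<not> distinct u}" by (auto simp: DL_def)
      moreover have "card (DL \<union> {u \<in> lists_below N (2 * n). \<not> distinct u}) = card DL + card {u \<in> lists_below N (2 * n). \<not> distinct u}"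
        by (intro card_Un_disjoint) (auto simp: DL_def)
      ultimately have "N ^ (2 * n) = card DL + card {u \<in> lists_below N (2 * n). \<not> distinct u}" by simp
      moreover have "card {u \<in> lists_below N (2 * n). \<not> distinct u} \<le> card {u \<in> lists_below N (2 * n). card (set u) \<le> D}"
      proof (rule card_mono)
        show "finite {u \<in> lists_below N (2 * n). card (set u) \<le> D}"
          by (rule finite_subset[OF _ finite_lists_below]) auto
        show "{u \<in> lists_below N (2 * n). \<not> distinct u} \<subseteq> {u \<in> lists_below N (2 * n). card (set u) \<le> D}"
          using few by (simp add: subset_iff lists_below_def)
      qed
      moreover have "card {u \<in> lists_below N (2 * n). card (set u) \<le> D} \<le> N ^ D * D ^ (2 * n)" by (rule card_few_distinct[OF N])
      ultimately have "N ^ (2 * n) \<le> card DL + N ^ D * D ^ (2 * n)" "card DL \<le> N ^ (2 * n)" by linarith+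
      then have "real (N ^ (2 * n)) \<le> real (card DL + N ^ D * D ^ (2 * n))" "real (card DL) \<le> real (N ^ (2 * n))"
        by (simp_all only: of_nat_le_iff)
      then show ?thesis by (simp add: B2_def)
    qed
    have ND: "real N ^ (2 * n) = real N * real N ^ D" using n by (simp add: D_def power_eq_if)
    have "\<bar>(\<Sum>p\<in>P. chi (fst p) H * chi (snd p) H) - 4 * n * real N ^ (2 * n)\<bar> \<le> real N ^ D * (B1 + 4 * n * B2)"
    proof -
      have "\<bar>4 * n * (real (card DL) - real N ^ (2 * n))\<bar> \<le> 4 * n * (real N ^ D * B2)"
        unfolding abs_mult using s3 by (intro mult_mono) auto
      then show ?thesis unfolding split s1 using s2 by (simp add: algebra_simps)
    qed
    then have "\<bar>(\<Sum>p\<in>P. chi (fst p) H * chi (snd p) H) - 4 * n * real N ^ (2 * n)\<bar> / real N ^ (2 * n) \<le>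
        real N ^ D * (B1 + 4 * n * B2) / real N ^ (2 * n)" by (intro divide_right_mono) auto
    also have "\<dots> = (B1 + 4 * n * B2) / real N" using N unfolding ND by simp
    also have "\<bar>(\<Sum>p\<in>P. chi (fst p) H * chi (snd p) H) - 4 * n * real N ^ (2 * n)\<bar> / real N ^ (2 * n) =
        \<bar>((\<Sum>p\<in>P. chi (fst p) H * chi (snd p) H) - 4 * n * real N ^ (2 * n)) / real N ^ (2 * n)\<bar>" by simp
    also have "((\<Sum>p\<in>P. chi (fst p) H * chi (snd p) H) - 4 * n * real N ^ (2 * n)) / real N ^ (2 * n) =
        (\<Sum>p\<in>P. chi (fst p) H * chi (snd p) H) / real N ^ (2 * n) - 4 * n"
      using N by (simp add: diff_divide_distrib)
    finally show ?thesis unfolding P_def S_def .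
  qed
  have "B1 + 4 * n * B2 \<ge> 0" by (simp add: B1_def B2_def)
  then show ?thesis using main by (intro exI[of _ "B1 + 4 * n * B2"]) blast
qed

text \<open>The 16 anticipates a factor 1/2 for each of the two statistics and the 1/4 in front of
  the conditional expectation. On the diagonal each pair has 2n common edges, which gives
  \<open>2 * n^2\<close>; for different \<open>n\<close> and \<open>m\<close> it is empty, since 2n
  odd edges are never 2m odd edges.\<close>

lemma simple_gradient_product:
  assumes n: "n \<ge> 2" and m: "m \<ge> 2"
  shows "\<exists>C. \<forall>N\<ge>1. mean N (\<lambda>H. \<bar>(\<Sum>E\<in>upper_pairs N.
      flip_diff E (walk_stat N n (simple_edge_walks N (2 * n))) H * flip_diff E (walk_stat N m (simple_edge_walks N (2 * m))) H) / 16
      - (if n = m then 2 * (real n)\<^sup>2 else 0)\<bar>) \<le> C / real N"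
proof -
  obtain C1 where C1: "C1 \<ge> 0" "\<And>N. N \<ge> 1 \<Longrightarrow> mean N (\<lambda>H. \<bar>(\<Sum>p\<in>{p \<in> simple_edge_walks N (2 * n) \<times> simple_edge_walks N (2 * m). odd_edges (fst p) \<noteq> odd_edges (snd p)}.
      card (odd_edges (fst p) \<inter> odd_edges (snd p)) * (chi (fst p) H * chi (snd p) H)) / real N ^ (n + m)\<bar>) \<le> C1 / real N"
    using offdiagonal_second_moment[of n m] n by auto
  obtain C2 where C2: "C2 \<ge> 0" "\<And>N H. N \<ge> 1 \<Longrightarrow> H \<in> imag_tournaments N \<Longrightarrow>
    \<bar>(\<Sum>p\<in>{p \<in> simple_edge_walks N (2 * n) \<times> simple_edge_walks N (2 * n). odd_edges (fst p) = odd_edges (snd p)}.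
      chi (fst p) H * chi (snd p) H) / real N ^ (2 * n) - 4 * n\<bar> \<le> C2 / real N"
    using diagonal_sum[OF n] by auto
  show ?thesis
  proof (intro exI allI impI)
    fix N :: nat assume N: "N \<ge> 1"
    define Sn where "Sn = simple_edge_walks N (2 * n)"
    define Sm where "Sm = simple_edge_walks N (2 * m)"
    define f where "f p H = real (card (odd_edges (fst p) \<inter> odd_edges (snd p))) * (chi (fst p) H * chi (snd p) H)" for p H
    define A where "A H = (\<Sum>p\<in>{p \<in> Sn \<times> Sm. odd_edges (fst p) \<noteq> odd_edges (snd p)}. f p H) / real N ^ (n + m)" for H
    define G where "G H = (\<Sum>E\<in>upper_pairs N. flip_diff E (walk_stat N n Sn) H * flip_diff E (walk_stat N m Sm) H) / 16 - (if n = m then 2 * (real n)\<^sup>2 else 0)" for H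
    have fin: "finite (Sn \<times> Sm)" unfolding Sn_def Sm_def
      using finite_subset[OF simple_sub_cyc finite_cyc_walks] by simp
    have "\<bar>G H\<bar> \<le> 1 / 4 * \<bar>A H\<bar> + n / 2 * (C2 / real N)" if H: "H \<in> imag_tournaments N" for H
    proof -
      have "(\<Sum>E\<in>upper_pairs N. flip_diff E (walk_stat N n Sn) H * flip_diff E (walk_stat N m Sm) H) =
          4 / real N ^ (n + m) * (\<Sum>p\<in>Sn \<times> Sm. f p H)"
        unfolding f_def by (rule sum_flip_diff_product[OF H]) (auto simp: Sn_def Sm_def simple_edge_walks_def)
      also have "(\<Sum>p\<in>Sn \<times> Sm. f p H) = (\<Sum>p\<in>{p \<in> Sn \<times> Sm. odd_edges (fst p) \<noteq> odd_edges (snd p)}. f p H) +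
          (\<Sum>p\<in>{p \<in> Sn \<times> Sm. odd_edges (fst p) = odd_edges (snd p)}. f p H)"
        using fin by (subst sum.union_disjoint[symmetric]) (auto intro!: sum.cong)
      finally have sum_eq: "(\<Sum>E\<in>upper_pairs N. flip_diff E (walk_stat N n Sn) H * flip_diff E (walk_stat N m Sm) H) =
          4 / real N ^ (n + m) * ((\<Sum>p\<in>{p \<in> Sn \<times> Sm. odd_edges (fst p) \<noteq> odd_edges (snd p)}. f p H) +
          (\<Sum>p\<in>{p \<in> Sn \<times> Sm. odd_edges (fst p) = odd_edges (snd p)}. f p H))" .
      have G: "G H = 1 / 4 * A H + ((\<Sum>p\<in>{p \<in> Sn \<times> Sm. odd_edges (fst p) = odd_edges (snd p)}. f p H) / (4 * real N ^ (n + m))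
          - (if n = m then 2 * (real n)\<^sup>2 else 0))"
      proof -
        have "4 / Q * (a + b) / 16 - x = 1 / 4 * (a / Q) + (b / (4 * Q) - x)" if "Q \<noteq> 0" for a b x Q :: real
          using that by (simp add: field_simps)
        moreover have "real N ^ (n + m) \<noteq> 0" using N by simp
        ultimately show ?thesis unfolding G_def A_def sum_eq by blast
      qed
      have "\<bar>(\<Sum>p\<in>{p \<in> Sn \<times> Sm. odd_edges (fst p) = odd_edges (snd p)}. f p H) / (4 * real N ^ (n + m))
          - (if n = m then 2 * (real n)\<^sup>2 else 0)\<bar> \<le> n / 2 * (C2 / real N)"
      proof (cases "n = m")
        case False
        have empty: "{p \<in> Sn \<times> Sm. odd_edges (fst p) = odd_edges (snd p)} = {}"
        proof -
          have "odd_edges u \<noteq> odd_edges v" if "u \<in> Sn" "v \<in> Sm" for u v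
            using that simple_odd_edges(3)[of u N "2 * n"] simple_odd_edges(3)[of v N "2 * m"] False
            by (auto simp: Sn_def Sm_def)
          then show ?thesis by auto
        qed
        show ?thesis unfolding empty using False C2(1) by simp
      next
        case True
        define T where "T = (\<Sum>p\<in>{p \<in> Sn \<times> Sn. odd_edges (fst p) = odd_edges (snd p)}. chi (fst p) H * chi (snd p) H)"
        have "(\<Sum>p\<in>{p \<in> Sn \<times> Sm. odd_edges (fst p) = odd_edges (snd p)}. f p H) = 2 * n * T"
        proof -
          have "(\<Sum>p\<in>{p \<in> Sn \<times> Sm. odd_edges (fst p) = odd_edges (snd p)}. f p H) =
            (\<Sum>p\<in>{p \<in> Sn \<times> Sn. odd_edges (fst p) = odd_edges (snd p)}. 2 * n * (chi (fst p) H * chi (snd p) H))"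
          proof (intro sum.cong)
            fix p assume p: "p \<in> {p \<in> Sn \<times> Sn. odd_edges (fst p) = odd_edges (snd p)}"
            then have "card (odd_edges (snd p)) = 2 * n" using simple_odd_edges(3)[of "snd p" N "2 * n"] by (auto simp: Sn_def)
            then show "f p H = 2 * n * (chi (fst p) H * chi (snd p) H)" using p by (simp add: f_def)
          qed (use True in \<open>simp add: Sn_def Sm_def\<close>)
          then show ?thesis by (simp add: T_def sum_distrib_left)
        qed
        moreover have "2 * a * T / (4 * Q) - 2 * a\<^sup>2 = a / 2 * (T / Q - 4 * a)" if "Q \<noteq> 0" for a Q :: real
          using that by (simp add: field_simps power2_eq_square)
        moreover have "real N ^ (2 * n) \<noteq> 0" "n + m = 2 * n" using N True by simp_all
        ultimately have eq: "(\<Sum>p\<in>{p \<in> Sn \<times> Sm. odd_edges (fst p) = odd_edges (snd p)}. f p H) / (4 * real N ^ (n + m)) - 2 * (real n)\<^sup>2 =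
            n / 2 * (T / real N ^ (2 * n) - 4 * n)"
          by (simp only: of_nat_mult of_nat_numeral)
        have "(if n = m then 2 * (real n)\<^sup>2 else 0) = 2 * (real n)\<^sup>2" using True by simp
        moreover have "\<bar>n / 2 * (T / real N ^ (2 * n) - 4 * n)\<bar> \<le> n / 2 * (C2 / real N)"
          unfolding abs_mult using C2(2)[OF N H] by (intro mult_mono) (auto simp: T_def Sn_def)
        ultimately show ?thesis by (simp only: eq)
      qed
      then show ?thesis unfolding G by linarith
    qed
    then have "mean N (\<lambda>H. \<bar>G H\<bar>) \<le> mean N (\<lambda>H. 1 / 4 * \<bar>A H\<bar> + n / 2 * (C2 / real N))" by (rule mean_mono)
    also have "\<dots> = 1 / 4 * mean N (\<lambda>H. \<bar>A H\<bar>) + n / 2 * (C2 / real N)" by (simp only: mean_add mean_cmult mean_const)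
    also have "\<dots> \<le> 1 / 4 * (C1 / real N) + n / 2 * (C2 / real N)"
      using C1(2)[OF N] unfolding A_def f_def Sn_def Sm_def by simp
    also have "\<dots> = (C1 / 4 + n / 2 * C2) / real N" by (simp add: add_divide_distrib)
    finally show "mean N (\<lambda>H. \<bar>(\<Sum>E\<in>upper_pairs N.
      flip_diff E (walk_stat N n (simple_edge_walks N (2 * n))) H * flip_diff E (walk_stat N m (simple_edge_walks N (2 * m))) H) / 16
      - (if n = m then 2 * (real n)\<^sup>2 else 0)\<bar>) \<le> (C1 / 4 + n / 2 * C2) / real N"
      unfolding G_def Sn_def Sm_def .
  qed
qed

section \<open>The remainders\<close>

lemma walk_weight_entries:
  assumes H: "H \<in> imag_tournaments N" and w: "w \<in> cyc_walks N (2 * l)"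
  shows "walk_weight (\<lambda>i j. H $$ (i, j)) w = of_real ((- 1) ^ l * chi w H)"
proof -
  have "walk_weight (\<lambda>i j. H $$ (i, j)) w = (\<Prod>i<length w. \<i> * of_real (sign_entry H (w ! i) (w ! ((i + 1) mod length w))))"
    unfolding walk_weight_def
    by (intro prod.cong refl entry_eq_sign_entry[OF H])
      (use cyc_walks_step[OF w] cyc_walks_length[OF w] in \<open>simp_all\<close>)
  also have "\<dots> = \<i> ^ (2 * l) * of_real (chi w H)"
    by (simp add: prod.distrib chi_def walk_weight_def cyc_walks_length[OF w])
  also have "\<i> ^ (2 * l) = (- 1) ^ l" by (simp add: power_mult)
  finally show ?thesis by simp
qed

lemma imag_tournaments_unimodular:
  assumes "H \<in> imag_tournaments N"
  shows "unimodular_weights N (\<lambda>i j. H $$ (i, j))"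
proof
  show "H $$ (i, i) = 0" if "i < N" for i using imag_tournamentsD(3)[OF assms that] .
  show "H $$ (i, j) * H $$ (j, i) = 1" if "i < N" "j < N" "i \<noteq> j" for i j
    using imag_tournamentsD(4)[OF assms that] imag_tournamentsD(5)[OF assms that] by auto
qed

abbreviation cyc_stat :: "nat \<Rightarrow> nat \<Rightarrow> complex mat \<Rightarrow> real" where
  "cyc_stat N l \<equiv> walk_stat N l (cyc_walks N (2 * l))"

text \<open>The sign is \<open>\<i> ^ (2 * l)\<close>, from the imaginary unit in every entry; the
  quotient of powers passes from the normalisation for length 2n to that for length 2l.\<close>

definition stat_coeff :: "nat \<Rightarrow> nat \<Rightarrow> nat \<Rightarrow> real" where
  "stat_coeff N n l = (- 1) ^ l * trace_coeff (real N) n l * real N ^ l / real N ^ n"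

lemma stat_coeff_top: "N \<ge> 1 \<Longrightarrow> stat_coeff N n n = (- 1) ^ n"
  by (simp add: stat_coeff_def trace_coeff_diag)

lemma stat_coeff_lower: "\<exists>C\<ge>0. \<forall>N\<ge>2. \<forall>l<n. \<bar>stat_coeff N n l\<bar> \<le> C / real N"
proof -
  obtain C where C: "C \<ge> 0" "\<And>N l. N \<ge> 2 \<Longrightarrow> l < n \<Longrightarrow> \<bar>trace_coeff N n l\<bar> \<le> C * N ^ (n - l - 1)"
    using trace_coeff_bound[of n] by auto
  have "\<bar>stat_coeff N n l\<bar> \<le> C / real N" if N: "N \<ge> 2" and l: "l < n" for N l
  proof -
    have "\<bar>stat_coeff N n l\<bar> = \<bar>trace_coeff (real N) n l\<bar> * (real N ^ l / real N ^ n)"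
      by (simp add: stat_coeff_def abs_mult power_abs)
    also have "\<dots> \<le> C * real N ^ (n - l - 1) * (real N ^ l / real N ^ n)"
      using C(2)[of "real N" l] N l by (intro mult_right_mono) auto
    also have "\<dots> = C / real N"
    proof -
      have "n = (n - l - 1) + l + 1" using l by simp
      then have "real N ^ n = real N ^ (n - l - 1) * real N ^ l * real N" by (metis power_add power_one_right)
      then show ?thesis using N by (simp add: field_simps)
    qed
    finally show ?thesis .
  qed
  then show ?thesis using C(1) by blast
qed

definition y_stat :: "nat \<Rightarrow> nat \<Rightarrow> complex mat \<Rightarrow> real" where
  "y_stat N n H = (\<Sum>l\<in>{2..n}. stat_coeff N n l * cyc_stat N l H) / 2"

text \<open>The constant \<kappa> is the same for all tournaments, so \<open>Y_stat\<close> and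
  \<open>deltaY\<close> can be computed from the real function \<open>y_stat\<close>. The factor 1/2
  there undoes the factor 2 in \<open>cheb_seq\<close>.\<close>

lemma cheb_trace_decomposition:
  assumes n: "n \<ge> 2" and N: "N \<ge> 1"
  shows "\<exists>\<kappa>. \<forall>H\<in>imag_tournaments N. cheb_trace N n H = of_real (y_stat N n H + \<kappa>)"
proof (intro exI ballI)
  fix H assume H: "H \<in> imag_tournaments N"
  let ?h = "\<lambda>i j. H $$ (i, j)"
  define K where "K = trace_coeff (real N) n 0 * 2 * real N + (\<Sum>l\<in>{1..n}. trace_coeff (real N) n l * (real N * (3 - real N)))"
  interpret unimodular_weights N ?h using H by (rule imag_tournaments_unimodular)
  have carr: "H \<in> carrier_mat N N" using imag_tournamentsD(1,2)[OF H] by auto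
  have "cheb_trace N n H = (\<Sum>i<N. cheb_seq N ?h (of_nat N) (2 * n) i i) / (2 * of_nat N ^ n)"
    by (rule cheb_trace_eq_cheb_seq[OF carr N])
  also have "(\<Sum>i<N. cheb_seq N ?h (of_nat N) (2 * n) i i) =
      (\<Sum>l\<in>{2..n}. of_real (trace_coeff (real N) n l) * (\<Sum>w\<in>cyc_walks N (2 * l). walk_weight ?h w)) + of_real K"
    unfolding K_def by (rule trace_cheb_seq_expansion[OF n])
  also have "(\<Sum>l\<in>{2..n}. of_real (trace_coeff (real N) n l) * (\<Sum>w\<in>cyc_walks N (2 * l). walk_weight ?h w)) =
      of_real (\<Sum>l\<in>{2..n}. trace_coeff (real N) n l * ((- 1) ^ l * (\<Sum>w\<in>cyc_walks N (2 * l). chi w H)))"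
    unfolding of_real_sum of_real_mult
    by (intro sum.cong refl arg_cong2[where f = "(*)"])
      (simp add: walk_weight_entries[OF H] sum_distrib_left)
  also have "(of_real (\<Sum>l\<in>{2..n}. trace_coeff (real N) n l * ((- 1) ^ l * (\<Sum>w\<in>cyc_walks N (2 * l). chi w H))) + of_real K) / (2 * of_nat N ^ n) =
      complex_of_real (((\<Sum>l\<in>{2..n}. trace_coeff (real N) n l * ((- 1) ^ l * (\<Sum>w\<in>cyc_walks N (2 * l). chi w H))) + K) / (2 * real N ^ n))"
    by simp
  also have "((\<Sum>l\<in>{2..n}. trace_coeff (real N) n l * ((- 1) ^ l * (\<Sum>w\<in>cyc_walks N (2 * l). chi w H))) + K) / (2 * real N ^ n) =
      y_stat N n H + K / (2 * real N ^ n)"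
  proof -
    have "(\<Sum>l\<in>{2..n}. trace_coeff (real N) n l * ((- 1) ^ l * (\<Sum>w\<in>cyc_walks N (2 * l). chi w H))) / (2 * real N ^ n) = y_stat N n H"
      unfolding y_stat_def sum_divide_distrib using N
      by (intro sum.cong refl) (simp add: stat_coeff_def walk_stat_def mult_ac)
    then show ?thesis by (simp add: add_divide_distrib)
  qed
  finally show "cheb_trace N n H = of_real (y_stat N n H +
      (trace_coeff (real N) n 0 * 2 * real N + (\<Sum>l\<in>{1..n}. trace_coeff (real N) n l * (real N * (3 - real N)))) / (2 * real N ^ n))"
    unfolding K_def .
qed

section \<open>Expectations and remainders as finite sums\<close>

lemma expectation_pmf_of_set:
  fixes f :: "'a \<Rightarrow> 'b::{banach, second_countable_topology}"
  assumes "finite A" "A \<noteq> {}"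
  shows "measure_pmf.expectation (pmf_of_set A) f = (\<Sum>a\<in>A. f a) /\<^sub>R card A"
proof -
  have "measure_pmf.expectation (pmf_of_set A) f = (\<Sum>a\<in>A. pmf (pmf_of_set A) a *\<^sub>R f a)"
    using assms by (intro integral_measure_pmf) auto
  also have "\<dots> = (\<Sum>a\<in>A. (1 / card A) *\<^sub>R f a)"
    using assms by (intro sum.cong refl) simp
  finally show ?thesis by (simp add: scaleR_sum_right inverse_eq_divide)
qed

lemma expectation_ite: "measure_pmf.expectation (ite N) f = mean N f"
  unfolding ite_def mean_def using finite_imag_tournaments imag_tournaments_nonempty
  by (subst expectation_pmf_of_set) (simp_all add: field_simps)

lemma expectation_ite_of_real:
  assumes "\<And>H. H \<in> imag_tournaments N \<Longrightarrow> f H = complex_of_real (g H)"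
  shows "measure_pmf.expectation (ite N) f = of_real (mean N g)"
  unfolding ite_def mean_def using finite_imag_tournaments imag_tournaments_nonempty assms
  by (subst expectation_pmf_of_set) (simp_all add: scaleR_conv_of_real field_simps)

lemma cond_exp_H_sum:
  fixes f :: "complex mat \<Rightarrow> complex mat \<Rightarrow> 'b::{banach, second_countable_topology}"
  assumes N: "N \<ge> 2" and H: "H \<in> imag_tournaments N"
  shows "cond_exp_H N f H = (\<Sum>E\<in>upper_pairs N. f (flip_edge E H) H) /\<^sub>R d_N N"
proof -
  have "cond_exp_H N f H = measure_pmf.expectation (pmf_of_set (upper_pairs N)) (\<lambda>E. f (flip_edge E H) H)"
    unfolding cond_exp_H_eq[OF H] walk_step_def integral_map_pmf
    by (simp add: case_prod_beta flip_edge_def)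
  then show ?thesis
    using expectation_pmf_of_set[OF finite_upper_pairs upper_pairs_nonempty[OF N]]
    by (simp add: card_upper_pairs)
qed

lemma d_N_pos: "N \<ge> 2 \<Longrightarrow> d_N N > 0"
  by (simp add: d_N_def)

lemma Y_stat_eq:
  assumes n: "n \<ge> 2" and N: "N \<ge> 1" and H: "H \<in> imag_tournaments N"
  shows "Y_stat N n H = of_real (y_stat N n H - mean N (y_stat N n))"
proof -
  obtain \<kappa> where k: "\<And>H. H \<in> imag_tournaments N \<Longrightarrow> cheb_trace N n H = of_real (y_stat N n H + \<kappa>)"
    using cheb_trace_decomposition[OF n N] by blast
  have "measure_pmf.expectation (ite N) (cheb_trace N n) = of_real (mean N (\<lambda>H. y_stat N n H + \<kappa>))"
    using k by (rule expectation_ite_of_real)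
  also have "mean N (\<lambda>H. y_stat N n H + \<kappa>) = mean N (y_stat N n) + \<kappa>" by (simp only: mean_add mean_const)
  finally show ?thesis unfolding Y_stat_def by (simp add: k[OF H])
qed

lemma deltaY_flip:
  assumes "n \<ge> 2" "N \<ge> 1" "H \<in> imag_tournaments N" "E \<in> upper_pairs N"
  shows "deltaY N n (flip_edge E H) H = of_real (flip_diff E (y_stat N n) H)"
  using assms Y_stat_eq[of n N H] Y_stat_eq[of n N "flip_edge E H"] flip_edge_in
  by (simp add: deltaY_def flip_diff_def)

lemma flip_diff_y_stat: "flip_diff E (y_stat N n) H = (\<Sum>l\<in>{2..n}. stat_coeff N n l * flip_diff E (cyc_stat N l) H) / 2"
  by (simp add: flip_diff_def y_stat_def diff_divide_distrib sum_subtractf right_diff_distrib)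

lemma R_n_eq:
  assumes n: "n \<ge> 2" and N: "N \<ge> 2" and H: "H \<in> imag_tournaments N"
  shows "R_n N n H = of_real ((\<Sum>l\<in>{2..n}. stat_coeff N n l * degree_defect N n l H) / 2)"
proof -
  have "cond_exp_H N (deltaY N n) H = (\<Sum>E\<in>upper_pairs N. of_real (flip_diff E (y_stat N n) H)) /\<^sub>R d_N N"
    unfolding cond_exp_H_sum[OF N H] using n N H by (simp add: deltaY_flip)
  then have "of_real (d_N N / 4) * cond_exp_H N (deltaY N n) H = of_real ((\<Sum>E\<in>upper_pairs N. flip_diff E (y_stat N n) H) / 4)"
    using d_N_pos[OF N] by (simp add: scaleR_conv_of_real)
  also have "(\<Sum>E\<in>upper_pairs N. flip_diff E (y_stat N n) H) = (\<Sum>l\<in>{2..n}. stat_coeff N n l * (\<Sum>E\<in>upper_pairs N. flip_diff E (cyc_stat N l) H)) / 2"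
    unfolding flip_diff_y_stat sum_divide_distrib[symmetric] sum_distrib_left by (subst sum.swap) (rule refl)
  finally have 0: "of_real (d_N N / 4) * cond_exp_H N (deltaY N n) H =
      complex_of_real ((\<Sum>l\<in>{2..n}. stat_coeff N n l * (\<Sum>E\<in>upper_pairs N. flip_diff E (cyc_stat N l) H)) / 2 / 4)" .
  have 1: "of_real (d_N N / 4) * cond_exp_H N (deltaY N n) H =
      complex_of_real ((\<Sum>l\<in>{2..n}. stat_coeff N n l * ((\<Sum>E\<in>upper_pairs N. flip_diff E (cyc_stat N l) H) / 4)) / 2)"
  proof -
    define S where "S l = (\<Sum>E\<in>upper_pairs N. flip_diff E (cyc_stat N l) H)" for l
    have "(\<Sum>l\<in>{2..n}. stat_coeff N n l * (S l / 4)) = (\<Sum>l\<in>{2..n}. stat_coeff N n l * S l) / 4" by (simp add: sum_divide_distrib)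
    then have "(\<Sum>l\<in>{2..n}. stat_coeff N n l * S l) / 2 / 4 = (\<Sum>l\<in>{2..n}. stat_coeff N n l * (S l / 4)) / 2" by simp
    then show ?thesis unfolding 0 S_def by (simp only:)
  qed
  have "mean N (y_stat N n) = (\<Sum>l\<in>{2..n}. stat_coeff N n l * mean N (cyc_stat N l)) / 2"
  proof -
    have "mean N (y_stat N n) = mean N (\<lambda>H. 1 / 2 * (\<Sum>l\<in>{2..n}. stat_coeff N n l * cyc_stat N l H))"
      by (intro mean_cong) (simp add: y_stat_def)
    then show ?thesis unfolding mean_cmult mean_sum by simp
  qed
  then have "y_stat N n H - mean N (y_stat N n) = (\<Sum>l\<in>{2..n}. stat_coeff N n l * (cyc_stat N l H - mean N (cyc_stat N l))) / 2"
    by (simp add: y_stat_def diff_divide_distrib sum_subtractf right_diff_distrib)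
  then have "real n * (y_stat N n H - mean N (y_stat N n)) =
      (\<Sum>l\<in>{2..n}. stat_coeff N n l * (n * (cyc_stat N l H - mean N (cyc_stat N l)))) / 2"
    by (simp add: sum_distrib_left mult_ac)
  moreover have "of_nat n * Y_stat N n H = complex_of_real (real n * (y_stat N n H - mean N (y_stat N n)))"
    using Y_stat_eq[OF n _ H] N by simp
  ultimately have 2: "of_nat n * Y_stat N n H =
      complex_of_real ((\<Sum>l\<in>{2..n}. stat_coeff N n l * (n * (cyc_stat N l H - mean N (cyc_stat N l)))) / 2)"
    by (simp only:)
  show ?thesis
    unfolding R_n_def 1 2 degree_defect_def
    by (simp only: of_real_add[symmetric] add_divide_distrib[symmetric] sum.distrib[symmetric] distrib_left[symmetric])
qed

lemma R_nm_eq: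
  assumes n: "n \<ge> 2" and m: "m \<ge> 2" and N: "N \<ge> 2" and H: "H \<in> imag_tournaments N"
  shows "R_nm N n m H = of_real ((\<Sum>E\<in>upper_pairs N. flip_diff E (y_stat N n) H * flip_diff E (y_stat N m) H) / 4
    - (if n = m then 2 * (real n)\<^sup>2 else 0))"
proof -
  have "cond_exp_H N (\<lambda>H' H. deltaY N n H' H * deltaY N m H' H) H =
      (\<Sum>E\<in>upper_pairs N. of_real (flip_diff E (y_stat N n) H * flip_diff E (y_stat N m) H)) /\<^sub>R d_N N"
    unfolding cond_exp_H_sum[OF N H] using n m N H by (simp add: deltaY_flip)
  then have "of_real (d_N N / 4) * cond_exp_H N (\<lambda>H' H. deltaY N n H' H * deltaY N m H' H) H =
      of_real ((\<Sum>E\<in>upper_pairs N. flip_diff E (y_stat N n) H * flip_diff E (y_stat N m) H) / 4)"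
    using d_N_pos[OF N] by (simp add: scaleR_conv_of_real)
  then show ?thesis unfolding R_nm_def by simp
qed

lemma R_nml_eq:
  assumes n: "n \<ge> 2" and m: "m \<ge> 2" and l: "l \<ge> 2" and N: "N \<ge> 2" and H: "H \<in> imag_tournaments N"
  shows "R_nml N n m l H =
    (\<Sum>E\<in>upper_pairs N. \<bar>flip_diff E (y_stat N n) H\<bar> * \<bar>flip_diff E (y_stat N m) H\<bar> * \<bar>flip_diff E (y_stat N l) H\<bar>) / 4"
proof -
  have "cond_exp_H N (\<lambda>H' H. cmod (deltaY N n H' H * deltaY N m H' H * deltaY N l H' H)) H =
      (\<Sum>E\<in>upper_pairs N. \<bar>flip_diff E (y_stat N n) H\<bar> * \<bar>flip_diff E (y_stat N m) H\<bar> * \<bar>flip_diff E (y_stat N l) H\<bar>) /\<^sub>R d_N N"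
    unfolding cond_exp_H_sum[OF N H] using n m l N H by (simp add: deltaY_flip norm_mult)
  then show ?thesis unfolding R_nml_def using d_N_pos[OF N] by simp
qed

section \<open>First moments of the three remainders\<close>

lemma sum_sq_le: "finite A \<Longrightarrow> (\<Sum>x\<in>A. f x)\<^sup>2 \<le> card A * (\<Sum>x\<in>A. (f x :: real)\<^sup>2)"
  using sum_squared_le_sum_of_squares[of f A] by (cases "A = {}") (auto simp: mult.commute)

lemma stat_coeff_bounded: "\<exists>C\<ge>0. \<forall>N\<ge>2. \<forall>l\<in>{2..n}. \<bar>stat_coeff N n l\<bar> \<le> C"
proof -
  obtain C where C: "C \<ge> 0" "\<And>N l. N \<ge> 2 \<Longrightarrow> l < n \<Longrightarrow> \<bar>stat_coeff N n l\<bar> \<le> C / real N" using stat_coeff_lower[of n] by blast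
  have "\<bar>stat_coeff N n l\<bar> \<le> C + 1" if "N \<ge> 2" "l \<in> {2..n}" for N l
  proof (cases "l = n")
    case True
    then show ?thesis using that C(1) by (simp add: stat_coeff_top)
  next
    case False
    have "C * 1 \<le> C * real N" using that C(1) by (intro mult_left_mono) auto
    then have "C / real N \<le> C" using that by (simp add: divide_le_eq)
    then show ?thesis using C(2)[of N l] that False by simp
  qed
  then show ?thesis using C(1) by (intro exI[of _ "C + 1"]) simp
qed

lemma sum_mean_swap: "mean N (\<lambda>H. \<Sum>E\<in>A. \<Sum>l\<in>B. f E l H) = (\<Sum>l\<in>B. mean N (\<lambda>H. \<Sum>E\<in>A. f E l H))"
  unfolding mean_sum by (rule sum.swap)

text \<open>Each summand is of order 1/N for one of two reasons: at top length the defect is small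
  and the coefficient has modulus 1, below it the coefficient is small and the defect
  bounded.\<close>

lemma R_n_bound:
  assumes n: "n \<ge> 2"
  shows "\<exists>C. \<forall>N\<ge>2. mean N (\<lambda>H. cmod (R_n N n H)) \<le> C / real N"
proof -
  obtain Cg where Cg: "Cg \<ge> 0" "\<And>N l. N \<ge> 2 \<Longrightarrow> l < n \<Longrightarrow> \<bar>stat_coeff N n l\<bar> \<le> Cg / real N" using stat_coeff_lower[of n] by blast
  obtain Ct where Ct: "\<And>N. N \<ge> 1 \<Longrightarrow> mean N (\<lambda>H. \<bar>degree_defect N n n H\<bar>) \<le> Ct / real N"
    using degree_defect_top[of n] n by auto
  have "\<exists>C. \<forall>l. \<forall>N\<ge>1. mean N (\<lambda>H. \<bar>degree_defect N n l H\<bar>) \<le> C l"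
    using degree_defect_lower by metis
  then obtain Cl where Cl: "\<And>l N. N \<ge> 1 \<Longrightarrow> mean N (\<lambda>H. \<bar>degree_defect N n l H\<bar>) \<le> Cl l" by blast
  show ?thesis
  proof (intro exI allI impI)
    fix N :: nat assume N: "N \<ge> 2"
    have "mean N (\<lambda>H. cmod (R_n N n H)) \<le> mean N (\<lambda>H. \<Sum>l\<in>{2..n}. \<bar>stat_coeff N n l\<bar> * \<bar>degree_defect N n l H\<bar>)"
    proof (rule mean_mono)
      fix H assume H: "H \<in> imag_tournaments N"
      have "cmod (R_n N n H) = \<bar>\<Sum>l\<in>{2..n}. stat_coeff N n l * degree_defect N n l H\<bar> / 2"
        unfolding R_n_eq[OF n N H] norm_of_real by simp
      also have "\<dots> \<le> \<bar>\<Sum>l\<in>{2..n}. stat_coeff N n l * degree_defect N n l H\<bar>" by simp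
      also have "\<dots> \<le> (\<Sum>l\<in>{2..n}. \<bar>stat_coeff N n l\<bar> * \<bar>degree_defect N n l H\<bar>)"
        unfolding abs_mult[symmetric] by (rule sum_abs)
      finally show "cmod (R_n N n H) \<le> (\<Sum>l\<in>{2..n}. \<bar>stat_coeff N n l\<bar> * \<bar>degree_defect N n l H\<bar>)" .
    qed
    also have "\<dots> = (\<Sum>l\<in>{2..n}. \<bar>stat_coeff N n l\<bar> * mean N (\<lambda>H. \<bar>degree_defect N n l H\<bar>))"
      by (simp only: mean_sum mean_cmult)
    also have "\<dots> \<le> (\<Sum>l\<in>{2..n}. (if l = n then Ct else Cg * Cl l) / real N)"
    proof (rule sum_mono)
      fix l assume l: "l \<in> {2..n}"
      have nn: "mean N (\<lambda>H. \<bar>degree_defect N n l H\<bar>) \<ge> 0" by (rule mean_nonneg) simp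
      show "\<bar>stat_coeff N n l\<bar> * mean N (\<lambda>H. \<bar>degree_defect N n l H\<bar>) \<le> (if l = n then Ct else Cg * Cl l) / real N"
      proof (cases "l = n")
        case True
        then show ?thesis using Ct[of N] N by (simp add: stat_coeff_top power_abs)
      next
        case False
        then have "\<bar>stat_coeff N n l\<bar> * mean N (\<lambda>H. \<bar>degree_defect N n l H\<bar>) \<le> Cg / real N * Cl l"
          using Cg Cl[of N l] l N nn by (intro mult_mono) auto
        then show ?thesis using False by simp
      qed
    qed
    also have "\<dots> = (\<Sum>l\<in>{2..n}. if l = n then Ct else Cg * Cl l) / real N" by (simp only: sum_divide_distrib)
    finally show "mean N (\<lambda>H. cmod (R_n N n H)) \<le> (\<Sum>l\<in>{2..n}. if l = n then Ct else Cg * Cl l) / real N" .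
  qed
qed

text \<open>With \<open>a = N\<close>, a bounded second moment of \<open>f\<close> and one of order
  \<open>N^-2\<close> of \<open>g\<close> both contribute at order 1/N.\<close>

lemma mean_sum_abs_mult_le:
  assumes "a > 0"
  shows "mean N (\<lambda>H. \<Sum>E\<in>A. \<bar>f E H\<bar> * \<bar>g E H\<bar>) \<le>
    (mean N (\<lambda>H. \<Sum>E\<in>A. (f E H)\<^sup>2) / a + a * mean N (\<lambda>H. \<Sum>E\<in>A. (g E H)\<^sup>2)) / 2"
proof -
  have "mean N (\<lambda>H. \<Sum>E\<in>A. \<bar>f E H\<bar> * \<bar>g E H\<bar>) \<le>
      mean N (\<lambda>H. 1 / (2 * a) * (\<Sum>E\<in>A. (f E H)\<^sup>2) + a / 2 * (\<Sum>E\<in>A. (g E H)\<^sup>2))"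
  proof (rule mean_mono)
    fix H
    have "\<bar>x\<bar> * \<bar>y\<bar> \<le> 1 / (2 * a) * x\<^sup>2 + a / 2 * y\<^sup>2" for x y :: real
    proof -
      have "0 \<le> (\<bar>x\<bar> - a * \<bar>y\<bar>)\<^sup>2 / (2 * a)" using assms by simp
      also have "\<dots> = 1 / (2 * a) * x\<^sup>2 + a / 2 * y\<^sup>2 - \<bar>x\<bar> * \<bar>y\<bar>"
        using assms by (simp add: power2_diff power_mult_distrib field_simps) (simp add: power2_eq_square)
      finally show ?thesis by simp
    qed
    then show "(\<Sum>E\<in>A. \<bar>f E H\<bar> * \<bar>g E H\<bar>) \<le> 1 / (2 * a) * (\<Sum>E\<in>A. (f E H)\<^sup>2) + a / 2 * (\<Sum>E\<in>A. (g E H)\<^sup>2)"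
      unfolding sum_distrib_left sum.distrib[symmetric] by (intro sum_mono)
  qed
  also have "\<dots> = (mean N (\<lambda>H. \<Sum>E\<in>A. (f E H)\<^sup>2) / a + a * mean N (\<lambda>H. \<Sum>E\<in>A. (g E H)\<^sup>2)) / 2"
    unfolding mean_add mean_cmult by (simp add: field_simps)
  finally show ?thesis .
qed

text \<open>Up to the factor 1/2, this is the part of the increment that does not come from
  top-length walks with simple edges; its square summed over the edges has mean of order
  \<open>N^-2\<close>.\<close>

definition error_part :: "nat \<Rightarrow> nat \<Rightarrow> nat \<times> nat \<Rightarrow> complex mat \<Rightarrow> real" where
  "error_part N n E H = (- 1) ^ n * flip_diff E (walk_stat N n (repeating_walks N (2 * n))) H +
     (\<Sum>l\<in>{2..<n}. stat_coeff N n l * flip_diff E (cyc_stat N l) H)"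

lemma flip_diff_y_stat_split:
  assumes "n \<ge> 2" "N \<ge> 1"
  shows "flip_diff E (y_stat N n) H = ((- 1) ^ n * flip_diff E (walk_stat N n (simple_edge_walks N (2 * n))) H + error_part N n E H) / 2"
proof -
  have ws: "cyc_stat N n H = walk_stat N n (simple_edge_walks N (2 * n)) H + walk_stat N n (repeating_walks N (2 * n)) H" for H
  proof -
    have "finite (simple_edge_walks N (2 * n))" "finite (repeating_walks N (2 * n))"
      using cyc_walks_split(1)[of N "2 * n"] finite_cyc_walks[of N "2 * n"] by (auto simp: finite_Un)
    then show ?thesis
      unfolding walk_stat_def add_divide_distrib[symmetric] cyc_walks_split(1)[of N "2 * n"]
      using cyc_walks_split(2)[of N "2 * n"] by (simp add: sum.union_disjoint)
  qed
  have "{2..n} = insert n {2..<n}" using assms by auto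
  then have eq: "(\<Sum>l\<in>{2..n}. stat_coeff N n l * flip_diff E (cyc_stat N l) H) =
      (- 1) ^ n * flip_diff E (cyc_stat N n) H + (\<Sum>l\<in>{2..<n}. stat_coeff N n l * flip_diff E (cyc_stat N l) H)"
    using assms by (simp add: stat_coeff_top)
  have "flip_diff E (cyc_stat N n) H = flip_diff E (walk_stat N n (simple_edge_walks N (2 * n))) H + flip_diff E (walk_stat N n (repeating_walks N (2 * n))) H"
    by (simp add: flip_diff_def ws)
  then show ?thesis unfolding flip_diff_y_stat error_part_def eq by (simp add: algebra_simps)
qed

lemma error_part_bound:
  assumes n: "n \<ge> 2"
  shows "\<exists>C. \<forall>N\<ge>2. mean N (\<lambda>H. \<Sum>E\<in>upper_pairs N. (error_part N n E H)\<^sup>2) \<le> C / (real N)\<^sup>2"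
proof -
  obtain Cg where Cg: "Cg \<ge> 0" "\<And>N l. N \<ge> 2 \<Longrightarrow> l < n \<Longrightarrow> \<bar>stat_coeff N n l\<bar> \<le> Cg / real N" using stat_coeff_lower[of n] by blast
  obtain Cr where Cr: "\<And>N. N \<ge> 1 \<Longrightarrow>
      mean N (\<lambda>H. \<Sum>E\<in>upper_pairs N. (flip_diff E (walk_stat N n (repeating_walks N (2 * n))) H)\<^sup>2) \<le> Cr / (real N)\<^sup>2"
    using sum_flip_diff_sq_repeating[of n] n by auto
  have "\<exists>C. \<forall>l. \<forall>N\<ge>1. mean N (\<lambda>H. \<Sum>E\<in>upper_pairs N. (flip_diff E (cyc_stat N l) H)\<^sup>2) \<le> C l"
    using sum_flip_diff_sq_cyc_bounded by metis
  then obtain Cl where Cl: "\<And>l N. N \<ge> 1 \<Longrightarrow> mean N (\<lambda>H. \<Sum>E\<in>upper_pairs N. (flip_diff E (cyc_stat N l) H)\<^sup>2) \<le> Cl l" by blast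
  show ?thesis
  proof (intro exI allI impI)
    fix N :: nat assume N: "N \<ge> 2"
    define P where "P E H = flip_diff E (walk_stat N n (repeating_walks N (2 * n))) H" for E H
    have sq: "(error_part N n E H)\<^sup>2 \<le> 2 * (P E H)\<^sup>2 + 2 * real n * (\<Sum>l\<in>{2..<n}. (stat_coeff N n l)\<^sup>2 * (flip_diff E (cyc_stat N l) H)\<^sup>2)" for E H
    proof -
      define b where "b = (\<Sum>l\<in>{2..<n}. stat_coeff N n l * flip_diff E (cyc_stat N l) H)"
      have "(x + y)\<^sup>2 \<le> 2 * x\<^sup>2 + 2 * y\<^sup>2" for x y :: real
        using sum_squares_bound[of x y] by (simp add: power2_sum)
      then have "(error_part N n E H)\<^sup>2 \<le> 2 * ((- 1) ^ n * P E H)\<^sup>2 + 2 * b\<^sup>2" unfolding error_part_def P_def b_def .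
      also have "((- 1) ^ n * P E H)\<^sup>2 = (P E H)\<^sup>2" by (simp add: power_mult_distrib flip: power_mult)
      also have "b\<^sup>2 \<le> card {2..<n} * (\<Sum>l\<in>{2..<n}. (stat_coeff N n l * flip_diff E (cyc_stat N l) H)\<^sup>2)"
        unfolding b_def by (rule sum_sq_le) simp
      also have "\<dots> \<le> real n * (\<Sum>l\<in>{2..<n}. (stat_coeff N n l * flip_diff E (cyc_stat N l) H)\<^sup>2)"
        by (intro mult_right_mono sum_nonneg) auto
      finally show ?thesis by (simp add: power_mult_distrib)
    qed
    have "mean N (\<lambda>H. \<Sum>E\<in>upper_pairs N. (error_part N n E H)\<^sup>2) \<le>
        mean N (\<lambda>H. \<Sum>E\<in>upper_pairs N. 2 * (P E H)\<^sup>2 + 2 * real n * (\<Sum>l\<in>{2..<n}. (stat_coeff N n l)\<^sup>2 * (flip_diff E (cyc_stat N l) H)\<^sup>2))"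
      by (intro mean_mono sum_mono sq)
    also have "\<dots> = 2 * mean N (\<lambda>H. \<Sum>E\<in>upper_pairs N. (P E H)\<^sup>2) +
        2 * real n * (\<Sum>l\<in>{2..<n}. (stat_coeff N n l)\<^sup>2 * mean N (\<lambda>H. \<Sum>E\<in>upper_pairs N. (flip_diff E (cyc_stat N l) H)\<^sup>2))"
      unfolding sum.distrib mean_add sum_distrib_left[symmetric] mean_cmult sum_mean_swap ..
    also have "\<dots> \<le> 2 * (Cr / (real N)\<^sup>2) + 2 * real n * (\<Sum>l\<in>{2..<n}. Cg\<^sup>2 / (real N)\<^sup>2 * Cl l)"
    proof (intro add_mono mult_left_mono sum_mono mult_mono)
      show "mean N (\<lambda>H. \<Sum>E\<in>upper_pairs N. (P E H)\<^sup>2) \<le> Cr / (real N)\<^sup>2"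
        unfolding P_def using Cr N by simp
      fix l assume l: "l \<in> {2..<n}"
      show "mean N (\<lambda>H. \<Sum>E\<in>upper_pairs N. (flip_diff E (cyc_stat N l) H)\<^sup>2) \<le> Cl l" using Cl N by simp
      have "\<bar>stat_coeff N n l\<bar> \<le> Cg / real N" using Cg l N by simp
      then have "\<bar>stat_coeff N n l\<bar>\<^sup>2 \<le> (Cg / real N)\<^sup>2" by (intro power_mono) auto
      then show "(stat_coeff N n l)\<^sup>2 \<le> Cg\<^sup>2 / (real N)\<^sup>2" by (simp add: power_divide)
      show "0 \<le> mean N (\<lambda>H. \<Sum>E\<in>upper_pairs N. (flip_diff E (cyc_stat N l) H)\<^sup>2)"
        by (intro mean_nonneg sum_nonneg) simp
    qed auto
    also have "\<dots> = (2 * Cr + 2 * real n * (\<Sum>l\<in>{2..<n}. Cg\<^sup>2 * Cl l)) / (real N)\<^sup>2"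
    proof -
      have "(\<Sum>l\<in>{2..<n}. Cg\<^sup>2 / (real N)\<^sup>2 * Cl l) = (\<Sum>l\<in>{2..<n}. Cg\<^sup>2 * Cl l) / (real N)\<^sup>2"
        by (simp add: sum_divide_distrib)
      then show ?thesis by (simp only: add_divide_distrib times_divide_eq_right)
    qed
    finally show "mean N (\<lambda>H. \<Sum>E\<in>upper_pairs N. (error_part N n E H)\<^sup>2) \<le> (2 * Cr + 2 * real n * (\<Sum>l\<in>{2..<n}. Cg\<^sup>2 * Cl l)) / (real N)\<^sup>2" .
  qed
qed

text \<open>The product of the two simple parts carries the limit. Every other product contains an
  error part and is of order 1/N by the weighted inequality.\<close>

lemma R_nm_bound:
  assumes n: "n \<ge> 2" and m: "m \<ge> 2"
  shows "\<exists>C. \<forall>N\<ge>2. mean N (\<lambda>H. cmod (R_nm N n m H)) \<le> C / real N"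
proof -
  obtain C0 where C0: "\<And>N. N \<ge> 1 \<Longrightarrow> mean N (\<lambda>H. \<bar>(\<Sum>E\<in>upper_pairs N.
      flip_diff E (walk_stat N n (simple_edge_walks N (2 * n))) H * flip_diff E (walk_stat N m (simple_edge_walks N (2 * m))) H) / 16
      - (if n = m then 2 * (real n)\<^sup>2 else 0)\<bar>) \<le> C0 / real N"
    using simple_gradient_product[OF n m] by auto
  obtain Cn where Cn: "\<And>N. N \<ge> 1 \<Longrightarrow> mean N (\<lambda>H. \<Sum>E\<in>upper_pairs N. (flip_diff E (walk_stat N n (simple_edge_walks N (2 * n))) H)\<^sup>2) \<le> Cn"
    using sum_flip_diff_sq_simple_bounded[of n] by auto
  obtain Cm where Cm: "\<And>N. N \<ge> 1 \<Longrightarrow> mean N (\<lambda>H. \<Sum>E\<in>upper_pairs N. (flip_diff E (walk_stat N m (simple_edge_walks N (2 * m))) H)\<^sup>2) \<le> Cm"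
    using sum_flip_diff_sq_simple_bounded[of m] by auto
  obtain Rn where Rn: "\<And>N. N \<ge> 2 \<Longrightarrow> mean N (\<lambda>H. \<Sum>E\<in>upper_pairs N. (error_part N n E H)\<^sup>2) \<le> Rn / (real N)\<^sup>2"
    using error_part_bound[OF n] by auto
  obtain Rm where Rm: "\<And>N. N \<ge> 2 \<Longrightarrow> mean N (\<lambda>H. \<Sum>E\<in>upper_pairs N. (error_part N m E H)\<^sup>2) \<le> Rm / (real N)\<^sup>2"
    using error_part_bound[OF m] by auto
  show ?thesis
  proof (intro exI allI impI)
    fix N :: nat assume N: "N \<ge> 2"
    define dn where "dn E H = flip_diff E (walk_stat N n (simple_edge_walks N (2 * n))) H" for E H
    define dm where "dm E H = flip_diff E (walk_stat N m (simple_edge_walks N (2 * m))) H" for E H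
    define rn where "rn = error_part N n"
    define rm where "rm = error_part N m"
    define U where "U = upper_pairs N"
    define \<delta> where "\<delta> = (if n = m then 2 * (real n)\<^sup>2 else 0)"
    have pw: "cmod (R_nm N n m H) \<le> \<bar>(\<Sum>E\<in>U. dn E H * dm E H) / 16 - \<delta>\<bar> +
        ((\<Sum>E\<in>U. \<bar>dn E H\<bar> * \<bar>rm E H\<bar>) + (\<Sum>E\<in>U. \<bar>dm E H\<bar> * \<bar>rn E H\<bar>) + (\<Sum>E\<in>U. \<bar>rn E H\<bar> * \<bar>rm E H\<bar>))"
      if H: "H \<in> imag_tournaments N" for H
    proof -
      define s where "s = (- 1 :: real) ^ n * (- 1) ^ m"
      define A where "A = (\<Sum>E\<in>U. dn E H * dm E H)"
      define B where "B E = (- 1) ^ n * dn E H * rm E H + (- 1) ^ m * dm E H * rn E H + rn E H * rm E H" for E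
      have "flip_diff E (y_stat N n) H * flip_diff E (y_stat N m) H = (s * (dn E H * dm E H) + B E) / 4" for E
      proof -
        have "((p * x + a) / 2) * ((q * y + b) / 2) = (p * q * (x * y) + (p * x * b + q * y * a + a * b)) / 4" for p q x y a b :: real
          by (simp add: algebra_simps)
        moreover have "N \<ge> 1" using N by simp
        ultimately show ?thesis
          unfolding flip_diff_y_stat_split[OF n \<open>N \<ge> 1\<close>] flip_diff_y_stat_split[OF m \<open>N \<ge> 1\<close>] s_def B_def dn_def dm_def rn_def rm_def
          by blast
      qed
      then have "(\<Sum>E\<in>U. flip_diff E (y_stat N n) H * flip_diff E (y_stat N m) H) / 4 - \<delta> = (s * A / 16 - \<delta>) + (\<Sum>E\<in>U. B E) / 16"
        by (simp add: A_def sum_divide_distrib[symmetric] sum.distrib sum_distrib_left[symmetric] add_divide_distrib)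
      then have "cmod (R_nm N n m H) = \<bar>(s * A / 16 - \<delta>) + (\<Sum>E\<in>U. B E) / 16\<bar>"
        unfolding R_nm_eq[OF n m N H] norm_of_real U_def \<delta>_def by (simp only:)
      also have "\<dots> \<le> \<bar>s * A / 16 - \<delta>\<bar> + \<bar>\<Sum>E\<in>U. B E\<bar>" by linarith
      \<comment> \<open>The sign is 1 when the indices agree; when they differ there is no constant
        to subtract, and the absolute value absorbs it.\<close>
      also have "\<bar>s * A / 16 - \<delta>\<bar> = \<bar>A / 16 - \<delta>\<bar>"
      proof (cases "n = m")
        case True
        then have "s = 1" by (simp add: s_def flip: power_add mult_2)
        then show ?thesis by simp
      next
        case False
        then show ?thesis by (simp add: \<delta>_def abs_mult s_def power_abs)
      qed
      also have "\<bar>\<Sum>E\<in>U. B E\<bar> \<le> (\<Sum>E\<in>U. \<bar>dn E H\<bar> * \<bar>rm E H\<bar> + \<bar>dm E H\<bar> * \<bar>rn E H\<bar> + \<bar>rn E H\<bar> * \<bar>rm E H\<bar>)"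
      proof (rule order_trans[OF sum_abs], rule sum_mono)
        fix E
        have "\<bar>B E\<bar> \<le> \<bar>(- 1) ^ n * dn E H * rm E H\<bar> + \<bar>(- 1) ^ m * dm E H * rn E H\<bar> + \<bar>rn E H * rm E H\<bar>"
          unfolding B_def by linarith
        then show "\<bar>B E\<bar> \<le> \<bar>dn E H\<bar> * \<bar>rm E H\<bar> + \<bar>dm E H\<bar> * \<bar>rn E H\<bar> + \<bar>rn E H\<bar> * \<bar>rm E H\<bar>"
          by (simp add: abs_mult power_abs)
      qed
      finally show ?thesis by (simp add: A_def sum.distrib)
    qed
    have N0: "real N > 0" using N by simp
    have sq: "real N * (c / (real N)\<^sup>2) = c / real N" for c using N by (simp add: power2_eq_square)
    have "mean N (\<lambda>H. cmod (R_nm N n m H)) \<le> mean N (\<lambda>H. \<bar>(\<Sum>E\<in>U. dn E H * dm E H) / 16 - \<delta>\<bar> +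
        ((\<Sum>E\<in>U. \<bar>dn E H\<bar> * \<bar>rm E H\<bar>) + (\<Sum>E\<in>U. \<bar>dm E H\<bar> * \<bar>rn E H\<bar>) + (\<Sum>E\<in>U. \<bar>rn E H\<bar> * \<bar>rm E H\<bar>)))"
      by (rule mean_mono[OF pw])
    also have "\<dots> = mean N (\<lambda>H. \<bar>(\<Sum>E\<in>U. dn E H * dm E H) / 16 - \<delta>\<bar>) + (mean N (\<lambda>H. \<Sum>E\<in>U. \<bar>dn E H\<bar> * \<bar>rm E H\<bar>)
        + mean N (\<lambda>H. \<Sum>E\<in>U. \<bar>dm E H\<bar> * \<bar>rn E H\<bar>) + mean N (\<lambda>H. \<Sum>E\<in>U. \<bar>rn E H\<bar> * \<bar>rm E H\<bar>))"
      by (simp only: mean_add)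
    also have "\<dots> \<le> C0 / real N + ((Cn + Rm) / real N + (Cm + Rn) / real N + (\<bar>Rn\<bar> + \<bar>Rm\<bar>) / real N)"
    proof (intro add_mono)
      show "mean N (\<lambda>H. \<bar>(\<Sum>E\<in>U. dn E H * dm E H) / 16 - \<delta>\<bar>) \<le> C0 / real N"
        using C0[of N] N unfolding dn_def dm_def U_def \<delta>_def by simp
      have Sn: "mean N (\<lambda>H. \<Sum>E\<in>U. (dn E H)\<^sup>2) \<le> Cn" using Cn[of N] N by (simp add: dn_def U_def)
      have Sm: "mean N (\<lambda>H. \<Sum>E\<in>U. (dm E H)\<^sup>2) \<le> Cm" using Cm[of N] N by (simp add: dm_def U_def)
      have Tn: "mean N (\<lambda>H. \<Sum>E\<in>U. (rn E H)\<^sup>2) \<le> Rn / (real N)\<^sup>2" using Rn[OF N] by (simp add: rn_def U_def)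
      have Tm: "mean N (\<lambda>H. \<Sum>E\<in>U. (rm E H)\<^sup>2) \<le> Rm / (real N)\<^sup>2" using Rm[OF N] by (simp add: rm_def U_def)
      have nn: "mean N (\<lambda>H. \<Sum>E\<in>U. (f E H)\<^sup>2) \<ge> 0" for f by (intro mean_nonneg sum_nonneg) simp
      have gen: "mean N (\<lambda>H. \<Sum>E\<in>U. \<bar>f E H\<bar> * \<bar>g E H\<bar>) \<le> (c + c') / real N"
        if f: "mean N (\<lambda>H. \<Sum>E\<in>U. (f E H)\<^sup>2) \<le> c" and g: "mean N (\<lambda>H. \<Sum>E\<in>U. (g E H)\<^sup>2) \<le> c' / (real N)\<^sup>2" for f g c c'
      proof -
        have "mean N (\<lambda>H. \<Sum>E\<in>U. \<bar>f E H\<bar> * \<bar>g E H\<bar>) \<le>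
            (mean N (\<lambda>H. \<Sum>E\<in>U. (f E H)\<^sup>2) / real N + real N * mean N (\<lambda>H. \<Sum>E\<in>U. (g E H)\<^sup>2)) / 2"
          by (rule mean_sum_abs_mult_le[OF N0])
        also have "\<dots> \<le> (c / real N + real N * (c' / (real N)\<^sup>2)) / 2"
          using f g N0 by (intro divide_right_mono add_mono mult_left_mono) auto
        also have "\<dots> = ((c + c') / real N) / 2" unfolding sq by (simp add: add_divide_distrib)
        also have "\<dots> \<le> (c + c') / real N"
        proof -
          have "c \<ge> 0" using nn[of f] f by linarith
          moreover have "0 \<le> c' / (real N)\<^sup>2" using nn[of g] g by linarith
          then have "c' \<ge> 0" using N0 by (simp add: zero_le_divide_iff)
          ultimately have "(c + c') / real N \<ge> 0" by simp
          moreover have "x / 2 \<le> x" if "x \<ge> 0" for x :: real using that by simp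
          ultimately show ?thesis by blast
        qed
        finally show ?thesis .
      qed
      show "mean N (\<lambda>H. \<Sum>E\<in>U. \<bar>dn E H\<bar> * \<bar>rm E H\<bar>) \<le> (Cn + Rm) / real N" by (rule gen[OF Sn Tm])
      show "mean N (\<lambda>H. \<Sum>E\<in>U. \<bar>dm E H\<bar> * \<bar>rn E H\<bar>) \<le> (Cm + Rn) / real N" by (rule gen[OF Sm Tn])
      \<comment> \<open>In the product of two error parts, one factor is used only through a bounded
        second moment, so the same estimate \<open>gen\<close> applies.\<close>
      have "Rn / (real N)\<^sup>2 \<le> \<bar>Rn\<bar>"
      proof -
        have "Rn / (real N)\<^sup>2 \<le> \<bar>Rn\<bar> / (real N)\<^sup>2" by (intro divide_right_mono) auto
        also have "\<dots> \<le> \<bar>Rn\<bar> / 1" using N by (intro divide_left_mono) (auto intro: one_le_power)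
        finally show ?thesis by simp
      qed
      then have Tn': "mean N (\<lambda>H. \<Sum>E\<in>U. (rn E H)\<^sup>2) \<le> \<bar>Rn\<bar>" using Tn by linarith
      have "Rm / (real N)\<^sup>2 \<le> \<bar>Rm\<bar> / (real N)\<^sup>2" by (intro divide_right_mono) auto
      then have Tm': "mean N (\<lambda>H. \<Sum>E\<in>U. (rm E H)\<^sup>2) \<le> \<bar>Rm\<bar> / (real N)\<^sup>2" using Tm by linarith
      show "mean N (\<lambda>H. \<Sum>E\<in>U. \<bar>rn E H\<bar> * \<bar>rm E H\<bar>) \<le> (\<bar>Rn\<bar> + \<bar>Rm\<bar>) / real N" by (rule gen[OF Tn' Tm'])
    qed
    also have "\<dots> = (C0 + ((Cn + Rm) + (Cm + Rn) + (\<bar>Rn\<bar> + \<bar>Rm\<bar>))) / real N" by (simp only: add_divide_distrib)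
    finally show "mean N (\<lambda>H. cmod (R_nm N n m H)) \<le> (C0 + ((Cn + Rm) + (Cm + Rn) + (\<bar>Rn\<bar> + \<bar>Rm\<bar>))) / real N" .
  qed
qed

text \<open>This interpolates the third power between the second and the fourth, from
  \<open>(a * y - 1)^2 * y^2 >= 0\<close> with \<open>y\<close> the absolute value of
  \<open>x\<close>.\<close>

lemma abs_cube_le:
  fixes x :: real assumes "a > 0"
  shows "\<bar>x\<bar> ^ 3 \<le> a * x ^ 4 + x\<^sup>2 / a"
proof -
  define y where "y = \<bar>x\<bar>"
  have y: "x\<^sup>2 = y\<^sup>2" "x ^ 4 = y ^ 4" "y ^ 3 \<ge> 0" by (simp_all add: y_def)
  have "0 \<le> (a * y - 1)\<^sup>2 * y\<^sup>2 / a" using assms by simp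
  also have "\<dots> = a * y ^ 4 + y\<^sup>2 / a - 2 * y ^ 3"
    using assms by (simp add: field_simps power2_eq_square power3_eq_cube power4_eq_xxxx)
  finally have "y ^ 3 \<le> a * y ^ 4 + y\<^sup>2 / a" using y(3) by linarith
  then show ?thesis unfolding y(1,2) y_def[symmetric] .
qed

text \<open>The summed squares have bounded mean and the summed fourth powers have mean of order
  \<open>N^-2\<close>; interpolation with weight \<open>N\<close> puts both contributions at order
  1/N.\<close>

lemma flip_diff_y_stat_moments:
  assumes n: "n \<ge> 2"
  shows "\<exists>C. \<forall>N\<ge>2. mean N (\<lambda>H. \<Sum>E\<in>upper_pairs N. \<bar>flip_diff E (y_stat N n) H\<bar> ^ 3) \<le> C / real N"
proof -
  obtain G where G: "G \<ge> 0" "\<And>N l. N \<ge> 2 \<Longrightarrow> l \<in> {2..n} \<Longrightarrow> \<bar>stat_coeff N n l\<bar> \<le> G" using stat_coeff_bounded[of n] by blast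
  have "\<exists>C. \<forall>l. \<forall>N\<ge>1. mean N (\<lambda>H. \<Sum>E\<in>upper_pairs N. (flip_diff E (cyc_stat N l) H)\<^sup>2) \<le> C l"
    using sum_flip_diff_sq_cyc_bounded by metis
  then obtain C2 where C2: "\<And>l N. N \<ge> 1 \<Longrightarrow> mean N (\<lambda>H. \<Sum>E\<in>upper_pairs N. (flip_diff E (cyc_stat N l) H)\<^sup>2) \<le> C2 l" by blast
  have "\<exists>C. \<forall>l\<ge>1. \<forall>N\<ge>1. mean N (\<lambda>H. \<Sum>E\<in>upper_pairs N. (flip_diff E (cyc_stat N l) H) ^ 4) \<le> C l / (real N)\<^sup>2"
    using sum_flip_diff_fourth by metis
  then obtain C4 where C4: "\<And>l N. l \<ge> 1 \<Longrightarrow> N \<ge> 1 \<Longrightarrow>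
      mean N (\<lambda>H. \<Sum>E\<in>upper_pairs N. (flip_diff E (cyc_stat N l) H) ^ 4) \<le> C4 l / (real N)\<^sup>2" by blast
  \<comment> \<open>The powers of \<open>n\<close> come from Cauchy-Schwarz over the at most
    \<open>n\<close> lengths: once for the square, and a second time, on the squares, for the fourth
    power, which gives \<open>n^2 * n\<close>.\<close>
  define K2 where "K2 = real n * (\<Sum>l\<in>{2..n}. G\<^sup>2 * C2 l)"
  define K4 where "K4 = real n ^ 3 * (\<Sum>l\<in>{2..n}. G ^ 4 * C4 l)"
  show ?thesis
  proof (intro exI allI impI)
    fix N :: nat assume N: "N \<ge> 2"
    define U where "U = upper_pairs N"
    define D where "D l E H = flip_diff E (cyc_stat N l) H" for l E H
    have sq: "(flip_diff E (y_stat N n) H)\<^sup>2 \<le> real n * (\<Sum>l\<in>{2..n}. G\<^sup>2 * (D l E H)\<^sup>2)"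
      and fourth: "(flip_diff E (y_stat N n) H) ^ 4 \<le> real n ^ 3 * (\<Sum>l\<in>{2..n}. G ^ 4 * (D l E H) ^ 4)" for E H
    proof -
      define x where "x l = stat_coeff N n l * D l E H" for l
      have y: "flip_diff E (y_stat N n) H = (\<Sum>l\<in>{2..n}. x l) / 2" by (simp add: flip_diff_y_stat x_def D_def)
      have half: "(flip_diff E (y_stat N n) H)\<^sup>2 \<le> (\<Sum>l\<in>{2..n}. x l)\<^sup>2"
        unfolding y by (simp add: power_divide)
      have "(\<Sum>l\<in>{2..n}. x l)\<^sup>2 \<le> card {2..n} * (\<Sum>l\<in>{2..n}. (x l)\<^sup>2)" by (rule sum_sq_le) simp
      also have "\<dots> \<le> real n * (\<Sum>l\<in>{2..n}. (x l)\<^sup>2)" by (intro mult_right_mono sum_nonneg) auto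
      finally have 1: "(flip_diff E (y_stat N n) H)\<^sup>2 \<le> real n * (\<Sum>l\<in>{2..n}. (x l)\<^sup>2)" using half by linarith
      have xb: "(x l)\<^sup>2 \<le> G\<^sup>2 * (D l E H)\<^sup>2" if "l \<in> {2..n}" for l
      proof -
        have "\<bar>stat_coeff N n l\<bar>\<^sup>2 \<le> G\<^sup>2" using G(2)[OF N that] by (intro power_mono) auto
        then show ?thesis unfolding x_def power_mult_distrib by (intro mult_right_mono) auto
      qed
      have "real n * (\<Sum>l\<in>{2..n}. (x l)\<^sup>2) \<le> real n * (\<Sum>l\<in>{2..n}. G\<^sup>2 * (D l E H)\<^sup>2)"
        using xb by (intro mult_left_mono sum_mono) auto
      then show "(flip_diff E (y_stat N n) H)\<^sup>2 \<le> real n * (\<Sum>l\<in>{2..n}. G\<^sup>2 * (D l E H)\<^sup>2)" using 1 by linarith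
      have "((flip_diff E (y_stat N n) H)\<^sup>2)\<^sup>2 \<le> (real n * (\<Sum>l\<in>{2..n}. (x l)\<^sup>2))\<^sup>2"
        using 1 by (intro power_mono) auto
      also have "\<dots> = (real n)\<^sup>2 * (\<Sum>l\<in>{2..n}. (x l)\<^sup>2)\<^sup>2" by (rule power_mult_distrib)
      also have "\<dots> \<le> (real n)\<^sup>2 * (card {2..n} * (\<Sum>l\<in>{2..n}. ((x l)\<^sup>2)\<^sup>2))"
        by (intro mult_left_mono sum_sq_le) auto
      also have "\<dots> \<le> (real n)\<^sup>2 * (real n * (\<Sum>l\<in>{2..n}. (G\<^sup>2 * (D l E H)\<^sup>2)\<^sup>2))"
        using xb by (intro mult_left_mono mult_mono sum_mono power_mono sum_nonneg) auto
      also have "\<dots> = real n ^ 3 * (\<Sum>l\<in>{2..n}. G ^ 4 * (D l E H) ^ 4)"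
      proof -
        have "(G\<^sup>2 * (D l E H)\<^sup>2)\<^sup>2 = G ^ 4 * (D l E H) ^ 4" for l
          by (simp add: power_mult_distrib flip: power_mult)
        then show ?thesis by (simp add: power3_eq_cube power2_eq_square)
      qed
      finally show "(flip_diff E (y_stat N n) H) ^ 4 \<le> real n ^ 3 * (\<Sum>l\<in>{2..n}. G ^ 4 * (D l E H) ^ 4)"
        by (simp flip: power_mult)
    qed
    have S2: "mean N (\<lambda>H. \<Sum>E\<in>U. (flip_diff E (y_stat N n) H)\<^sup>2) \<le> K2"
    proof -
      have "mean N (\<lambda>H. \<Sum>E\<in>U. (flip_diff E (y_stat N n) H)\<^sup>2) \<le> mean N (\<lambda>H. \<Sum>E\<in>U. real n * (\<Sum>l\<in>{2..n}. G\<^sup>2 * (D l E H)\<^sup>2))"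
        by (intro mean_mono sum_mono sq)
      also have "\<dots> = real n * (\<Sum>l\<in>{2..n}. G\<^sup>2 * mean N (\<lambda>H. \<Sum>E\<in>U. (D l E H)\<^sup>2))"
        unfolding sum_distrib_left[symmetric] mean_cmult sum_mean_swap ..
      also have "\<dots> \<le> K2" unfolding K2_def U_def D_def using C2 N by (intro mult_left_mono sum_mono) auto
      finally show ?thesis .
    qed
    have S4: "mean N (\<lambda>H. \<Sum>E\<in>U. (flip_diff E (y_stat N n) H) ^ 4) \<le> K4 / (real N)\<^sup>2"
    proof -
      have "mean N (\<lambda>H. \<Sum>E\<in>U. (flip_diff E (y_stat N n) H) ^ 4) \<le> mean N (\<lambda>H. \<Sum>E\<in>U. real n ^ 3 * (\<Sum>l\<in>{2..n}. G ^ 4 * (D l E H) ^ 4))"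
        by (intro mean_mono sum_mono fourth)
      also have "\<dots> = real n ^ 3 * (\<Sum>l\<in>{2..n}. G ^ 4 * mean N (\<lambda>H. \<Sum>E\<in>U. (D l E H) ^ 4))"
        unfolding sum_distrib_left[symmetric] mean_cmult sum_mean_swap ..
      also have "\<dots> \<le> real n ^ 3 * (\<Sum>l\<in>{2..n}. G ^ 4 * (C4 l / (real N)\<^sup>2))"
        unfolding U_def D_def using C4 N G(1) by (intro mult_left_mono sum_mono) auto
      also have "\<dots> = K4 / (real N)\<^sup>2"
      proof -
        have "(\<Sum>l\<in>{2..n}. G ^ 4 * (C4 l / (real N)\<^sup>2)) = (\<Sum>l\<in>{2..n}. G ^ 4 * C4 l) / (real N)\<^sup>2"
          by (simp add: sum_divide_distrib)
        then show ?thesis by (simp only: K4_def times_divide_eq_right)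
      qed
      finally show ?thesis .
    qed
    have N0: "real N > 0" using N by simp
    have "mean N (\<lambda>H. \<Sum>E\<in>U. \<bar>flip_diff E (y_stat N n) H\<bar> ^ 3) \<le>
        mean N (\<lambda>H. real N * (\<Sum>E\<in>U. (flip_diff E (y_stat N n) H) ^ 4) + 1 / real N * (\<Sum>E\<in>U. (flip_diff E (y_stat N n) H)\<^sup>2))"
      unfolding sum_distrib_left sum.distrib[symmetric] using abs_cube_le[OF N0]
      by (intro mean_mono sum_mono) simp
    also have "\<dots> = real N * mean N (\<lambda>H. \<Sum>E\<in>U. (flip_diff E (y_stat N n) H) ^ 4) + 1 / real N * mean N (\<lambda>H. \<Sum>E\<in>U. (flip_diff E (y_stat N n) H)\<^sup>2)"
      by (simp only: mean_add mean_cmult)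
    also have "\<dots> \<le> real N * (K4 / (real N)\<^sup>2) + 1 / real N * K2"
      using S2 S4 by (intro add_mono mult_left_mono) auto
    also have "\<dots> = (K4 + K2) / real N" using N by (simp add: power2_eq_square add_divide_distrib)
    finally show "mean N (\<lambda>H. \<Sum>E\<in>upper_pairs N. \<bar>flip_diff E (y_stat N n) H\<bar> ^ 3) \<le> (K4 + K2) / real N"
      unfolding U_def .
  qed
qed

lemma triple_product_le:
  fixes x y z :: real assumes "x \<ge> 0" "y \<ge> 0" "z \<ge> 0"
  shows "x * y * z \<le> x ^ 3 + y ^ 3 + z ^ 3"
proof -
  define M where "M = max x (max y z)"
  have "x * y * z \<le> M * M * M" using assms by (intro mult_mono) (auto simp: M_def)
  also have "\<dots> = M ^ 3" by (simp add: power3_eq_cube)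
  also have "\<dots> \<le> x ^ 3 + y ^ 3 + z ^ 3"
    using assms by (auto simp: M_def max_def)
  finally show ?thesis .
qed

lemma R_nml_bound:
  assumes n: "n \<ge> 2" and m: "m \<ge> 2" and l: "l \<ge> 2"
  shows "\<exists>C. \<forall>N\<ge>2. mean N (\<lambda>H. \<bar>R_nml N n m l H\<bar>) \<le> C / real N"
proof -
  obtain Cn where Cn: "\<And>N. N \<ge> 2 \<Longrightarrow> mean N (\<lambda>H. \<Sum>E\<in>upper_pairs N. \<bar>flip_diff E (y_stat N n) H\<bar> ^ 3) \<le> Cn / real N"
    using flip_diff_y_stat_moments[OF n] by auto
  obtain Cm where Cm: "\<And>N. N \<ge> 2 \<Longrightarrow> mean N (\<lambda>H. \<Sum>E\<in>upper_pairs N. \<bar>flip_diff E (y_stat N m) H\<bar> ^ 3) \<le> Cm / real N"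
    using flip_diff_y_stat_moments[OF m] by auto
  obtain Cl where Cl: "\<And>N. N \<ge> 2 \<Longrightarrow> mean N (\<lambda>H. \<Sum>E\<in>upper_pairs N. \<bar>flip_diff E (y_stat N l) H\<bar> ^ 3) \<le> Cl / real N"
    using flip_diff_y_stat_moments[OF l] by auto
  show ?thesis
  proof (intro exI allI impI)
    fix N :: nat assume N: "N \<ge> 2"
    define a where "a n H = (\<Sum>E\<in>upper_pairs N. \<bar>flip_diff E (y_stat N n) H\<bar> ^ 3)" for n H
    have "mean N (\<lambda>H. \<bar>R_nml N n m l H\<bar>) \<le> mean N (\<lambda>H. a n H + a m H + a l H)"
    proof (rule mean_mono)
      fix H assume H: "H \<in> imag_tournaments N"
      define b where "b = (\<Sum>E\<in>upper_pairs N. \<bar>flip_diff E (y_stat N n) H\<bar> * \<bar>flip_diff E (y_stat N m) H\<bar> * \<bar>flip_diff E (y_stat N l) H\<bar>)"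
      have "b \<ge> 0" unfolding b_def by (intro sum_nonneg) simp
      then have "\<bar>R_nml N n m l H\<bar> \<le> b" using R_nml_eq[OF n m l N H] by (simp add: b_def[symmetric])
      also have "b \<le> a n H + a m H + a l H"
        unfolding a_def b_def sum.distrib[symmetric] by (intro sum_mono triple_product_le) auto
      finally show "\<bar>R_nml N n m l H\<bar> \<le> a n H + a m H + a l H" .
    qed
    also have "\<dots> = mean N (a n) + mean N (a m) + mean N (a l)" by (simp only: mean_add)
    also have "\<dots> \<le> Cn / real N + Cm / real N + Cl / real N"
      using Cn[OF N] Cm[OF N] Cl[OF N] unfolding a_def by (intro add_mono)
    also have "\<dots> = (Cn + Cm + Cl) / real N" by (simp only: add_divide_distrib)
    finally show "mean N (\<lambda>H. \<bar>R_nml N n m l H\<bar>) \<le> (Cn + Cm + Cl) / real N" .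
  qed
qed

lemma expectation_bigo:
  assumes "\<exists>C. \<forall>N\<ge>2. mean N (f N) \<le> C / real N" and "\<And>N H. f N H \<ge> 0"
  shows "(\<lambda>N. measure_pmf.expectation (ite N) (f N)) \<in> O(\<lambda>N. 1 / real N)"
proof -
  obtain C where C: "\<And>N. N \<ge> 2 \<Longrightarrow> mean N (f N) \<le> C / real N" using assms(1) by blast
  show ?thesis
  proof (rule bigoI[of _ C], rule eventually_mono[OF eventually_ge_at_top[of 2]])
    fix N :: nat assume N: "N \<ge> 2"
    have "mean N (f N) \<ge> 0" using assms(2) by (rule mean_nonneg)
    then show "norm (measure_pmf.expectation (ite N) (f N)) \<le> C * norm (1 / real N)"
      using C[OF N] by (simp add: expectation_ite)
  qed
qed

theorem proposition4p1:
  fixes k n m l :: nat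
  assumes "k \<ge> 2" and "n \<in> {2..k}" and "m \<in> {2..k}" and "l \<in> {2..k}"
  shows "(\<lambda>N. measure_pmf.expectation (ite N) (\<lambda>H. cmod (R_n N n H))) \<in> O(\<lambda>N. 1 / real N) \<and>
    (\<lambda>N. measure_pmf.expectation (ite N) (\<lambda>H. cmod (R_nm N n m H))) \<in> O(\<lambda>N. 1 / real N) \<and>
    (\<lambda>N. measure_pmf.expectation (ite N) (\<lambda>H. \<bar>R_nml N n m l H\<bar>)) \<in> O(\<lambda>N. 1 / real N)"
  using assms by (intro conjI expectation_bigo R_n_bound R_nm_bound R_nml_bound) auto

end
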